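(* Let $n\in\{2,3\}$ and let $p=p_0(n):=\dfrac{n+1+\sqrt{n^2+10n-7}}{2(n-1)}$. Let $f,g:\mathbb{R}^n\to\mathbb{R}$ be smooth functions such that $f\equiv 0$, $g(x)\ge 0$ for all $x\in\mathbb{R}^n$, and $g\not\equiv 0$. Then there exist a constant $\varepsilon_0=\varepsilon_0(n,p,g)>0$ and a constant $C>0$ independent of $\varepsilon$ such that, for every $\varepsilon$ with $0<\varepsilon\le\varepsilon_0$ and every $T$ with $$T>\exp\left(C\varepsilon^{-p(p-1)}\right),$$ there is no classical solution $u:\mathbb{R}^n\times[0,T)\to\mathbb{R}$ of the initial value problem $$u_{tt}-\Delta u=|u|^p\quad\text{in }\mathbb{R}^n\times(0,T),\qquad u(x,0)=\varepsilon f(x),\quad u_t(x,0)=\varepsilon g(x)\quad\text{for }x\in\mathbb{R}^n.$$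
   Context: The number $p_0(n)$ is the Strauss exponent, i.e. the positive root $p$ of $\gamma(n,p)=0$, where $\gamma(n,p):=1+\frac{n+1}{2}p-\frac{n-1}{2}p^2$. Thus $p_0(2)=\frac{3+\sqrt{17}}{2}$ and $p_0(3)=1+\sqrt{2}$, both greater than $2$. A classical solution on $\mathbb{R}^n\times[0,T)$ means a function $u\in C^2(\mathbb{R}^n\times[0,T))$ satisfying the equation and the initial conditions pointwise. The function $g$ is not assumed to have compact support. *)

theory Defs
  imports "HOL-Analysis.Analysis"
begin

definition strauss_gamma :: "nat \<Rightarrow> real \<Rightarrow> real" where
  "strauss_gamma n p = 1 + (real n + 1) / 2 * p - (real n - 1) / 2 * p\<^sup>2"

definition strauss_exponent :: "nat \<Rightarrow> real" where
  "strauss_exponent n =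
     (real n + 1 + sqrt ((real n)\<^sup>2 + 10 * real n - 7)) / (2 * (real n - 1))"

lemma strauss_gamma_eq_0_iff:
  assumes "n \<ge> 2" and "p > 0"
  shows "strauss_gamma n p = 0 \<longleftrightarrow> p = strauss_exponent n"
proof -
  define m where "m = real n - 1"
  have m: "m \<ge> 1" and n: "real n = m + 1" using assms by (auto simp: m_def)
  define s where "s = sqrt ((real n)\<^sup>2 + 10 * real n - 7)"
  have eq: "(real n)\<^sup>2 + 10 * real n - 7 = (m + 2)\<^sup>2 + 8 * m"
    by (simp add: n power2_eq_square algebra_simps)
  have s2: "s\<^sup>2 = (m + 2)\<^sup>2 + 8 * m"
    unfolding s_def eq using m by (intro real_sqrt_pow2) simp
  have "m + 2 < s"
    using m unfolding s_def eq by (intro real_less_rsqrt) simp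
  then have pos: "2 * m * p - (m + 2) + s > 0"
    using m assms(2) by (smt (verit) mult_pos_pos)
  have "8 * m * strauss_gamma n p =
        - (2 * m * p - (m + 2) - s) * (2 * m * p - (m + 2) + s)"
    using s2 by (simp add: strauss_gamma_def n power2_eq_square field_simps)
  then have "strauss_gamma n p = 0 \<longleftrightarrow> 2 * m * p - (m + 2) - s = 0"
    using m pos by (smt (verit) mult_eq_0_iff)
  also have "\<dots> \<longleftrightarrow> p = strauss_exponent n"
    using m unfolding strauss_exponent_def s_def[symmetric] by (auto simp: n field_simps)
  finally show ?thesis .
qed

text \<open>
  The class \<open>C\<^sup>k(S)\<close>. Derivatives are taken within \<open>S\<close>, so they are one-sided at
  boundary points belonging to \<open>S\<close>. For convex \<open>S\<close> with nonempty interior they are unique,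
  and the definition says that the partial derivatives up to order \<open>k\<close> exist in the interior and
  extend continuously to \<open>S\<close>.
\<close>

primrec Ck_on :: "nat \<Rightarrow> ('a::real_normed_vector \<Rightarrow> real) \<Rightarrow> 'a set \<Rightarrow> bool" where
  "Ck_on 0 f S \<longleftrightarrow> continuous_on S f"
| "Ck_on (Suc k) f S \<longleftrightarrow>
     (\<exists>f'. (\<forall>x\<in>S. (f has_derivative f' x) (at x within S)) \<and> (\<forall>v. Ck_on k (\<lambda>x. f' x v) S))"

definition smooth :: "('a::real_normed_vector \<Rightarrow> real) \<Rightarrow> bool" where
  "smooth f \<longleftrightarrow> (\<forall>k. Ck_on k f UNIV)"

definition laplacian :: "(real ^ 'n \<Rightarrow> real) \<Rightarrow> real ^ 'n \<Rightarrow> real" where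
  "laplacian v x = (\<Sum>i\<in>UNIV. (deriv ^^ 2) (\<lambda>s. v (x + s *\<^sub>R axis i 1)) 0)"

text \<open>
  A classical solution on \<open>\<real>\<^sup>n \<times> [0,T)\<close> of \<open>u\<^sub>t\<^sub>t - \<Delta>u = |u|\<^sup>p\<close> with initial position \<open>\<phi>\<close>
  and initial velocity \<open>\<psi>\<close>. The values of \<open>u\<close> outside this set are irrelevant; the time
  derivative at \<open>t = 0\<close> is one-sided.
\<close>

definition classical_solution ::
  "real \<Rightarrow> real \<Rightarrow> (real ^ 'n \<Rightarrow> real) \<Rightarrow> (real ^ 'n \<Rightarrow> real) \<Rightarrow> ((real ^ 'n) \<times> real \<Rightarrow> real) \<Rightarrow> bool"
where
  "classical_solution p T \<phi> \<psi> u \<longleftrightarrow>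
     Ck_on 2 u (UNIV \<times> {0..<T}) \<and>
     (\<forall>x. \<forall>t\<in>{0<..<T}.
        (deriv ^^ 2) (\<lambda>s. u (x, s)) t - laplacian (\<lambda>y. u (y, t)) x = \<bar>u (x, t)\<bar> powr p) \<and>
     (\<forall>x. u (x, 0) = \<phi> x) \<and>
     (\<forall>x. ((\<lambda>s. u (x, s)) has_real_derivative \<psi> x) (at 0 within {0..<T}))"

end

theory Submission
  imports Defs
begin

text \<open>
  Everything rests on a comparison principle. For \<open>n \<le> 3\<close> the wave equation is positivity
  preserving: testing a function \<open>w\<close> with \<open>\<box>w \<ge> 0\<close> against an explicit nonnegative radial solution
  of the backward problem in three dimensions, concentrated near the surface of a backward cone,
  gives \<open>w \<ge> 0\<close> at its tip; two dimensions follow by descent. Hence a solution \<open>u\<close> dominates every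
  subsolution \<open>v\<close> on backward cones, and no compact support is needed.

  With \<open>m = (n - 1) / 2\<close> the ansatz \<open>v = r\<^bsup>-m\<^esup> V\<close> turns the problem into one in the characteristic
  coordinates \<open>X \<sim> t - r\<close> and \<open>\<beta> \<sim> t + r\<close>, since
  \<open>\<box>v = r\<^bsup>-m\<^esup> (V\<^sub>t\<^sub>t - V\<^sub>r\<^sub>r - m (1 - m) V / r\<^sup>2)\<close> and \<open>m (1 - m) \<ge> 0\<close>. Three subsolutions are used.
  \<^item> A free outgoing wave gives \<open>u \<ge> c \<epsilon> r\<^bsup>-m\<^esup>\<close> in a strip along the light cone.
  \<^item> Criticality means \<open>p q = 1\<close> and \<open>m (p - 1) = 1 + q\<close> for \<open>q = m p - m - 1\<close>. It makes
    \<open>V = N (ln X) X\<^bsup>2q\<^esup> ((8 X)\<^bsup>-q\<^esup> - \<beta>\<^bsup>-q\<^esup>)\<^sub>+\<^sup>3\<close> a subsolution when \<open>N' = c N\<^sup>p\<close>, that is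
    \<open>N s = \<mu> (A - s)\<^bsup>-1/(p-1)\<^esup>\<close>. The strip carries \<open>N\<close> of size \<open>\<epsilon>\<^sup>p\<close>, whence \<open>A \<sim> \<epsilon>\<^bsup>-p(p-1)\<^esup>\<close>, and at
    time \<open>exp A\<close> the factor \<open>N\<close> exceeds any prescribed constant.
  \<^item> Then \<open>u \<ge> L\<close> on a truncated backward cone of height \<open>R\<close> with \<open>L\<^bsup>p-1\<^esup> R\<^sup>2\<close> large, and a subsolution
    depending on time only blows up at the tip of that cone.
\<close>

section \<open>Positivity for the linear wave equation\<close>

text \<open>The free parameter of the argument is \<mu>. At the light cone N has the size \<mu>
  A^(-1/(p-1)), which must not exceed a multiple of \<epsilon>^p; this fixes A, and a larger \<mu>
  only enlarges C. The comparison stops at ln X = A - \<nu>/(2q), before N becomes singular; there N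
  has the order of \<mu>, whatever \<epsilon> is. Criticality also gives (m + q)(p - 1) = 2, so
  L^(p-1) R^2 does not depend on the time scale exp A and is proportional to \<mu>^(p-1). One \<mu>,
  chosen before \<epsilon>, therefore starts the final blow-up.

  The truncated cube makes the subsolution C^2 and settles the sign near the edge of its support:
  with g = (8 X)^(-q) and f = g - \<beta>^(-q) the wave operator produces, up to a nonnegative
  factor and a term of favourable sign, f ((N'/N + 2q) f - 2q g), which is negative for small f. The
  source is needed only where f \<ge> g/2; there f is comparable with X^(-q), and what remains is an
  ordinary differential inequality for N.\<close>

text \<open>The derivatives are explicit arguments, so that differences, shorter time intervals and
  the dummy coordinate of the descent act on each of them separately. Only pure second space
  derivatives occur: the Laplacian and Green's identity ask for no mixed ones. Time derivatives are
  taken within the closed interval, hence one-sided at its ends.\<close>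

definition C2_slab ::
  "real \<Rightarrow> ('a::euclidean_space \<Rightarrow> real \<Rightarrow> real) \<Rightarrow> ('a \<Rightarrow> real \<Rightarrow> real) \<Rightarrow> ('a \<Rightarrow> real \<Rightarrow> real)
    \<Rightarrow> ('a \<Rightarrow> 'a \<Rightarrow> real \<Rightarrow> real) \<Rightarrow> ('a \<Rightarrow> 'a \<Rightarrow> real \<Rightarrow> real) \<Rightarrow> bool"
where
  "C2_slab \<tau> w wt wtt wb wbb \<longleftrightarrow>
     (\<forall>x. \<forall>t\<in>{0..\<tau>}. (w x has_real_derivative wt x t) (at t within {0..\<tau>})
        \<and> (wt x has_real_derivative wtt x t) (at t within {0..\<tau>})) \<and>
     (\<forall>b\<in>Basis. \<forall>x. \<forall>t\<in>{0..\<tau>}. ((\<lambda>s. w (x + s *\<^sub>R b) t) has_real_derivative wb b x t) (at 0)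
        \<and> ((\<lambda>s. wb b (x + s *\<^sub>R b) t) has_real_derivative wbb b x t) (at 0)) \<and>
     continuous_on (UNIV \<times> {0..\<tau>}) (\<lambda>z. w (fst z) (snd z)) \<and>
     continuous_on (UNIV \<times> {0..\<tau>}) (\<lambda>z. wt (fst z) (snd z)) \<and>
     continuous_on (UNIV \<times> {0..\<tau>}) (\<lambda>z. wtt (fst z) (snd z)) \<and>
     (\<forall>b\<in>Basis. continuous_on (UNIV \<times> {0..\<tau>}) (\<lambda>z. wb b (fst z) (snd z))
        \<and> continuous_on (UNIV \<times> {0..\<tau>}) (\<lambda>z. wbb b (fst z) (snd z)))"

lemma C2_slabD:
  assumes "C2_slab \<tau> w wt wtt wb wbb"
  shows "\<And>x t. t \<in> {0..\<tau>} \<Longrightarrow> (w x has_real_derivative wt x t) (at t within {0..\<tau>})"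
    and "\<And>x t. t \<in> {0..\<tau>} \<Longrightarrow> (wt x has_real_derivative wtt x t) (at t within {0..\<tau>})"
    and "\<And>b x t. b \<in> Basis \<Longrightarrow> t \<in> {0..\<tau>} \<Longrightarrow>
      ((\<lambda>s. w (x + s *\<^sub>R b) t) has_real_derivative wb b x t) (at 0)"
    and "\<And>b x t. b \<in> Basis \<Longrightarrow> t \<in> {0..\<tau>} \<Longrightarrow>
      ((\<lambda>s. wb b (x + s *\<^sub>R b) t) has_real_derivative wbb b x t) (at 0)"
    and "continuous_on (UNIV \<times> {0..\<tau>}) (\<lambda>z. w (fst z) (snd z))"
    and "continuous_on (UNIV \<times> {0..\<tau>}) (\<lambda>z. wt (fst z) (snd z))"
    and "continuous_on (UNIV \<times> {0..\<tau>}) (\<lambda>z. wtt (fst z) (snd z))"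
    and "\<And>b. b \<in> Basis \<Longrightarrow> continuous_on (UNIV \<times> {0..\<tau>}) (\<lambda>z. wb b (fst z) (snd z))"
    and "\<And>b. b \<in> Basis \<Longrightarrow> continuous_on (UNIV \<times> {0..\<tau>}) (\<lambda>z. wbb b (fst z) (snd z))"
  using assms unfolding C2_slab_def by blast+

lemma C2_slab_diff:
  assumes "C2_slab \<tau> w wt wtt wb wbb" and "C2_slab \<tau> v vt vtt vb vbb"
  shows "C2_slab \<tau> (\<lambda>x t. w x t - v x t) (\<lambda>x t. wt x t - vt x t) (\<lambda>x t. wtt x t - vtt x t)
           (\<lambda>b x t. wb b x t - vb b x t) (\<lambda>b x t. wbb b x t - vbb b x t)"
  unfolding C2_slab_def
  using C2_slabD[OF assms(1)] C2_slabD[OF assms(2)]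
  by (auto intro!: derivative_intros continuous_intros)

lemma C2_slab_mono:
  assumes "C2_slab \<tau> w wt wtt wb wbb" and "\<tau>' \<le> \<tau>"
  shows "C2_slab \<tau>' w wt wtt wb wbb"
proof -
  have "{0..\<tau>'} \<subseteq> {0..\<tau>}" "UNIV \<times> {0..\<tau>'} \<subseteq> UNIV \<times> {0..\<tau>}" using assms(2) by auto
  then have "continuous_on (UNIV \<times> {0..\<tau>'}) f" if "continuous_on (UNIV \<times> {0..\<tau>}) f" for f :: "'a \<times> real \<Rightarrow> real"
    using that continuous_on_subset by blast
  moreover have "(f has_real_derivative f') (at t within {0..\<tau>'})"
    if "(f has_real_derivative f') (at t within {0..\<tau>})" for f f' t
    using that \<open>{0..\<tau>'} \<subseteq> {0..\<tau>}\<close> DERIV_subset by blast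
  moreover have "t \<in> {0..\<tau>}" if "t \<in> {0..\<tau>'}" for t using that assms(2) by auto
  ultimately show ?thesis
    using assms(1) unfolding C2_slab_def by meson
qed

lemma C2_slab_time:
  assumes "\<And>t. t \<in> {0..\<tau>} \<Longrightarrow> (\<theta> has_real_derivative \<theta>1 t) (at t within {0..\<tau>})"
    and "\<And>t. t \<in> {0..\<tau>} \<Longrightarrow> (\<theta>1 has_real_derivative \<theta>2 t) (at t within {0..\<tau>})"
    and "continuous_on {0..\<tau>} \<theta>2"
  shows "C2_slab \<tau> (\<lambda>x. \<theta>) (\<lambda>x. \<theta>1) (\<lambda>x. \<theta>2) (\<lambda>b x t. 0) (\<lambda>b x t. 0)"
proof -
  have "continuous_on {0..\<tau>} \<theta>" "continuous_on {0..\<tau>} \<theta>1"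
    using assms(1,2) by (meson DERIV_continuous_on)+
  then show ?thesis
    unfolding C2_slab_def using assms
    by (auto intro!: continuous_on_compose2[of "{0..\<tau>}" _ _ snd] continuous_intros)
qed

lemma C2_slab_slice:
  assumes "C2_slab \<tau> w wt wtt wb wbb" and "t \<in> {0..\<tau>}"
  shows "continuous_on A (\<lambda>x. w x t)" "continuous_on A (\<lambda>x. wt x t)" "continuous_on A (\<lambda>x. wtt x t)"
    "b \<in> Basis \<Longrightarrow> continuous_on A (\<lambda>x. wb b x t)" "b \<in> Basis \<Longrightarrow> continuous_on A (\<lambda>x. wbb b x t)"
proof -
  have *: "continuous_on A (\<lambda>x. f x t)"
    if "continuous_on (UNIV \<times> {0..\<tau>}) (\<lambda>z. f (fst z) (snd z))" for f :: "'a \<Rightarrow> real \<Rightarrow> real"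
  proof -
    have "continuous_on A (\<lambda>x. (x, t))" by (intro continuous_intros)
    moreover have "(\<lambda>x. (x, t)) ` A \<subseteq> UNIV \<times> {0..\<tau>}" using assms(2) by blast
    ultimately show ?thesis
      using continuous_on_compose2[OF that, of A "\<lambda>x. (x, t)"] by simp
  qed
  show "continuous_on A (\<lambda>x. w x t)" "continuous_on A (\<lambda>x. wt x t)" "continuous_on A (\<lambda>x. wtt x t)"
    "b \<in> Basis \<Longrightarrow> continuous_on A (\<lambda>x. wb b x t)" "b \<in> Basis \<Longrightarrow> continuous_on A (\<lambda>x. wbb b x t)"
    using C2_slabD[OF assms(1)] * by blast+
qed

section \<open>Integration by parts over a large box\<close>

lemma DERIV_along_shift:
  fixes f :: "'a::real_vector \<Rightarrow> real"
  assumes "\<And>x. ((\<lambda>s. f (x + s *\<^sub>R b)) has_real_derivative f' x) (at 0)"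
  shows "((\<lambda>s. f (x + s *\<^sub>R b)) has_real_derivative f' (x + h *\<^sub>R b)) (at h within A)"
proof -
  have "((\<lambda>s. f ((x + h *\<^sub>R b) + s *\<^sub>R b)) has_real_derivative f' (x + h *\<^sub>R b)) (at (h - h))"
    using assms by simp
  then have "((\<lambda>s. f ((x + h *\<^sub>R b) + (s - h) *\<^sub>R b)) has_real_derivative f' (x + h *\<^sub>R b)) (at h)"
    using DERIV_shift[of "\<lambda>s. f ((x + h *\<^sub>R b) + s *\<^sub>R b)" _ h "-h"] by simp
  moreover have "(\<lambda>s. f ((x + h *\<^sub>R b) + (s - h) *\<^sub>R b)) = (\<lambda>s. f (x + s *\<^sub>R b))"
    by (simp add: algebra_simps)
  ultimately show ?thesis using has_field_derivative_at_within by metis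
qed

text \<open>The margin 1 beyond the radius \<open>R\<close> leaves room for shifts of length at most
  1 of a function supported in the ball of radius \<open>R\<close>.\<close>

definition big_box :: "'a::euclidean_space \<Rightarrow> real \<Rightarrow> 'a set" where
  "big_box c R = cbox (c - (R + 1) *\<^sub>R One) (c + (R + 1) *\<^sub>R One)"

lemma cball_subset_big_box:
  assumes "norm (x - c) \<le> R + 1"
  shows "x \<in> big_box c R"
proof -
  have "\<bar>(x - c) \<bullet> i\<bar> \<le> R + 1" if "i \<in> Basis" for i
    using Basis_le_norm[OF that, of "x - c"] assms by linarith
  then show ?thesis
    unfolding big_box_def mem_box
    by (auto simp: inner_diff_left inner_add_left abs_le_iff algebra_simps)
qed

text \<open>Translation invariance makes the integrals of the shifts of \<open>f\<close> independent of the shift;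
  differentiate at shift \<open>0\<close>.\<close>

lemma integral_directional_derivative_eq_0:
  fixes f f' :: "'a::euclidean_space \<Rightarrow> real"
  assumes b: "b \<in> Basis"
    and der: "\<And>x. ((\<lambda>s. f (x + s *\<^sub>R b)) has_real_derivative f' x) (at 0)"
    and cont: "continuous_on UNIV f" "continuous_on UNIV f'"
    and supp: "\<And>x. norm (x - c) > R \<Longrightarrow> f x = 0"
  shows "integral (big_box c R) f' = 0"
proof -
  define B where "B = big_box c R"
  have const: "integral B (\<lambda>x. f (x + h *\<^sub>R b)) = integral B f" if h: "\<bar>h\<bar> \<le> 1" for h
  proof -
    let ?l = "c - (R + 1) *\<^sub>R One" and ?u = "c + (R + 1) *\<^sub>R One"
    have fi: "(f has_integral integral B f) (cbox ?l ?u)"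
      unfolding B_def big_box_def
      by (intro integrable_integral integrable_continuous) (rule continuous_on_subset[OF cont(1)], simp)
    have "((\<lambda>x. f (x + h *\<^sub>R b)) has_integral integral B f) (cbox (?l - h *\<^sub>R b) (?u - h *\<^sub>R b))"
      by (rule has_integral_shift_cbox[OF fi])
    moreover have z: "f (x + h *\<^sub>R b) = 0" if "x \<notin> cbox (?l - h *\<^sub>R b) (?u - h *\<^sub>R b)" for x
    proof (rule supp, rule ccontr)
      assume "\<not> R < norm (x + h *\<^sub>R b - c)"
      then have "x + h *\<^sub>R b \<in> big_box c R" by (intro cball_subset_big_box) auto
      then show False using that unfolding big_box_def mem_box
        by (auto simp: inner_diff_left inner_add_left algebra_simps)
    qed
    moreover have z2: "f (x + h *\<^sub>R b) = 0" if "x \<notin> B" for x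
    proof (rule supp, rule ccontr)
      assume *: "\<not> R < norm (x + h *\<^sub>R b - c)"
      have "norm (x - c) \<le> norm (x + h *\<^sub>R b - c) + norm (h *\<^sub>R b)"
        using norm_triangle_ineq4[of "x + h *\<^sub>R b - c" "h *\<^sub>R b"] by simp
      also have "\<dots> \<le> R + 1" using * h b by simp
      finally show False using that cball_subset_big_box unfolding B_def by blast
    qed
    \<comment> \<open>The shifted box and \<open>B\<close> both contain the support of the shifted
      function, so both integrals equal its integral over the whole space.\<close>
    ultimately have "((\<lambda>x. f (x + h *\<^sub>R b)) has_integral integral B f) UNIV"
      by (intro has_integral_on_superset[where T = UNIV]) auto
    moreover have "(\<lambda>x. f (x + h *\<^sub>R b)) integrable_on B"
      unfolding B_def big_box_def
      by (intro integrable_continuous continuous_on_compose2[OF cont(1)] continuous_intros) auto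
    then have "((\<lambda>x. f (x + h *\<^sub>R b)) has_integral integral B (\<lambda>x. f (x + h *\<^sub>R b))) UNIV"
      using z2 by (intro has_integral_on_superset[OF integrable_integral]) auto
    ultimately show ?thesis by (rule has_integral_unique[symmetric])
  qed
  have "((\<lambda>h. integral B (\<lambda>x. f (x + h *\<^sub>R b))) has_real_derivative
          integral B (\<lambda>x. f' (x + 0 *\<^sub>R b))) (at 0 within {-1..1})"
    unfolding B_def big_box_def
  proof (rule leibniz_rule_field_derivative[where fx = "\<lambda>h x. f' (x + h *\<^sub>R b)"])
    show "((\<lambda>h. f (x + h *\<^sub>R b)) has_real_derivative f' (x + h *\<^sub>R b)) (at h within {-1..1})" for h x
      by (rule DERIV_along_shift[OF der])
    show "(\<lambda>x. f (x + h *\<^sub>R b)) integrable_on cbox (c - (R + 1) *\<^sub>R One) (c + (R + 1) *\<^sub>R One)" for h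
      by (intro integrable_continuous continuous_on_compose2[OF cont(1)] continuous_intros) auto
    show "continuous_on ({-1..1} \<times> cbox (c - (R + 1) *\<^sub>R One) (c + (R + 1) *\<^sub>R One))
       (\<lambda>(h, x). f' (x + h *\<^sub>R b))"
      unfolding case_prod_unfold
      by (intro continuous_on_compose2[OF cont(2)] continuous_intros) auto
  qed auto
  moreover have "((\<lambda>h. integral B (\<lambda>x. f (x + h *\<^sub>R b))) has_real_derivative 0) (at 0 within {-1..1})"
    by (rule has_field_derivative_transform_within[where d = 1 and f = "\<lambda>h. integral B f"])
       (auto simp: const dist_real_def)
  moreover have "at (0::real) within {-1..1} = at 0" by (rule at_within_interior) auto
  ultimately show ?thesis unfolding B_def[symmetric] using DERIV_unique by fastforce
qed

text \<open>The integrand is the derivative along \<open>b\<close> of the flux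
  \<open>f1 x * g x - f x * g1 x\<close>. Only \<open>g\<close> needs bounded support, so
  \<open>f\<close>, later the solution, may behave arbitrarily at infinity.\<close>

lemma second_green_identity:
  fixes f g :: "'a::euclidean_space \<Rightarrow> real"
  assumes b: "b \<in> Basis"
    and f: "\<And>x. ((\<lambda>s. f (x + s *\<^sub>R b)) has_real_derivative f1 x) (at 0)"
      "\<And>x. ((\<lambda>s. f1 (x + s *\<^sub>R b)) has_real_derivative f2 x) (at 0)"
      "continuous_on UNIV f" "continuous_on UNIV f1" "continuous_on UNIV f2"
    and g: "\<And>x. ((\<lambda>s. g (x + s *\<^sub>R b)) has_real_derivative g1 x) (at 0)"
      "\<And>x. ((\<lambda>s. g1 (x + s *\<^sub>R b)) has_real_derivative g2 x) (at 0)"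
      "continuous_on UNIV g" "continuous_on UNIV g1" "continuous_on UNIV g2"
    and supp: "\<And>x. norm (x - c) > R \<Longrightarrow> g x = 0 \<and> g1 x = 0"
  shows "integral (big_box c R) (\<lambda>x. f2 x * g x - f x * g2 x) = 0"
proof (rule integral_directional_derivative_eq_0[OF b, where f = "\<lambda>x. f1 x * g x - f x * g1 x"])
  show "((\<lambda>s. f1 (x + s *\<^sub>R b) * g (x + s *\<^sub>R b) - f (x + s *\<^sub>R b) * g1 (x + s *\<^sub>R b))
          has_real_derivative f2 x * g x - f x * g2 x) (at 0)" for x
    using f(1,2)[of x] g(1,2)[of x] by (auto intro!: derivative_eq_intros)
  show "continuous_on UNIV (\<lambda>x. f1 x * g x - f x * g1 x)"
    "continuous_on UNIV (\<lambda>x. f2 x * g x - f x * g2 x)"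
    using f g by (auto intro!: continuous_intros)
  show "norm (x - c) > R \<Longrightarrow> f1 x * g x - f x * g1 x = 0" for x using supp by simp
qed

lemma continuous_on_curried_compose:
  assumes "continuous_on (A \<times> B) (\<lambda>z. f (fst z) (snd z))"
    and "continuous_on S g" and "continuous_on S h" and "\<And>z. z \<in> S \<Longrightarrow> g z \<in> A \<and> h z \<in> B"
  shows "continuous_on S (\<lambda>z. f (g z) (h z))"
proof -
  have "continuous_on S (\<lambda>z. (g z, h z))" using assms(2,3) by (intro continuous_intros)
  moreover have "(\<lambda>z. (g z, h z)) ` S \<subseteq> A \<times> B" using assms(4) by blast
  ultimately show ?thesis using continuous_on_compose2[OF assms(1)] by fastforce
qed

section \<open>Radial functions of class C^2\<close>

lemma DERIV_norm_along:
  fixes y b :: "'a::real_inner"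
  assumes "y \<noteq> 0"
  shows "((\<lambda>s. norm (y + s *\<^sub>R b)) has_real_derivative (y \<bullet> b) / norm y) (at 0)"
proof -
  have "((\<lambda>s. sqrt ((y + s *\<^sub>R b) \<bullet> (y + s *\<^sub>R b))) has_real_derivative (y \<bullet> b) / norm y) (at 0)"
    using assms inner_gt_zero_iff[of y]
    by (auto intro!: derivative_eq_intros
        simp: inner_add_left inner_add_right inner_commute norm_eq_sqrt_inner field_simps
        simp del: inner_gt_zero_iff)
  then show ?thesis by (simp add: norm_eq_sqrt_inner)
qed

text \<open>Along a line through its centre a radial function is the even extension of its profile;
  a profile with slope 0 at the origin has no kink there.\<close>

lemma DERIV_even_ext:
  fixes f :: "real \<Rightarrow> real"
  assumes "(f has_real_derivative 0) (at 0 within {0..})"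
  shows "((\<lambda>s. f \<bar>s\<bar>) has_real_derivative 0) (at 0)"
proof -
  have *: "((\<lambda>r. (f r - f 0) / r) \<longlongrightarrow> 0) (at 0 within {0..})"
    using assms by (simp add: has_field_derivative_iff)
  have "filterlim (\<lambda>s::real. \<bar>s\<bar>) (at 0 within {0..}) (at 0)"
    by (auto simp: filterlim_at eventually_at_filter intro!: tendsto_eq_intros)
  then have "((\<lambda>s. (f \<bar>s\<bar> - f 0) / \<bar>s\<bar>) \<longlongrightarrow> 0) (at 0)"
    using * filterlim_compose by blast
  then have "((\<lambda>s. \<bar>(f \<bar>s\<bar> - f 0) / \<bar>s\<bar>\<bar>) \<longlongrightarrow> 0) (at 0)" by (rule tendsto_rabs_zero)
  then have "((\<lambda>s. \<bar>(f \<bar>s\<bar> - f 0) / s\<bar>) \<longlongrightarrow> 0) (at 0)" by (simp add: abs_divide)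
  then have "((\<lambda>s. (f \<bar>s\<bar> - f 0) / s) \<longlongrightarrow> 0) (at 0)" by (simp only: tendsto_rabs_zero_iff)
  then show ?thesis by (simp add: has_field_derivative_iff)
qed

text \<open>\<open>K\<close> is e_r / r and \<open>H\<close> is r K_r, that is e_rr - e_r / r. In
  these terms the second derivative along \<open>b\<close> is \<open>K\<close> plus \<open>H\<close>
  times a squared direction cosine. The cosine has no limit at the centre but is bounded by 1, so
  \<open>H = 0\<close> there gives continuity. The squared cosines sum to 1, which yields the trace
  n K + H, the familiar e_rr + (n - 1) e_r / r.\<close>

lemma radial_C2_slab:
  fixes e K H et ett :: "real \<Rightarrow> real \<Rightarrow> real" and c :: "'a::euclidean_space"
  assumes er: "\<And>r t. r > 0 \<Longrightarrow> t \<in> {0..\<tau>} \<Longrightarrow> ((\<lambda>r. e r t) has_real_derivative r * K r t) (at r)"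
    and Kr: "\<And>r t. r > 0 \<Longrightarrow> t \<in> {0..\<tau>} \<Longrightarrow> ((\<lambda>r. K r t) has_real_derivative H r t / r) (at r)"
    and e0: "\<And>t. t \<in> {0..\<tau>} \<Longrightarrow> ((\<lambda>r. e r t) has_real_derivative 0) (at 0 within {0..})"
    and H0: "\<And>t. t \<in> {0..\<tau>} \<Longrightarrow> H 0 t = 0"
    and et: "\<And>r t. r \<ge> 0 \<Longrightarrow> t \<in> {0..\<tau>} \<Longrightarrow> (e r has_real_derivative et r t) (at t within {0..\<tau>})"
    and ett: "\<And>r t. r \<ge> 0 \<Longrightarrow> t \<in> {0..\<tau>} \<Longrightarrow> (et r has_real_derivative ett r t) (at t within {0..\<tau>})"
    and cont: "continuous_on ({0..} \<times> {0..\<tau>}) (\<lambda>z. e (fst z) (snd z))"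
      "continuous_on ({0..} \<times> {0..\<tau>}) (\<lambda>z. K (fst z) (snd z))"
      "continuous_on ({0..} \<times> {0..\<tau>}) (\<lambda>z. H (fst z) (snd z))"
      "continuous_on ({0..} \<times> {0..\<tau>}) (\<lambda>z. et (fst z) (snd z))"
      "continuous_on ({0..} \<times> {0..\<tau>}) (\<lambda>z. ett (fst z) (snd z))"
  shows "C2_slab \<tau> (\<lambda>x. e (norm (x - c))) (\<lambda>x. et (norm (x - c))) (\<lambda>x. ett (norm (x - c)))
      (\<lambda>b x t. K (norm (x - c)) t * ((x - c) \<bullet> b))
      (\<lambda>b x t. K (norm (x - c)) t + H (norm (x - c)) t * (((x - c) \<bullet> b) / norm (x - c))\<^sup>2)" (is ?A)
    and "t \<in> {0..\<tau>} \<Longrightarrow> (\<Sum>b\<in>Basis. K (norm (x - c)) t + H (norm (x - c)) t * (((x - c) \<bullet> b) / norm (x - c))\<^sup>2)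
      = DIM('a) * K (norm (x - c)) t + H (norm (x - c)) t" (is "_ \<Longrightarrow> ?B")
proof -
  have comp: "continuous_on (UNIV \<times> {0..\<tau>}) (\<lambda>z. f (norm (fst z - c)) (snd z))"
    if "continuous_on ({0..} \<times> {0..\<tau>}) (\<lambda>z. f (fst z) (snd z))" for f :: "real \<Rightarrow> real \<Rightarrow> real"
    by (rule continuous_on_curried_compose[OF that]) (auto intro!: continuous_intros)
  have D1: "((\<lambda>s. e (norm (x + s *\<^sub>R b - c)) t) has_real_derivative K (norm (x - c)) t * ((x - c) \<bullet> b)) (at 0)"
    if b: "b \<in> Basis" and t: "t \<in> {0..\<tau>}" for b x t
  proof (cases "x = c")
    case True
    have "((\<lambda>s. e \<bar>s\<bar> t) has_real_derivative 0) (at 0)" by (rule DERIV_even_ext[OF e0[OF t]])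
    then show ?thesis using True b by simp
  next
    case False
    then have y: "x - c \<noteq> 0" by simp
    have "((\<lambda>s. e (norm (x - c + s *\<^sub>R b)) t) has_real_derivative
        norm (x - c) * K (norm (x - c)) t * ((x - c) \<bullet> b / norm (x - c))) (at 0)"
      using y by (intro DERIV_chain2[OF _ DERIV_norm_along]) (auto intro!: er t)
    moreover have "norm (x - c) * K (norm (x - c)) t * ((x - c) \<bullet> b / norm (x - c))
        = K (norm (x - c)) t * ((x - c) \<bullet> b)" using y by simp
    ultimately show ?thesis by (simp add: add_diff_eq diff_add_eq)
  qed
  have D2: "((\<lambda>s. K (norm (x + s *\<^sub>R b - c)) t * ((x + s *\<^sub>R b - c) \<bullet> b)) has_real_derivative
      K (norm (x - c)) t + H (norm (x - c)) t * (((x - c) \<bullet> b) / norm (x - c))\<^sup>2) (at 0)"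
    if b: "b \<in> Basis" and t: "t \<in> {0..\<tau>}" for b x t
  proof (cases "x = c")
    case True
    \<comment> \<open>On a line through the centre the first derivative is
      \<open>K \<bar>s\<bar> t * s\<close>, whose difference quotient at 0 is
      \<open>K \<bar>s\<bar> t\<close> itself; continuity of \<open>K\<close> suffices.\<close>
    have "continuous_on {0..} (\<lambda>r. K r t)"
      by (rule continuous_on_curried_compose[OF cont(2)]) (use t in \<open>auto intro!: continuous_intros\<close>)
    then have "((\<lambda>r. K r t) \<longlongrightarrow> K 0 t) (at 0 within {0..})" by (auto simp: continuous_on_def)
    moreover have "filterlim (\<lambda>s::real. \<bar>s\<bar>) (at 0 within {0..}) (at 0)"
      by (auto simp: filterlim_at eventually_at_filter intro!: tendsto_eq_intros)
    ultimately have "((\<lambda>s. K \<bar>s\<bar> t) \<longlongrightarrow> K 0 t) (at 0)" using filterlim_compose by blast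
    then have "((\<lambda>s. (K \<bar>s\<bar> t * s - K 0 t * 0) / (s - 0)) \<longlongrightarrow> K 0 t) (at 0)"
      by (rule Lim_transform_eventually) (auto simp: eventually_at_filter)
    then have "((\<lambda>s. K \<bar>s\<bar> t * s) has_real_derivative K 0 t) (at 0)"
      by (simp add: has_field_derivative_iff)
    then show ?thesis using True b H0[OF t] by simp
  next
    case False
    then have y: "x - c \<noteq> 0" by simp
    have n: "((\<lambda>s. K (norm (x - c + s *\<^sub>R b)) t) has_real_derivative
        H (norm (x - c)) t / norm (x - c) * ((x - c) \<bullet> b / norm (x - c))) (at 0)"
      using y by (intro DERIV_chain2[OF _ DERIV_norm_along]) (auto intro!: Kr t)
    have "((\<lambda>s. K (norm (x - c + s *\<^sub>R b)) t * ((x - c + s *\<^sub>R b) \<bullet> b)) has_real_derivative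
        K (norm (x - c)) t + H (norm (x - c)) t * (((x - c) \<bullet> b) / norm (x - c))\<^sup>2) (at 0)"
      unfolding inner_add_left
      by (rule derivative_eq_intros n refl | simp)+
         (use y b in \<open>simp add: field_simps power2_eq_square\<close>)
    then show ?thesis by (simp add: algebra_simps)
  qed
  have C: "continuous_on (UNIV \<times> {0..\<tau>})
      (\<lambda>z. H (norm (fst z - c)) (snd z) * (((fst z - c) \<bullet> b) / norm (fst z - c))\<^sup>2)"
    if b: "b \<in> Basis" for b
    unfolding continuous_on_def
  proof
    fix z :: "'a \<times> real" assume z: "z \<in> UNIV \<times> {0..\<tau>}"
    let ?H = "\<lambda>z. H (norm (fst z - c)) (snd z)"
    have Hc: "(?H \<longlongrightarrow> ?H z) (at z within UNIV \<times> {0..\<tau>})"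
      using comp[OF cont(3), unfolded continuous_on_def] z by blast
    show "((\<lambda>z. ?H z * (((fst z - c) \<bullet> b) / norm (fst z - c))\<^sup>2) \<longlongrightarrow>
      ?H z * (((fst z - c) \<bullet> b) / norm (fst z - c))\<^sup>2) (at z within UNIV \<times> {0..\<tau>})"
    proof (cases "fst z = c")
      case False
      then show ?thesis by (intro tendsto_intros Hc) auto
    next
      case True
      then have "?H z = 0" using H0 z by (auto simp: mem_Times_iff)
      then have "((\<lambda>z. \<bar>?H z\<bar>) \<longlongrightarrow> 0) (at z within UNIV \<times> {0..\<tau>})"
        using Hc by (simp add: tendsto_rabs_zero)
      moreover have "\<bar>?H z * (((fst z - c) \<bullet> b) / norm (fst z - c))\<^sup>2\<bar> \<le> \<bar>?H z\<bar>" for z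
      proof -
        have "\<bar>((fst z - c) \<bullet> b) / norm (fst z - c)\<bar> \<le> 1"
          using Basis_le_norm[OF b, of "fst z - c"] by (simp add: abs_divide divide_le_eq_1)
        then have "(((fst z - c) \<bullet> b) / norm (fst z - c))\<^sup>2 \<le> 1" by (simp add: abs_square_le_1)
        then show ?thesis by (simp add: abs_mult mult_left_le)
      qed
      ultimately have "((\<lambda>z. ?H z * (((fst z - c) \<bullet> b) / norm (fst z - c))\<^sup>2) \<longlongrightarrow> 0) (at z within UNIV \<times> {0..\<tau>})"
        by (rule_tac tendsto_0_le[where K = 1]) (auto simp: tendsto_rabs_zero_iff)
      then show ?thesis using \<open>?H z = 0\<close> by simp
    qed
  qed
  show ?A
    unfolding C2_slab_def
    by (intro conjI ballI allI D1 D2 et ett comp[OF cont(1)] comp[OF cont(2)] comp[OF cont(4)]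
        comp[OF cont(5)] C continuous_on_add continuous_on_mult continuous_intros) auto
  show ?B if t: "t \<in> {0..\<tau>}"
  proof (cases "x = c")
    case True
    then show ?thesis using H0[OF t] by simp
  next
    case False
    have "(\<Sum>b\<in>Basis. (((x - c) \<bullet> b) / norm (x - c))\<^sup>2) = (\<Sum>b\<in>Basis. ((x - c) \<bullet> b)\<^sup>2) / (norm (x - c))\<^sup>2"
      by (simp add: power_divide sum_divide_distrib)
    also have "(\<Sum>b\<in>Basis. ((x - c) \<bullet> b)\<^sup>2) = (norm (x - c))\<^sup>2"
      by (simp add: norm_eq_sqrt_inner euclidean_inner[of "x - c" "x - c"] power2_eq_square sum_nonneg)
    finally show ?thesis
      using False by (simp add: sum.distrib sum_distrib_left[symmetric])
  qed
qed

section \<open>The radial test function in three dimensions\<close>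

lemma DERIV_pos_part_power:
  "((\<lambda>x. max 0 x ^ Suc (Suc n)) has_real_derivative real (Suc (Suc n)) * max 0 x ^ Suc n) (at (x::real))"
proof -
  consider "x > 0" | "x < 0" | "x = 0" by linarith
  then show ?thesis
  proof cases
    case 1
    have "((\<lambda>x. x ^ Suc (Suc n)) has_real_derivative real (Suc (Suc n)) * max 0 x ^ Suc n) (at x)"
      by (rule derivative_eq_intros refl)+ (use 1 in simp)
    then show ?thesis
      by (rule has_field_derivative_transform_within_open[where S = "{0<..}"]) (use 1 in auto)
  next
    case 2
    have "((\<lambda>x. 0) has_real_derivative real (Suc (Suc n)) * max 0 x ^ Suc n) (at x)"
      using 2 by (auto intro!: derivative_eq_intros simp: max_def)
    then show ?thesis
      by (rule has_field_derivative_transform_within_open[where S = "{..<0}"]) (use 2 in auto)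
  next
    case 3
    have "((\<lambda>h::real. max 0 h ^ Suc (Suc n) / h) \<longlongrightarrow> 0) (at 0)"
    proof (rule Lim_null_comparison)
      show "\<forall>\<^sub>F h in at (0::real). norm (max 0 h ^ Suc (Suc n) / h) \<le> \<bar>h\<bar> ^ Suc n"
      proof (intro always_eventually allI)
        fix h :: real
        show "norm (max 0 h ^ Suc (Suc n) / h) \<le> \<bar>h\<bar> ^ Suc n"
        proof (cases "h > 0")
          case False
          then have "norm (max 0 h ^ Suc (Suc n) / h) = 0" by (simp add: max_absorb1)
          then show ?thesis by (metis abs_ge_zero zero_le_power)
        qed (simp add: max_absorb2)
      qed
      show "((\<lambda>h::real. \<bar>h\<bar> ^ Suc n) \<longlongrightarrow> 0) (at 0)"
        by (rule tendsto_eq_intros refl | simp)+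
    qed
    then show ?thesis using 3 by (simp add: has_field_derivative_iff)
  qed
qed

lemma DERIV_pos_part:
  fixes x :: real
  shows "((\<lambda>x. max 0 x ^ 2) has_real_derivative 2 * max 0 x) (at x)"
    and "((\<lambda>x. max 0 x ^ 3) has_real_derivative 3 * max 0 x ^ 2) (at x)"
    and "((\<lambda>x. max 0 x ^ 4) has_real_derivative 4 * max 0 x ^ 3) (at x)"
  using DERIV_pos_part_power[of 0 x] DERIV_pos_part_power[of 1 x] DERIV_pos_part_power[of 2 x]
  by (simp_all add: eval_nat_numeral)

text \<open>Up to a factor this is a weighted average of \<open>f\<close> over [s - r, s + r]. The
  fixed interval makes r = 0 a regular point and allows differentiation under the integral in both
  parameters; the weight absorbs the factor z that each r-derivative produces.\<close>

definition ray_avg :: "(real \<Rightarrow> real) \<Rightarrow> (real \<Rightarrow> real) \<Rightarrow> real \<Rightarrow> real \<Rightarrow> real" where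
  "ray_avg \<omega> f r s = integral {-1..1} (\<lambda>z. \<omega> z * f (s + r * z))"

lemma ray_avg_integrable:
  fixes \<omega> f :: "real \<Rightarrow> real"
  assumes "continuous_on UNIV \<omega>" and "continuous_on UNIV f"
  shows "(\<lambda>z. \<omega> z * f (s + r * z)) integrable_on {-1..1}"
  by (rule integrable_continuous_real, intro continuous_on_mult continuous_on_subset[OF assms(1)]
      continuous_on_compose2[OF assms(2)] continuous_intros) auto

lemma ray_avg_continuous:
  assumes "continuous_on UNIV \<omega>" and "continuous_on UNIV f"
  shows "continuous_on A (\<lambda>z. ray_avg \<omega> f (fst z) (snd z))"
proof -
  have "continuous_on (UNIV \<times> cbox (-1) 1) (\<lambda>(z, y). \<omega> y * f (snd z + fst z * y))"
    unfolding case_prod_unfold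
    by (intro continuous_intros continuous_on_compose2[OF assms(1)] continuous_on_compose2[OF assms(2)]) auto
  then have "continuous_on UNIV (\<lambda>z. integral (cbox (-1) 1) (\<lambda>y. \<omega> y * f (snd z + fst z * y)))"
    by (rule integral_continuous_on_param)
  then have "continuous_on UNIV (\<lambda>z. ray_avg \<omega> f (fst z) (snd z))" by (simp add: ray_avg_def)
  then show ?thesis by (rule continuous_on_subset) simp
qed

lemma ray_avg_deriv:
  assumes \<omega>: "continuous_on UNIV \<omega>" and f': "continuous_on UNIV f'"
    and f: "\<And>x. (f has_real_derivative f' x) (at x)"
  shows "((\<lambda>s. ray_avg \<omega> f r s) has_real_derivative ray_avg \<omega> f' r s) (at s within A)"
    and "((\<lambda>r. ray_avg \<omega> f r s) has_real_derivative ray_avg (\<lambda>z. z * \<omega> z) f' r s) (at r within A)"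
proof -
  have fc: "continuous_on UNIV f" using f by (meson DERIV_continuous_on)
  have "((\<lambda>s. integral (cbox (-1) 1) (\<lambda>z. \<omega> z * f (s + r * z))) has_real_derivative
      integral (cbox (-1) 1) (\<lambda>z. \<omega> z * f' (s + r * z))) (at s within UNIV)"
  proof (rule leibniz_rule_field_derivative[where fx = "\<lambda>s z. \<omega> z * f' (s + r * z)"])
    show "((\<lambda>s. \<omega> z * f (s + r * z)) has_real_derivative \<omega> z * f' (s + r * z)) (at s within UNIV)" for s z
      by (auto intro!: derivative_eq_intros DERIV_chain2[OF f])
    show "continuous_on (UNIV \<times> cbox (-1) 1) (\<lambda>(s, z). \<omega> z * f' (s + r * z))"
      unfolding case_prod_unfold
      by (intro continuous_intros continuous_on_compose2[OF \<omega>] continuous_on_compose2[OF f']) auto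
  qed (use ray_avg_integrable[OF \<omega> fc] in auto)
  then show "((\<lambda>s. ray_avg \<omega> f r s) has_real_derivative ray_avg \<omega> f' r s) (at s within A)"
    unfolding ray_avg_def by (simp add: has_field_derivative_at_within)
  have "((\<lambda>r. integral (cbox (-1) 1) (\<lambda>z. \<omega> z * f (s + r * z))) has_real_derivative
      integral (cbox (-1) 1) (\<lambda>z. z * \<omega> z * f' (s + r * z))) (at r within UNIV)"
  proof (rule leibniz_rule_field_derivative[where fx = "\<lambda>r z. z * \<omega> z * f' (s + r * z)"])
    show "((\<lambda>r. \<omega> z * f (s + r * z)) has_real_derivative z * \<omega> z * f' (s + r * z)) (at r within UNIV)" for r z
      by (auto intro!: derivative_eq_intros DERIV_chain2[OF f])
    show "continuous_on (UNIV \<times> cbox (-1) 1) (\<lambda>(r, z). z * \<omega> z * f' (s + r * z))"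
      unfolding case_prod_unfold
      by (intro continuous_intros continuous_on_compose2[OF \<omega>] continuous_on_compose2[OF f']) auto
  qed (use ray_avg_integrable[OF \<omega> fc] in auto)
  then show "((\<lambda>r. ray_avg \<omega> f r s) has_real_derivative ray_avg (\<lambda>z. z * \<omega> z) f' r s) (at r within A)"
    unfolding ray_avg_def by (simp add: has_field_derivative_at_within)
qed

lemma ray_avg_add:
  assumes "continuous_on UNIV \<omega>1" "continuous_on UNIV \<omega>2" "continuous_on UNIV f"
  shows "ray_avg \<omega>1 f r s + ray_avg \<omega>2 f r s = ray_avg (\<lambda>z. \<omega>1 z + \<omega>2 z) f r s"
  unfolding ray_avg_def distrib_right
  by (rule integral_add[symmetric]) (intro ray_avg_integrable assms)+

text \<open>Extracts from the r-derivative of an average the factor r that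
  \<open>radial_C2_slab\<close> demands, and so gives \<open>K\<close> without a division. The
  boundary terms vanish because z^2 - 1 does at both ends.\<close>

lemma ray_avg_by_parts:
  assumes f: "\<And>x. (f has_real_derivative f' x) (at x)" and f': "continuous_on UNIV f'"
  shows "ray_avg (\<lambda>z. z) f r s = r * ray_avg (\<lambda>z. (1 - z\<^sup>2) / 2) f' r s"
proof -
  have fc: "continuous_on UNIV f" using f by (meson DERIV_continuous_on)
  have "((\<lambda>z. z * f (s + r * z) - r * ((1 - z\<^sup>2) / 2 * f' (s + r * z))) has_integral
      (1\<^sup>2 - 1) / 2 * f (s + r * 1) - ((-1)\<^sup>2 - 1) / 2 * f (s + r * (-1))) {-1..1}"
  proof (rule fundamental_theorem_of_calculus)
    show "((\<lambda>z. (z\<^sup>2 - 1) / 2 * f (s + r * z)) has_vector_derivative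
        z * f (s + r * z) - r * ((1 - z\<^sup>2) / 2 * f' (s + r * z))) (at z within {-1..1})" for z
      unfolding has_real_derivative_iff_has_vector_derivative[symmetric]
      by (rule derivative_eq_intros DERIV_chain2[OF f] refl | simp add: field_simps)+
  qed simp
  then have "integral {-1..1} (\<lambda>z. z * f (s + r * z) - r * ((1 - z\<^sup>2) / 2 * f' (s + r * z))) = 0"
    by (simp add: integral_unique)
  moreover have "(\<lambda>z. r * ((1 - z\<^sup>2) / 2 * f' (s + r * z))) integrable_on {-1..1}"
    by (intro integrable_on_mult_right ray_avg_integrable f' continuous_intros) auto
  moreover have "(\<lambda>z. z * f (s + r * z)) integrable_on {-1..1}"
    by (intro ray_avg_integrable fc continuous_intros)
  ultimately show ?thesis
    unfolding ray_avg_def by (simp add: integral_diff)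
qed

text \<open>The backward wave with vanishing data and velocity \<open>2 (d\<^sup>2 - r\<^sup>2)\<^sub>+\<^sup>3\<close> at the tip of a cone in
  three dimensions is \<open>(\<chi> (s - r) - \<chi> (s + r)) / r\<close> for \<open>\<chi> y = (d\<^sup>2 - y\<^sup>2)\<^sub>+\<^sup>4 / 8\<close>; the average of
  the odd function \<open>-\<chi>'\<close> over \<open>[s - r, s + r]\<close> is a form of it that is smooth at \<open>r = 0\<close>.\<close>

definition odd_bump :: "real \<Rightarrow> real \<Rightarrow> real" where
  "odd_bump d y = y * max 0 (d\<^sup>2 - y\<^sup>2) ^ 3"

definition odd_bump1 :: "real \<Rightarrow> real \<Rightarrow> real" where
  "odd_bump1 d y = max 0 (d\<^sup>2 - y\<^sup>2) ^ 3 - 6 * y\<^sup>2 * max 0 (d\<^sup>2 - y\<^sup>2) ^ 2"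

definition odd_bump2 :: "real \<Rightarrow> real \<Rightarrow> real" where
  "odd_bump2 d y = 24 * y ^ 3 * max 0 (d\<^sup>2 - y\<^sup>2) - 18 * y * max 0 (d\<^sup>2 - y\<^sup>2) ^ 2"

lemma odd_bump_deriv:
  "(odd_bump d has_real_derivative odd_bump1 d y) (at y within A)"
  "(odd_bump1 d has_real_derivative odd_bump2 d y) (at y within A)"
  "((\<lambda>y. max 0 (d\<^sup>2 - y\<^sup>2) ^ 4 / 8) has_real_derivative - odd_bump d y) (at y within A)"
proof -
  note [derivative_intros] = DERIV_chain2[OF DERIV_pos_part(1)] DERIV_chain2[OF DERIV_pos_part(2)]
    DERIV_chain2[OF DERIV_pos_part(3)]
  show "(odd_bump d has_real_derivative odd_bump1 d y) (at y within A)"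
    unfolding odd_bump_def[abs_def] odd_bump1_def
    by (rule derivative_eq_intros refl)+ (simp add: algebra_simps power2_eq_square power3_eq_cube)
  show "(odd_bump1 d has_real_derivative odd_bump2 d y) (at y within A)"
    unfolding odd_bump1_def[abs_def] odd_bump2_def
    by (rule derivative_eq_intros refl)+ (simp add: algebra_simps power2_eq_square power3_eq_cube)
  have "((\<lambda>y. max 0 (d\<^sup>2 - y\<^sup>2) ^ 4) has_real_derivative
      4 * max 0 (d\<^sup>2 - y\<^sup>2) ^ 3 * (- (2 * y))) (at y within A)"
    by (rule DERIV_chain2[OF DERIV_pos_part(3)]) (auto intro!: derivative_eq_intros)
  from DERIV_cdivide[OF this, of 8]
  show "((\<lambda>y. max 0 (d\<^sup>2 - y\<^sup>2) ^ 4 / 8) has_real_derivative - odd_bump d y) (at y within A)"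
    unfolding odd_bump_def by (simp add: algebra_simps)
qed

lemma odd_bump_continuous:
  "continuous_on A (odd_bump d)" "continuous_on A (odd_bump1 d)" "continuous_on A (odd_bump2 d)"
  unfolding odd_bump_def odd_bump1_def odd_bump2_def by (intro continuous_intros)+

lemma ray_avg_odd_bump:
  "r * ray_avg (\<lambda>z. 1) (odd_bump d) r s = (max 0 (d\<^sup>2 - (s - r)\<^sup>2) ^ 4 - max 0 (d\<^sup>2 - (s + r)\<^sup>2) ^ 4) / 8"
proof -
  have "((\<lambda>z. r * odd_bump d (s + r * z)) has_integral
      (- (max 0 (d\<^sup>2 - (s + r * 1)\<^sup>2) ^ 4 / 8)) - (- (max 0 (d\<^sup>2 - (s + r * (-1))\<^sup>2) ^ 4 / 8))) {-1..1}"
  proof (rule fundamental_theorem_of_calculus)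
    show "((\<lambda>z. - (max 0 (d\<^sup>2 - (s + r * z)\<^sup>2) ^ 4 / 8)) has_vector_derivative
        r * odd_bump d (s + r * z)) (at z within {-1..1})" for z
      unfolding has_real_derivative_iff_has_vector_derivative[symmetric]
      by (rule derivative_eq_intros DERIV_chain2[OF odd_bump_deriv(3)] refl | simp)+
  qed simp
  then have "integral {-1..1} (\<lambda>z. r * odd_bump d (s + r * z)) =
    (max 0 (d\<^sup>2 - (s - r)\<^sup>2) ^ 4 - max 0 (d\<^sup>2 - (s + r)\<^sup>2) ^ 4) / 8"
    by (subst integral_unique) (assumption, simp add: diff_divide_distrib)
  then show ?thesis unfolding ray_avg_def by simp
qed

lemma ray_avg_odd_bump1:
  "ray_avg (\<lambda>z. 1) (odd_bump1 d) r 0 = 2 * max 0 (d\<^sup>2 - r\<^sup>2) ^ 3"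
proof (cases "r = 0")
  case True
  then show ?thesis by (simp add: ray_avg_def odd_bump1_def)
next
  case False
  have "((\<lambda>z. r * odd_bump1 d (0 + r * z)) has_integral
      odd_bump d (0 + r * 1) - odd_bump d (0 + r * (-1))) {-1..1}"
  proof (rule fundamental_theorem_of_calculus)
    show "((\<lambda>z. odd_bump d (0 + r * z)) has_vector_derivative
        r * odd_bump1 d (0 + r * z)) (at z within {-1..1})" for z
      unfolding has_real_derivative_iff_has_vector_derivative[symmetric]
      by (rule DERIV_cong[OF DERIV_chain2[OF odd_bump_deriv(1)]])
         (auto intro!: derivative_eq_intros)
  qed simp
  from integral_unique[OF this]
  have "r * integral {-1..1} (\<lambda>z. odd_bump1 d (0 + r * z)) = r * (2 * max 0 (d\<^sup>2 - r\<^sup>2) ^ 3)"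
    by (simp add: odd_bump_def)
  then show ?thesis using False unfolding ray_avg_def by simp
qed

text \<open>The positivity of the test function: (d^2 - y^2)^4, cut off at 0, decreases in the
  modulus of y, and s - r has modulus at most s + r.\<close>

lemma ray_avg_odd_bump_nonneg:
  assumes "r \<ge> 0" "s \<ge> 0"
  shows "ray_avg (\<lambda>z. 1) (odd_bump d) r s \<ge> 0"
proof (cases "r = 0")
  case True
  then show ?thesis using assms by (simp add: ray_avg_def odd_bump_def)
next
  case False
  have "(s - r)\<^sup>2 \<le> (s + r)\<^sup>2" using assms by (simp add: power2_eq_square algebra_simps)
  then have "max 0 (d\<^sup>2 - (s + r)\<^sup>2) ^ 4 \<le> max 0 (d\<^sup>2 - (s - r)\<^sup>2) ^ 4"
    by (intro power_mono) auto
  then have "r * ray_avg (\<lambda>z. 1) (odd_bump d) r s \<ge> 0" unfolding ray_avg_odd_bump by simp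
  then show ?thesis using False assms by (simp add: zero_le_mult_iff)
qed

lemma ray_avg_odd_bump_0: "ray_avg (\<lambda>z. 1) (odd_bump d) r 0 = 0"
proof (cases "r = 0")
  case True
  then show ?thesis by (simp add: ray_avg_def odd_bump_def)
next
  case False
  then show ?thesis using ray_avg_odd_bump[of r d 0] by simp
qed

lemma ray_avg_odd_bump_outside:
  assumes "d > 0" "s \<ge> 0" "r \<ge> s + d"
  shows "ray_avg (\<lambda>z. 1) (odd_bump d) r s = 0"
proof -
  have "d\<^sup>2 \<le> (r - s)\<^sup>2" "d\<^sup>2 \<le> (s + r)\<^sup>2" using assms by (auto intro!: power_mono)
  moreover have "(s - r)\<^sup>2 = (r - s)\<^sup>2" by (simp add: power2_commute)
  ultimately have "r * ray_avg (\<lambda>z. 1) (odd_bump d) r s = 0" unfolding ray_avg_odd_bump by simp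
  then show ?thesis using assms by simp
qed

lemma odd_bump_wave:
  fixes c :: "'a::euclidean_space"
  assumes dim: "DIM('a) = 3" and d: "d > 0"
  obtains \<phi> \<phi>t \<phi>tt :: "'a \<Rightarrow> real \<Rightarrow> real" and \<phi>b \<phi>bb where
    "C2_slab \<tau> \<phi> \<phi>t \<phi>tt \<phi>b \<phi>bb"
    "\<forall>x. \<forall>t\<in>{0..\<tau>}. \<phi>tt x t = (\<Sum>b\<in>Basis. \<phi>bb b x t)"
    "\<forall>x. \<forall>t\<in>{0..\<tau>}. \<phi> x t \<ge> 0"
    "\<forall>x. \<forall>t\<in>{0..\<tau>}. norm (x - c) \<ge> \<tau> - t + d \<longrightarrow> \<phi> x t = 0"
    "\<forall>x. \<phi> x \<tau> = 0"
    "\<forall>x. \<phi>t x \<tau> = - 2 * max 0 (d\<^sup>2 - (norm (x - c))\<^sup>2) ^ 3"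
proof -
  let ?Q = "ray_avg (\<lambda>z. 1) (odd_bump d)" and ?Q1 = "ray_avg (\<lambda>z. 1) (odd_bump1 d)"
    and ?Q2 = "ray_avg (\<lambda>z. 1) (odd_bump2 d)"
  define K where "K = ray_avg (\<lambda>z. (1 - z\<^sup>2) / 2) (odd_bump2 d)"
  define Qrr where "Qrr = ray_avg (\<lambda>z. z\<^sup>2) (odd_bump2 d)"
  have Qr: "((\<lambda>r. ?Q r s) has_real_derivative r * K r s) (at r within A)" for r s A
    using ray_avg_deriv(2)[OF _ odd_bump_continuous(2) odd_bump_deriv(1), of "\<lambda>z. 1" d s r A]
    unfolding K_def
    by (simp add: ray_avg_by_parts[OF odd_bump_deriv(2) odd_bump_continuous(3)])
  have Qr1: "((\<lambda>r. r * K r s) has_real_derivative Qrr r s) (at r within A)" for r s A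
    using ray_avg_deriv(2)[OF _ odd_bump_continuous(3) odd_bump_deriv(2), of "\<lambda>z. z" d s r A]
    unfolding K_def Qrr_def
    by (simp add: ray_avg_by_parts[OF odd_bump_deriv(2) odd_bump_continuous(3)] power2_eq_square)
  have Kr: "((\<lambda>r. K r s) has_real_derivative (Qrr r s - K r s) / r) (at r)" if "r > 0" for r s
  proof -
    have "((\<lambda>r. (r * K r s) / r) has_real_derivative (Qrr r s - K r s) / r) (at r)"
      by (rule derivative_eq_intros Qr1 refl | use that in \<open>simp add: field_simps\<close>)+
    then show ?thesis
      by (rule has_field_derivative_transform_within_open[where S = "{0<..}"]) (use that in auto)
  qed
  \<comment> \<open>Here dimension three enters: the Laplacian 3 K + H with H = Qrr - K is 2 K +
    Qrr, and the weights (1 - z^2) + z^2 add up to 1, the weight of the second time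
    derivative.\<close>
  have K2: "2 * K r s + Qrr r s = ?Q2 r s" for r s
  proof -
    have "K r s + (K r s + Qrr r s) = ray_avg (\<lambda>z. (1 - z\<^sup>2) / 2 + ((1 - z\<^sup>2) / 2 + z\<^sup>2)) (odd_bump2 d) r s"
      unfolding K_def Qrr_def
      by (subst ray_avg_add, (auto intro!: continuous_intros odd_bump_continuous)[3])+ (rule refl)
    moreover have "(\<lambda>z::real. (1 - z\<^sup>2) / 2 + ((1 - z\<^sup>2) / 2 + z\<^sup>2)) = (\<lambda>z. 1)"
      by (auto simp: field_simps)
    ultimately show ?thesis by simp
  qed
  \<comment> \<open>At r = 0 the function \<open>odd_bump2 d\<close> leaves the averages as a
    constant, and the weights z^2 and (1 - z^2)/2 have the same integral 2/3. Hence \<open>H\<close>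
    vanishes at the centre.\<close>
  have int1: "integral {-1..1} (\<lambda>z. z\<^sup>2 - (1 - z\<^sup>2) / 2) = (0::real)"
  proof -
    have "((\<lambda>z. z\<^sup>2 - (1 - z\<^sup>2) / 2) has_integral ((1::real)^3 - 1) / 2 - ((-1)^3 - (-1)) / 2) {-1..1}"
    proof (rule fundamental_theorem_of_calculus)
      show "((\<lambda>z::real. (z ^ 3 - z) / 2) has_vector_derivative z\<^sup>2 - (1 - z\<^sup>2) / 2) (at z within {-1..1})" for z
        unfolding has_real_derivative_iff_has_vector_derivative[symmetric]
        by (rule derivative_eq_intros refl | simp add: field_simps)+
    qed simp
    then show ?thesis by (simp add: integral_unique)
  qed
  have H0: "Qrr 0 s - K 0 s = 0" for s
  proof -
    have "Qrr 0 s - K 0 s = integral {-1..1} (\<lambda>z. z\<^sup>2 * odd_bump2 d s - (1 - z\<^sup>2) / 2 * odd_bump2 d s)"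
      unfolding Qrr_def K_def ray_avg_def
      by (subst integral_diff) (auto intro!: integrable_continuous_real continuous_intros)
    also have "\<dots> = integral {-1..1} (\<lambda>z. z\<^sup>2 - (1 - z\<^sup>2) / 2) * odd_bump2 d s"
      by (simp only: left_diff_distrib[symmetric] integral_mult_left)
    finally show ?thesis by (simp add: int1)
  qed
  have Qt: "((\<lambda>t. ?Q r (\<tau> - t)) has_real_derivative - ?Q1 r (\<tau> - t)) (at t within A)" for r t A
    by (rule DERIV_cong[OF DERIV_chain2[OF ray_avg_deriv(1)[OF _ odd_bump_continuous(2) odd_bump_deriv(1)]]])
       (auto intro!: derivative_eq_intros)
  have Qtt: "((\<lambda>t. - ?Q1 r (\<tau> - t)) has_real_derivative ?Q2 r (\<tau> - t)) (at t within A)" for r t A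
    by (rule DERIV_cong[OF DERIV_minus[OF DERIV_chain2[OF ray_avg_deriv(1)[OF _ odd_bump_continuous(3) odd_bump_deriv(2)]]]])
       (auto intro!: derivative_eq_intros)
  have cont: "continuous_on ({0..} \<times> {0..\<tau>}) (\<lambda>z. ray_avg \<omega> f (fst z) (\<tau> - snd z))"
    if "continuous_on UNIV \<omega>" "continuous_on UNIV f" for \<omega> f
    by (rule continuous_on_curried_compose[of UNIV UNIV "ray_avg \<omega> f"])
       (auto intro!: ray_avg_continuous that continuous_intros)
  have e0: "((\<lambda>r. ?Q r (\<tau> - t)) has_real_derivative 0) (at 0 within {0..})" for t
    using Qr[where r = 0] by simp
  note radial = radial_C2_slab[where e = "\<lambda>r t. ?Q r (\<tau> - t)" and K = "\<lambda>r t. K r (\<tau> - t)"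
      and H = "\<lambda>r t. Qrr r (\<tau> - t) - K r (\<tau> - t)" and et = "\<lambda>r t. - ?Q1 r (\<tau> - t)"
      and ett = "\<lambda>r t. ?Q2 r (\<tau> - t)" and \<tau> = \<tau> and c = c,
      OF Qr Kr e0 H0 Qt Qtt cont _ _ continuous_on_minus[OF cont] cont]
  show ?thesis
  proof (rule that)
    show "C2_slab \<tau> (\<lambda>x t. ?Q (norm (x - c)) (\<tau> - t)) (\<lambda>x t. - ?Q1 (norm (x - c)) (\<tau> - t))
      (\<lambda>x t. ?Q2 (norm (x - c)) (\<tau> - t))
      (\<lambda>b x t. K (norm (x - c)) (\<tau> - t) * ((x - c) \<bullet> b))
      (\<lambda>b x t. K (norm (x - c)) (\<tau> - t) + (Qrr (norm (x - c)) (\<tau> - t) - K (norm (x - c)) (\<tau> - t)) *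
          (((x - c) \<bullet> b) / norm (x - c))\<^sup>2)"
      unfolding K_def Qrr_def
      by (intro radial(1)[unfolded K_def Qrr_def] continuous_on_diff cont odd_bump_continuous continuous_intros) auto
    have sum: "?Q2 (norm (x - c)) (\<tau> - t) =
      (\<Sum>b\<in>Basis. K (norm (x - c)) (\<tau> - t) + (Qrr (norm (x - c)) (\<tau> - t) - K (norm (x - c)) (\<tau> - t)) *
          (((x - c) \<bullet> b) / norm (x - c))\<^sup>2)" if t: "t \<in> {0..\<tau>}" for x t
    proof -
      have "(\<Sum>b\<in>Basis. K (norm (x - c)) (\<tau> - t) + (Qrr (norm (x - c)) (\<tau> - t) - K (norm (x - c)) (\<tau> - t)) *
          (((x - c) \<bullet> b) / norm (x - c))\<^sup>2) =
        DIM('a) * K (norm (x - c)) (\<tau> - t) + (Qrr (norm (x - c)) (\<tau> - t) - K (norm (x - c)) (\<tau> - t))"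
        using t unfolding K_def Qrr_def
        by (intro radial(2)[unfolded K_def Qrr_def] continuous_on_diff cont odd_bump_continuous continuous_intros) auto
      then show ?thesis using K2[of "norm (x - c)" "\<tau> - t"] dim by simp
    qed
    then show "\<forall>x. \<forall>t\<in>{0..\<tau>}. ?Q2 (norm (x - c)) (\<tau> - t) =
      (\<Sum>b\<in>Basis. K (norm (x - c)) (\<tau> - t) + (Qrr (norm (x - c)) (\<tau> - t) - K (norm (x - c)) (\<tau> - t)) *
          (((x - c) \<bullet> b) / norm (x - c))\<^sup>2)" by blast
    show "\<forall>x. \<forall>t\<in>{0..\<tau>}. ?Q (norm (x - c)) (\<tau> - t) \<ge> 0"
      by (intro allI ballI ray_avg_odd_bump_nonneg) auto
    show "\<forall>x. \<forall>t\<in>{0..\<tau>}. norm (x - c) \<ge> \<tau> - t + d \<longrightarrow> ?Q (norm (x - c)) (\<tau> - t) = 0"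
      using d by (intro allI ballI impI ray_avg_odd_bump_outside) auto
  qed (auto simp: ray_avg_odd_bump_0 ray_avg_odd_bump1)
qed

section \<open>Positivity in three dimensions\<close>

lemma wave_positivity_3d:
  fixes w :: "'a::euclidean_space \<Rightarrow> real \<Rightarrow> real"
  assumes dim: "DIM('a) = 3" and w: "C2_slab \<tau> w wt wtt wb wbb" and \<tau>: "\<tau> > 0"
    and init: "\<And>x. w x 0 = 0" "\<And>x. norm (x - x0) \<le> \<tau> \<Longrightarrow> wt x 0 \<ge> 0"
    and box: "\<And>x t. 0 < t \<Longrightarrow> t < \<tau> \<Longrightarrow> norm (x - x0) \<le> \<tau> - t \<Longrightarrow> wtt x t - (\<Sum>b\<in>Basis. wbb b x t) \<ge> 0"
  shows "w x0 \<tau> \<ge> 0"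
proof (rule ccontr)
  assume "\<not> ?thesis"
  then have neg: "w x0 \<tau> < 0" by simp
  obtain \<delta> where \<delta>: "\<delta> > 0" "\<And>x t. t \<in> {0..\<tau>} \<Longrightarrow> dist (x, t) (x0, \<tau>) < \<delta> \<Longrightarrow> w x t < 0"
  proof -
    have "((\<lambda>z. w (fst z) (snd z)) \<longlongrightarrow> w x0 \<tau>) (at (x0, \<tau>) within UNIV \<times> {0..\<tau>})"
      using C2_slabD(5)[OF w, unfolded continuous_on_def, rule_format, of "(x0, \<tau>)"] \<tau> by simp
    then have "\<forall>\<^sub>F z in at (x0, \<tau>) within UNIV \<times> {0..\<tau>}. w (fst z) (snd z) < 0"
      using neg by (rule order_tendstoD)
    then obtain \<delta> where "\<delta> > 0"
      "\<And>z. z \<in> UNIV \<times> {0..\<tau>} \<Longrightarrow> z \<noteq> (x0, \<tau>) \<Longrightarrow> dist z (x0, \<tau>) < \<delta> \<Longrightarrow> w (fst z) (snd z) < 0"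
      unfolding eventually_at by blast
    then show ?thesis using neg that[of \<delta>] by (metis SigmaI UNIV_I fst_conv snd_conv)
  qed
  \<comment> \<open>With T + d = \<tau> the support of the test function, of radius T - t + d, is
    exactly the backward cone of (x0, \<tau>). The ball of radius d at time T lies within distance 2
    d < \<delta> of its tip, where w is negative.\<close>
  define d where "d = min (\<delta> / 3) (\<tau> / 2)"
  define T where "T = \<tau> - d"
  have d: "d > 0" "d \<le> \<tau> / 2" "2 * d < \<delta>" using \<delta> \<tau> by (auto simp: d_def)
  have T: "0 < T" "T \<le> \<tau>" "\<tau> = T + d" using d \<tau> by (auto simp: T_def)
  obtain \<phi> \<phi>t \<phi>tt :: "'a \<Rightarrow> real \<Rightarrow> real" and \<phi>b \<phi>bb where
    \<phi>: "C2_slab T \<phi> \<phi>t \<phi>tt \<phi>b \<phi>bb"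
    and wave0: "\<forall>x. \<forall>t\<in>{0..T}. \<phi>tt x t = (\<Sum>b\<in>Basis. \<phi>bb b x t)"
    and nn0: "\<forall>x. \<forall>t\<in>{0..T}. \<phi> x t \<ge> 0"
    and out0: "\<forall>x. \<forall>t\<in>{0..T}. norm (x - x0) \<ge> T - t + d \<longrightarrow> \<phi> x t = 0"
    and tip0: "\<forall>x. \<phi> x T = 0" "\<forall>x. \<phi>t x T = - 2 * max 0 (d\<^sup>2 - (norm (x - x0))\<^sup>2) ^ 3"
    by (rule odd_bump_wave[OF dim d(1), of T x0])
  note wave = wave0[rule_format] and nn = nn0[rule_format] and out = out0[rule_format]
    and tip = tip0[rule_format]
  have wT: "C2_slab T w wt wtt wb wbb" by (rule C2_slab_mono[OF w T(2)])
  define B where "B = big_box x0 \<tau>"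
  \<comment> \<open>This pairing decides the sign. By Green's identity and the wave equation for
    \<phi> its time derivative is the integral of \<phi> against the wave operator of w, hence
    nonnegative. At time 0 only \<open>wt x 0 * \<phi> x 0\<close> can contribute, since w vanishes;
    at time T only the term with \<open>\<phi>t\<close> is left, and it is negative because w < 0 on
    its support.\<close>
  define I where "I t = integral B (\<lambda>x. wt x t * \<phi> x t - w x t * \<phi>t x t)" for t
  have cB: "continuous_on B f \<Longrightarrow> f integrable_on B" for f :: "'a \<Rightarrow> real"
    unfolding B_def big_box_def by (rule integrable_continuous)
  note cw = C2_slab_slice[OF wT] and c\<phi> = C2_slab_slice[OF \<phi>]
  have I': "(I has_real_derivative integral B (\<lambda>x. wtt x t * \<phi> x t - w x t * \<phi>tt x t)) (at t within {0..T})"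
    if t: "t \<in> {0..T}" for t
    unfolding I_def B_def big_box_def
  proof (rule leibniz_rule_field_derivative[where fx = "\<lambda>t x. wtt x t * \<phi> x t - w x t * \<phi>tt x t"])
    show "((\<lambda>t. wt x t * \<phi> x t - w x t * \<phi>t x t) has_real_derivative wtt x t * \<phi> x t - w x t * \<phi>tt x t)
       (at t within {0..T})" if "t \<in> {0..T}" for t x
      using C2_slabD(1,2)[OF wT that] C2_slabD(1,2)[OF \<phi> that]
      by (auto intro!: derivative_eq_intros)
    show "(\<lambda>x. wt x t * \<phi> x t - w x t * \<phi>t x t) integrable_on
        cbox (x0 - (\<tau> + 1) *\<^sub>R One) (x0 + (\<tau> + 1) *\<^sub>R One)" if "t \<in> {0..T}" for t
      by (intro integrable_continuous continuous_intros cw[OF that] c\<phi>[OF that])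
    show "continuous_on ({0..T} \<times> cbox (x0 - (\<tau> + 1) *\<^sub>R One) (x0 + (\<tau> + 1) *\<^sub>R One))
       (\<lambda>(t, x). wtt x t * \<phi> x t - w x t * \<phi>tt x t)"
      unfolding case_prod_unfold
      by (intro continuous_intros continuous_on_curried_compose[OF C2_slabD(5)[OF wT]]
          continuous_on_curried_compose[OF C2_slabD(7)[OF wT]]
          continuous_on_curried_compose[OF C2_slabD(5)[OF \<phi>]]
          continuous_on_curried_compose[OF C2_slabD(7)[OF \<phi>]]) auto
  qed (use t in auto)
  have I'nn: "integral B (\<lambda>x. wtt x t * \<phi> x t - w x t * \<phi>tt x t) \<ge> 0" if t: "0 < t" "t < T" for t
  proof -
    have t': "t \<in> {0..T}" using t by auto
    have g: "integral B (\<lambda>x. wbb b x t * \<phi> x t - w x t * \<phi>bb b x t) = 0" if b: "b \<in> Basis" for b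
      unfolding B_def
    proof (rule second_green_identity[OF b C2_slabD(3)[OF wT b t'] C2_slabD(4)[OF wT b t'] _ _ _
          C2_slabD(3)[OF \<phi> b t'] C2_slabD(4)[OF \<phi> b t']])
      fix x assume x: "norm (x - x0) > \<tau>"
      have out': "\<phi> y t = 0" if "norm (y - x0) > \<tau>" for y
        using out[OF t', of y] that T t by simp
      have "\<forall>\<^sub>F s in at 0. \<tau> < norm (x + s *\<^sub>R b - x0)"
        using x by (intro order_tendstoD(1)) (auto intro!: tendsto_eq_intros)
      then have "\<forall>\<^sub>F s in nhds 0. \<phi> (x + s *\<^sub>R b) t = 0"
        using x out' by (auto simp: eventually_at_filter elim!: eventually_mono)
      then have "((\<lambda>s. \<phi> (x + s *\<^sub>R b) t) has_real_derivative 0) (at 0)"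
        by (subst DERIV_cong_ev[OF refl _ refl, of _ "\<lambda>s. 0"]) auto
      then have "\<phi>b b x t = 0" using C2_slabD(3)[OF \<phi> b t', of x] DERIV_unique by blast
      then show "\<phi> x t = 0 \<and> \<phi>b b x t = 0" using out'[OF x] by simp
    qed (use cw[OF t'] c\<phi>[OF t'] b in auto)
    have "integral B (\<lambda>x. wtt x t * \<phi> x t - w x t * \<phi>tt x t)
      = integral B (\<lambda>x. (wtt x t - (\<Sum>b\<in>Basis. wbb b x t)) * \<phi> x t +
          (\<Sum>b\<in>Basis. wbb b x t * \<phi> x t - w x t * \<phi>bb b x t))"
      using wave[OF t']
      by (intro integral_cong) (simp add: sum_subtractf sum_distrib_left sum_distrib_right algebra_simps)
    also have "\<dots> = integral B (\<lambda>x. (wtt x t - (\<Sum>b\<in>Basis. wbb b x t)) * \<phi> x t) +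
        integral B (\<lambda>x. (\<Sum>b\<in>Basis. wbb b x t * \<phi> x t - w x t * \<phi>bb b x t))"
      by (intro integral_add cB continuous_intros cw[OF t'] c\<phi>[OF t'])
    also have "integral B (\<lambda>x. (\<Sum>b\<in>Basis. wbb b x t * \<phi> x t - w x t * \<phi>bb b x t)) =
      (\<Sum>b\<in>Basis. integral B (\<lambda>x. wbb b x t * \<phi> x t - w x t * \<phi>bb b x t))"
      by (intro integral_sum cB continuous_intros cw[OF t'] c\<phi>[OF t']) auto
    also have "\<dots> = 0" using g by simp
    finally have "integral B (\<lambda>x. wtt x t * \<phi> x t - w x t * \<phi>tt x t) =
      integral B (\<lambda>x. (wtt x t - (\<Sum>b\<in>Basis. wbb b x t)) * \<phi> x t)" by simp
    moreover have "integral B (\<lambda>x. (wtt x t - (\<Sum>b\<in>Basis. wbb b x t)) * \<phi> x t) \<ge> 0"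
    proof -
      have "(wtt x t - (\<Sum>b\<in>Basis. wbb b x t)) * \<phi> x t \<ge> 0" for x
      proof (cases "norm (x - x0) \<le> \<tau> - t")
        case True
        then show ?thesis using box[of t x] nn[OF t'] t T by auto
      next
        case False
        then show ?thesis using out[OF t', of x] T by auto
      qed
      then show ?thesis
        by (auto intro!: integral_nonneg cB continuous_intros cw[OF t'] c\<phi>[OF t'])
    qed
    ultimately show ?thesis by simp
  qed
  have "I 0 \<le> I T"
  proof (rule DERIV_nonneg_imp_increasing_open[where f = I])
    show "continuous_on {0..T} I" using I' by (rule DERIV_continuous_on)
    show "\<exists>y. (I has_real_derivative y) (at t) \<and> 0 \<le> y" if "0 < t" "t < T" for t
    proof -
      have "at t within {0..T} = at t" using that by (intro at_within_interior) auto
      then show ?thesis using I'[of t] I'nn[OF that] that by auto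
    qed
  qed (use T in auto)
  moreover have "I 0 \<ge> 0"
  proof -
    have 0: "0 \<in> {0..T}" using T by auto
    have "wt x 0 * \<phi> x 0 - w x 0 * \<phi>t x 0 \<ge> 0" for x
      using init(2)[of x] init(1) nn[OF 0, of x] out[OF 0, of x] T by (cases "norm (x - x0) \<le> \<tau>") auto
    then show ?thesis
      unfolding I_def
      by (intro integral_nonneg cB continuous_intros cw[OF 0] c\<phi>[OF 0])
  qed
  moreover have "I T < 0"
  proof -
    have TT: "T \<in> {0..T}" using T by auto
    define h where "h x = - w x T * (2 * max 0 (d\<^sup>2 - (norm (x - x0))\<^sup>2) ^ 3)" for x
    have hn: "h x \<ge> 0" for x
    proof (cases "norm (x - x0) < d")
      case True
      have "dist (x, T) (x0, \<tau>) \<le> dist x x0 + dist T \<tau>"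
        unfolding dist_Pair_Pair by (rule sqrt_sum_squares_le_sum) auto
      also have "\<dots> < \<delta>" using True d T by (simp add: dist_norm)
      finally have "w x T < 0" using \<delta>(2)[of T x] T by auto
      then show ?thesis unfolding h_def by (intro mult_nonneg_nonneg) auto
    next
      case False
      then have "d\<^sup>2 \<le> (norm (x - x0))\<^sup>2" using d by (intro power_mono) auto
      then show ?thesis by (simp add: h_def)
    qed
    have hc: "continuous_on B h"
      unfolding h_def by (intro continuous_intros cw(1)[OF TT])
    have IT: "I T = - integral B h"
      unfolding I_def h_def
      using tip by (simp add: integral_neg[symmetric] del: integral_neg)
    have "integral B h \<noteq> 0"
    proof
      assume "integral B h = 0"
      then have "(h has_integral 0) B" using cB[OF hc] by (simp add: has_integral_iff)
      moreover have "x0 \<in> B" using T d by (auto simp: B_def intro!: cball_subset_big_box)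
      moreover have "box (x0 - (\<tau> + 1) *\<^sub>R One) (x0 + (\<tau> + 1) *\<^sub>R One) \<noteq> {}"
        using \<tau> by (auto simp: box_ne_empty inner_diff_left inner_add_left)
      ultimately have "h x0 = 0"
        using hc hn unfolding B_def big_box_def by (intro has_integral_0_cbox_imp_0)
      moreover have "w x0 T < 0" using \<delta>(2)[of T x0] T d by (auto simp: dist_Pair_Pair dist_real_def)
      ultimately show False using d by (simp add: h_def)
    qed
    moreover have "integral B h \<ge> 0" by (intro integral_nonneg cB hc hn)
    ultimately show ?thesis using IT by simp
  qed
  ultimately show False by simp
qed

section \<open>Comparison for the semilinear equation\<close>

text \<open>Descent: in two dimensions, add a dummy coordinate.\<close>

lemma wave_positivity:
  fixes w :: "'a::euclidean_space \<Rightarrow> real \<Rightarrow> real"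
  assumes dim: "DIM('a) \<in> {2, 3}" and w: "C2_slab \<tau> w wt wtt wb wbb" and \<tau>: "\<tau> > 0"
    and init: "\<And>x. w x 0 = 0" "\<And>x. norm (x - x0) \<le> \<tau> \<Longrightarrow> wt x 0 \<ge> 0"
    and box: "\<And>x t. 0 < t \<Longrightarrow> t < \<tau> \<Longrightarrow> norm (x - x0) \<le> \<tau> - t \<Longrightarrow> wtt x t - (\<Sum>b\<in>Basis. wbb b x t) \<ge> 0"
  shows "w x0 \<tau> \<ge> 0"
proof (cases "DIM('a) = 3")
  case True
  show ?thesis by (rule wave_positivity_3d[OF True w \<tau> init box])
next
  case False
  let ?ext = "\<lambda>f (b :: 'a \<times> real) (z :: 'a \<times> real) (t :: real). (if snd b = 0 then f (fst b) (fst z) t else (0 :: real))"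
  have dim3: "DIM('a \<times> real) = 3" using dim False by simp
  have fst_le: "norm (fst z - x0) \<le> norm (z - (x0, 0))" for z :: "'a \<times> real"
    by (cases z) (auto simp: norm_Pair intro: real_le_rsqrt)
  have comp: "continuous_on (UNIV \<times> {0..\<tau>}) (\<lambda>z. f (fst (fst z)) (snd z))"
    if "continuous_on (UNIV \<times> {0..\<tau>}) (\<lambda>z. f (fst z) (snd z))"
    for f :: "'a \<Rightarrow> real \<Rightarrow> real"
    by (rule continuous_on_curried_compose[OF that]) (auto intro!: continuous_intros)
  have C2: "C2_slab \<tau> (\<lambda>z. w (fst z)) (\<lambda>z. wt (fst z)) (\<lambda>z. wtt (fst z)) (?ext wb) (?ext wbb)"
    unfolding C2_slab_def
  proof (intro conjI allI ballI C2_slabD(1,2)[OF w] comp[OF C2_slabD(5)[OF w]]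
      comp[OF C2_slabD(6)[OF w]] comp[OF C2_slabD(7)[OF w]])
    fix b :: "'a \<times> real" assume b: "b \<in> Basis"
    then have b': "snd b = 0 \<and> fst b \<in> Basis \<or> fst b = 0 \<and> snd b = 1"
      by (auto simp: Basis_prod_def)
    fix z :: "'a \<times> real" and t assume t: "t \<in> {0..\<tau>}"
    show "((\<lambda>s. w (fst (z + s *\<^sub>R b)) t) has_real_derivative ?ext wb b z t) (at 0)"
      "((\<lambda>s. ?ext wb b (z + s *\<^sub>R b) t) has_real_derivative ?ext wbb b z t) (at 0)"
      using b' C2_slabD(3,4)[OF w _ t] by auto
  next
    fix b :: "'a \<times> real" assume b: "b \<in> Basis"
    then have b': "snd b = 0 \<and> fst b \<in> Basis \<or> fst b = 0 \<and> snd b = 1"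
      by (auto simp: Basis_prod_def)
    show "continuous_on (UNIV \<times> {0..\<tau>}) (\<lambda>z. ?ext wb b (fst z) (snd z))"
      "continuous_on (UNIV \<times> {0..\<tau>}) (\<lambda>z. ?ext wbb b (fst z) (snd z))"
      using b' comp[OF C2_slabD(8)[OF w]] comp[OF C2_slabD(9)[OF w]] by auto
  qed auto
  have lap: "(\<Sum>b\<in>Basis. ?ext wbb b z t) = (\<Sum>b\<in>Basis. wbb b (fst z) t)" for z t
  proof -
    have B: "(Basis :: ('a \<times> real) set) = insert (0, 1) ((\<lambda>u. (u, 0)) ` Basis)"
      by (auto simp: Basis_prod_def)
    show ?thesis
      unfolding B
      by (subst sum.insert) (auto simp: image_iff sum.reindex inj_on_def)
  qed
  have "w (fst (x0, 0 :: real)) \<tau> \<ge> 0"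
  proof (rule wave_positivity_3d[OF dim3 C2 \<tau>, of "(x0, 0)"])
    show "w (fst z) 0 = 0" for z :: "'a \<times> real" by (rule init)
    show "wt (fst z) 0 \<ge> 0" if "norm (z - (x0, 0)) \<le> \<tau>" for z :: "'a \<times> real"
      using fst_le[of z] that by (intro init(2)) simp
    show "0 \<le> wtt (fst z) t - (\<Sum>b\<in>Basis. ?ext wbb b z t)"
      if "0 < t" "t < \<tau>" "norm (z - (x0, 0)) \<le> \<tau> - t" for z :: "'a \<times> real" and t
      using box[of t "fst z"] fst_le[of z] that by (simp only: lap)
  qed
  then show ?thesis by simp
qed

section \<open>Comparison on backward cones\<close>

lemma powr_diff_le:
  fixes y d M p :: real
  assumes "p > 1" "0 \<le> y" "y \<le> M" "0 \<le> d" "d \<le> 1"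
  shows "(y + d) powr p \<le> y powr p + p * (M + 1) powr (p - 1) * d"
proof (cases "d = 0")
  case False
  have "\<exists>z\<in>{y<..<y + d}. (y + d) powr p - y powr p = (p * z powr (p - 1)) * (y + d - y)"
  proof (rule mvt)
    show "continuous_on {y..y + d} (\<lambda>x. x powr p)"
      using assms by (intro continuous_on_powr' continuous_intros) auto
    show "((\<lambda>x. x powr p) has_derivative (*) (p * x powr (p - 1))) (at x)" if "y < x" "x < y + d" for x
      unfolding has_field_derivative_def[symmetric]
      using that assms by (auto intro!: derivative_eq_intros)
  qed (use False assms in auto)
  then obtain z where z: "y < z" "z < y + d" "(y + d) powr p - y powr p = d * (p * z powr (p - 1))"
    by (auto simp: mult_ac)
  have "z powr (p - 1) \<le> (M + 1) powr (p - 1)" using z assms by (intro powr_mono2) auto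
  then have "d * (p * z powr (p - 1)) \<le> d * (p * (M + 1) powr (p - 1))"
    using assms by (intro mult_left_mono) auto
  then show ?thesis using z(3) by (simp add: mult_ac)
qed simp

lemma compact_backward_cone:
  "compact {z :: 'a::euclidean_space \<times> real. 0 \<le> snd z \<and> norm (fst z - x0) \<le> \<tau> - snd z}" (is "compact ?K")
proof -
  have "?K \<subseteq> cball x0 \<tau> \<times> {0..\<tau>}"
  proof
    fix z assume "z \<in> ?K"
    then have *: "0 \<le> snd z" "norm (fst z - x0) \<le> \<tau> - snd z" by auto
    have "0 \<le> norm (fst z - x0)" by simp
    then have "snd z \<le> \<tau>" "norm (fst z - x0) \<le> \<tau>" using * by linarith+
    then show "z \<in> cball x0 \<tau> \<times> {0..\<tau>}"
      using * by (cases z) (auto simp: dist_norm norm_minus_commute)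
  qed
  moreover have "closed ?K"
    by (intro closed_Collect_conj closed_Collect_le continuous_intros)
  moreover have "bounded (cball x0 \<tau> \<times> {0..\<tau>})"
    by (intro bounded_Times bounded_cball) simp
  ultimately show ?thesis
    unfolding compact_eq_bounded_closed using bounded_subset by blast
qed

text \<open>With \<open>e exp (\<mu>t)\<close> added to the difference, a first zero of it in the cone would contradict
  the linear positivity principle, since up to then the two sources are comparable.\<close>

lemma semilinear_comparison:
  fixes u v :: "'a::euclidean_space \<Rightarrow> real \<Rightarrow> real"
  assumes dim: "DIM('a) \<in> {2, 3}" and p: "p > 1" and \<tau>: "\<tau> > 0"
    and u: "C2_slab \<tau> u ut utt ub ubb" and v: "C2_slab \<tau> v vt vtt vb vbb"
    and init: "\<And>x. u x 0 = 0" "\<And>x. v x 0 = 0" "\<And>x. norm (x - x0) \<le> \<tau> \<Longrightarrow> vt x 0 \<le> ut x 0"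
    and eq: "\<And>x t. 0 < t \<Longrightarrow> t < \<tau> \<Longrightarrow> norm (x - x0) \<le> \<tau> - t \<Longrightarrow>
        utt x t - (\<Sum>b\<in>Basis. ubb b x t) = \<bar>u x t\<bar> powr p"
    and low: "\<And>x t. 0 < t \<Longrightarrow> t < \<tau> \<Longrightarrow> norm (x - x0) \<le> \<tau> - t \<Longrightarrow> 0 \<le> l x t \<and> l x t \<le> u x t"
    and sub: "\<And>x t. 0 < t \<Longrightarrow> t < \<tau> \<Longrightarrow> norm (x - x0) \<le> \<tau> - t \<Longrightarrow>
        vtt x t - (\<Sum>b\<in>Basis. vbb b x t) \<le> max (v x t) (l x t) powr p"
  shows "v x0 \<tau> \<le> u x0 \<tau>"
proof (rule ccontr)
  assume "\<not> ?thesis"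
  then have neg: "u x0 \<tau> - v x0 \<tau> < 0" by simp
  define K where "K = {z :: 'a \<times> real. 0 \<le> snd z \<and> norm (fst z - x0) \<le> \<tau> - snd z}"
  have K: "compact K" unfolding K_def by (rule compact_backward_cone)
  have Ksub: "K \<subseteq> UNIV \<times> {0..\<tau>}"
  proof
    fix z assume "z \<in> K"
    then have "0 \<le> snd z" "snd z \<le> \<tau>" unfolding K_def using norm_ge_zero[of "fst z - x0"] by (simp_all, linarith)
    then show "z \<in> UNIV \<times> {0..\<tau>}" by (simp add: mem_Times_iff)
  qed
  have uK: "continuous_on K (\<lambda>z. u (fst z) (snd z))" and vK: "continuous_on K (\<lambda>z. v (fst z) (snd z))"
    using C2_slabD(5)[OF u] C2_slabD(5)[OF v] Ksub continuous_on_subset by blast+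
  obtain M where M: "M > 0" "\<And>z. z \<in> K \<Longrightarrow> u (fst z) (snd z) \<le> M"
  proof -
    have "bounded ((\<lambda>z. u (fst z) (snd z)) ` K)"
      by (intro compact_imp_bounded compact_continuous_image uK K)
    then obtain M where "M > 0" "\<And>y. y \<in> (\<lambda>z. u (fst z) (snd z)) ` K \<Longrightarrow> norm y \<le> M"
      unfolding bounded_pos by blast
    then show ?thesis using that[of M] by force
  qed
  \<comment> \<open>The square of \<mu> is the Lipschitz constant of the source on [0, M + 1]. The
    second time derivative of e exp(\<mu> t) then compensates for the change of the source under
    this perturbation.\<close>
  define \<mu> where "\<mu> = sqrt (p * (M + 1) powr (p - 1))"
  have \<mu>: "\<mu> \<ge> 0" "\<mu>\<^sup>2 = p * (M + 1) powr (p - 1)" using p by (auto simp: \<mu>_def)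
  \<comment> \<open>Up to time \<tau> the perturbation stays below 1, so its addition to u remains
    within M + 1. It also stays below half of the deficit v - u at the tip, so that \<open>W\<close>
    is still negative there.\<close>
  define e where "e = min 1 ((v x0 \<tau> - u x0 \<tau>) / 2) * exp (- (\<mu> * \<tau>))"
  have e: "e > 0" using neg by (simp add: e_def)
  have e1: "e * exp (\<mu> * t) \<le> min 1 ((v x0 \<tau> - u x0 \<tau>) / 2)" if "t \<le> \<tau>" for t
  proof -
    have "e * exp (\<mu> * t) = min 1 ((v x0 \<tau> - u x0 \<tau>) / 2) * exp (\<mu> * (t - \<tau>))"
      by (simp add: e_def exp_add[symmetric] algebra_simps)
    also have "\<dots> \<le> min 1 ((v x0 \<tau> - u x0 \<tau>) / 2) * 1"
      using that \<mu> neg by (intro mult_left_mono) (auto simp: mult_nonneg_nonpos)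
    finally show ?thesis by simp
  qed
  define W where "W z = u (fst z) (snd z) - v (fst z) (snd z) + e * exp (\<mu> * snd z)" for z
  define Z where "Z = K \<inter> {z \<in> K. W z \<in> {..0}}"
  have "closed {z \<in> K. W z \<in> {..0}}"
    unfolding W_def
    by (intro continuous_closed_preimage[unfolded vimage_def Int_def, simplified] continuous_intros uK vK compact_imp_closed K closed_atMost)
  then have "compact Z" unfolding Z_def by (intro compact_Int_closed K)
  moreover have "(x0, \<tau>) \<in> Z"
    using e1[of \<tau>] neg \<tau> by (auto simp: Z_def K_def W_def)
  ultimately obtain z1 where z1: "z1 \<in> Z" "\<And>z. z \<in> Z \<Longrightarrow> snd z1 \<le> snd z"
    using continuous_attains_inf[of Z snd] continuous_on_snd[OF continuous_on_id] by blast
  define x1 t1 where "x1 = fst z1" and "t1 = snd z1"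
  have z1K: "0 \<le> t1" "norm (x1 - x0) \<le> \<tau> - t1" "W (x1, t1) \<le> 0"
    using z1(1) by (auto simp: Z_def K_def x1_def t1_def)
  have "t1 \<noteq> 0"
  proof
    assume "t1 = 0"
    then have "W (x1, t1) = e" by (simp add: W_def init)
    then show False using z1K e by simp
  qed
  then have t1: "0 < t1" "t1 \<le> \<tau>" using z1K norm_ge_zero[of "x1 - x0"] by linarith+
  \<comment> \<open>Subtracting e - e exp(\<mu> t) instead of adding e exp(\<mu> t) keeps the
    initial value 0, as the linear principle requires. Its conclusion then reads W \<ge> e, strictly
    more than what is contradicted.\<close>
  define \<theta> where "\<theta> t = e - e * exp (\<mu> * t)" for t
  have "C2_slab t1 (\<lambda>x. \<theta>) (\<lambda>x t. - (e * \<mu> * exp (\<mu> * t))) (\<lambda>x t. - (e * \<mu>\<^sup>2 * exp (\<mu> * t)))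
      (\<lambda>b x t. 0) (\<lambda>(b::'a) (x::'a) t. 0)"
    unfolding \<theta>_def
    by (rule C2_slab_time) (auto intro!: derivative_eq_intros continuous_intros simp: power2_eq_square)
  note C2 = C2_slab_diff[OF C2_slab_diff[OF C2_slab_mono[OF u t1(2)] C2_slab_mono[OF v t1(2)]] this]
  have "0 \<le> u x1 t1 - v x1 t1 - \<theta> t1"
  proof (rule wave_positivity[OF dim C2 t1(1)])
    show "u x 0 - v x 0 - \<theta> 0 = 0" for x by (simp add: init \<theta>_def)
    show "0 \<le> ut x 0 - vt x 0 - - (e * \<mu> * exp (\<mu> * 0))" if "norm (x - x1) \<le> t1" for x
    proof -
      have "norm (x - x0) \<le> \<tau>" using norm_triangle_ineq[of "x - x1" "x1 - x0"] that z1K by simp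
      then show ?thesis using init(3)[of x] e \<mu> by (simp add: add_nonneg_nonneg)
    qed
    fix x t assume t: "0 < t" "t < t1" and x: "norm (x - x1) \<le> t1 - t"
    have cone: "norm (x - x0) \<le> \<tau> - t" using norm_triangle_ineq[of "x - x1" "x1 - x0"] x z1K by simp
    have tt: "0 < t" "t < \<tau>" using t t1 by auto
    have "(x, t) \<in> K" using cone t by (simp add: K_def)
    moreover have "(x, t) \<notin> Z" using z1(2)[of "(x, t)"] t by (auto simp: t1_def)
    ultimately have W: "W (x, t) > 0" by (auto simp: Z_def)
    define d where "d = e * exp (\<mu> * t)"
    have d: "0 \<le> d" "d \<le> 1" using e e1[of t] tt by (auto simp: d_def)
    have l: "0 \<le> l x t" "l x t \<le> u x t" using low[OF tt cone] by auto
    \<comment> \<open>v lies below u + d since the point is earlier than the first zero of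
      \<open>W\<close>, and \<open>l\<close> lies below u by assumption. Through \<open>l\<close>
      the source of v may use a bound on u that v itself does not attain.\<close>
    have "max (v x t) (l x t) \<le> u x t + d" using W l d by (auto simp: W_def d_def)
    then have "max (v x t) (l x t) powr p \<le> (u x t + d) powr p"
      using l p by (intro powr_mono2) auto
    also have "\<dots> \<le> u x t powr p + \<mu>\<^sup>2 * d"
      unfolding \<mu>(2) using p l d M(2)[OF \<open>(x, t) \<in> K\<close>] by (intro powr_diff_le) auto
    finally have "vtt x t - (\<Sum>b\<in>Basis. vbb b x t) \<le> utt x t - (\<Sum>b\<in>Basis. ubb b x t) + \<mu>\<^sup>2 * d"
      using sub[OF tt cone] eq[OF tt cone] l by simp
    then show "0 \<le> utt x t - vtt x t - - (e * \<mu>\<^sup>2 * exp (\<mu> * t)) - (\<Sum>b\<in>Basis. ubb b x t - vbb b x t - 0)"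
      by (simp add: sum_subtractf d_def algebra_simps)
  qed
  then have "W (x1, t1) \<ge> e" by (simp add: W_def \<theta>_def)
  then show False using z1K e by simp
qed

section \<open>From classical solutions to explicit derivatives\<close>

lemma has_derivative_along_line:
  fixes F :: "'a::real_normed_vector \<Rightarrow> real"
  assumes "(F has_derivative F') (at (z + s0 *\<^sub>R d) within S)"
    and "\<And>s. s \<in> A \<Longrightarrow> z + s *\<^sub>R d \<in> S"
  shows "((\<lambda>s. F (z + s *\<^sub>R d)) has_real_derivative F' d) (at s0 within A)"
proof -
  have "((\<lambda>s. z + s *\<^sub>R d) has_derivative (\<lambda>h. h *\<^sub>R d)) (at s0 within A)"
    by (auto intro!: derivative_eq_intros)
  moreover have "(F has_derivative F') (at (z + s0 *\<^sub>R d) within (\<lambda>s. z + s *\<^sub>R d) ` A)"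
    using assms by (intro has_derivative_subset[OF assms(1)]) auto
  ultimately have "((\<lambda>s. F (z + s *\<^sub>R d)) has_derivative (\<lambda>h. F' (h *\<^sub>R d))) (at s0 within A)"
    by (rule has_derivative_in_compose)
  moreover have "(\<lambda>h. F' (h *\<^sub>R d)) = (*) (F' d)"
    using linear_cmul[OF has_derivative_linear[OF assms(1)]] by (auto simp: mult.commute)
  ultimately show ?thesis by (simp add: has_field_derivative_def)
qed

lemma sum_Basis_vec: "(\<Sum>b\<in>(Basis :: (real ^ 'n) set). F b) = (\<Sum>i\<in>UNIV. F (axis i 1))"
proof -
  have B: "(Basis :: (real ^ 'n) set) = range (\<lambda>i. axis i 1)"
    by (auto simp: Basis_vec_def)
  have inj: "inj (\<lambda>i. axis i (1 :: real) :: real ^ 'n)"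
    by (auto simp: inj_on_def axis_eq_axis)
  show ?thesis unfolding B by (subst sum.reindex[OF inj]) (simp add: o_def)
qed

text \<open>The joint derivatives supplied by \<open>Ck_on 2\<close> are evaluated in the directions
  (0, 1) and (b, 0). The iterated \<open>deriv\<close> of the equation is identified only for t > 0,
  where derivatives within the slab are two-sided; at t = 0 uniqueness of the one-sided derivative
  identifies the initial velocity.\<close>

lemma classical_solution_C2_slab:
  fixes u :: "(real ^ 'n) \<times> real \<Rightarrow> real"
  assumes sol: "classical_solution p T \<phi> \<psi> u" and T: "T > 0"
  obtains ut utt ub ubb where
    "\<forall>\<tau><T. C2_slab \<tau> (\<lambda>x t. u (x, t)) ut utt ub ubb"
    "\<forall>x. \<forall>t\<in>{0<..<T}. utt x t - (\<Sum>b\<in>Basis. ubb b x t) = \<bar>u (x, t)\<bar> powr p"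
    "\<forall>x. u (x, 0) = \<phi> x" "\<forall>x. ut x 0 = \<psi> x"
proof -
  let ?S = "(UNIV :: (real ^ 'n) set) \<times> {0..<T}"
  from sol obtain f' where
    f': "\<And>z. z \<in> ?S \<Longrightarrow> (u has_derivative f' z) (at z within ?S)" and "\<And>v. Ck_on (Suc 0) (\<lambda>z. f' z v) ?S"
    unfolding classical_solution_def numeral_2_eq_2 Ck_on.simps(2)[of "Suc 0"] by blast
  then have "\<forall>v. \<exists>f''. (\<forall>z\<in>?S. ((\<lambda>z. f' z v) has_derivative f'' z) (at z within ?S)) \<and>
      (\<forall>w. continuous_on ?S (\<lambda>z. f'' z w))"
    unfolding Ck_on.simps by blast
  then obtain f'' where
    f'': "\<And>v z. z \<in> ?S \<Longrightarrow> ((\<lambda>z. f' z v) has_derivative f'' v z) (at z within ?S)"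
    and cont'': "\<And>v w. continuous_on ?S (\<lambda>z. f'' v z w)"
    by metis
  have cont': "continuous_on ?S (\<lambda>z. f' z v)" for v
    using f'' has_derivative_continuous continuous_on_eq_continuous_within by blast
  have cont: "continuous_on ?S u"
    using f' has_derivative_continuous continuous_on_eq_continuous_within by blast
  define ut utt where "ut x t = f' (x, t) (0, 1)" and "utt x t = f'' (0, 1) (x, t) (0, 1)" for x t
  define ub ubb where "ub b x t = f' (x, t) (b, 0)" and "ubb b x t = f'' (b, 0) (x, t) (b, 0)" for b x t
  have time: "((\<lambda>s. F (x, s)) has_real_derivative F' (0, 1)) (at t within A)"
    if "(F has_derivative F') (at (x, t) within ?S)" "A \<subseteq> {0..<T}" for F F' x t A
    using has_derivative_along_line[of F F' "(x, 0)" t "(0, 1)" ?S A] that by force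
  have space: "((\<lambda>s. F (x + s *\<^sub>R b, t)) has_real_derivative F' (b, 0)) (at 0)"
    if "(F has_derivative F') (at (x, t) within ?S)" "t \<in> {0..<T}" for F F' x t b
    using has_derivative_along_line[of F F' "(x, t)" 0 "(b, 0)" ?S UNIV] that by auto
  have dt: "((\<lambda>s. u (x, s)) has_real_derivative ut x t) (at t within A)"
    "(ut x has_real_derivative utt x t) (at t within A)"
    if "t \<in> {0..<T}" "A \<subseteq> {0..<T}" for x t A
    unfolding ut_def[abs_def] utt_def using that by (auto intro!: time[OF f'] time[OF f''[where v = "(0, 1)"]])
  have dx: "((\<lambda>s. u (x + s *\<^sub>R b, t)) has_real_derivative ub b x t) (at 0)"
    "((\<lambda>s. ub b (x + s *\<^sub>R b) t) has_real_derivative ubb b x t) (at 0)"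
    if "t \<in> {0..<T}" for x t b
    unfolding ub_def[abs_def] ubb_def using that by (auto intro!: space[OF f'] space[OF f''[where v = "(b, 0)"]])
  have "C2_slab \<tau> (\<lambda>x t. u (x, t)) ut utt ub ubb" if \<tau>: "\<tau> < T" for \<tau>
  proof -
    have sub: "{0..\<tau>} \<subseteq> {0..<T}" "UNIV \<times> {0..\<tau>} \<subseteq> ?S" using \<tau> by auto
    have "continuous_on (UNIV \<times> {0..\<tau>}) F" if "continuous_on ?S F" for F :: "(real ^ 'n) \<times> real \<Rightarrow> real"
      using that sub(2) continuous_on_subset by blast
    then show ?thesis
      unfolding C2_slab_def ut_def utt_def ub_def ubb_def
      using dt[OF _ sub(1), unfolded ut_def utt_def] dx[unfolded ub_def ubb_def] sub(1) cont cont' cont''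
      by auto
  qed
  moreover have "utt x t - (\<Sum>b\<in>Basis. ubb b x t) = \<bar>u (x, t)\<bar> powr p" if t: "t \<in> {0<..<T}" for x t
  proof -
    have at: "at s within {0<..<T} = at s" if "s \<in> {0<..<T}" for s
      using that by (intro at_within_open) auto
    have sub0: "{0<..<T} \<subseteq> {0..<T}" by auto
    have d1: "((\<lambda>s. u (x, s)) has_real_derivative ut x s) (at s)" if "s \<in> {0<..<T}" for s
      using dt(1)[OF _ sub0, of s] at[OF that] that by auto
    have "(deriv (\<lambda>s. u (x, s)) has_real_derivative utt x t) (at t)"
    proof (rule has_field_derivative_transform_within_open)
      show "(ut x has_real_derivative utt x t) (at t)"
        using dt(2)[OF _ sub0, of t] at[OF t] t by auto
      show "ut x s = deriv (\<lambda>s. u (x, s)) s" if "s \<in> {0<..<T}" for s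
        using d1[OF that] by (simp add: DERIV_imp_deriv)
    qed (use t in auto)
    then have tt: "(deriv ^^ 2) (\<lambda>s. u (x, s)) t = utt x t"
      by (simp add: numeral_2_eq_2 DERIV_imp_deriv)
    have "(deriv ^^ 2) (\<lambda>s. u (x + s *\<^sub>R b, t)) 0 = ubb b x t" for b
    proof -
      have "deriv (\<lambda>s. u (x + s *\<^sub>R b, t)) s = ub b (x + s *\<^sub>R b) t" for s
        using t by (intro DERIV_imp_deriv DERIV_along_shift[where f = "\<lambda>x. u (x, t)" and f' = "\<lambda>x. ub b x t"] dx(1)) auto
      then have "deriv (\<lambda>s. u (x + s *\<^sub>R b, t)) = (\<lambda>s. ub b (x + s *\<^sub>R b) t)" by auto
      then show ?thesis
        using t dx(2)[of t b x] by (simp add: numeral_2_eq_2 DERIV_imp_deriv)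
    qed
    then have lap: "laplacian (\<lambda>y. u (y, t)) x = (\<Sum>b\<in>Basis. ubb b x t)"
      by (simp add: laplacian_def sum_Basis_vec)
    have "(deriv ^^ 2) (\<lambda>s. u (x, s)) t - laplacian (\<lambda>y. u (y, t)) x = \<bar>u (x, t)\<bar> powr p"
      using sol t unfolding classical_solution_def by blast
    then show ?thesis by (simp only: tt lap)
  qed
  moreover have "ut x 0 = \<psi> x" for x
  proof -
    have T2: "T / 2 > 0" and sub: "{0..T / 2} \<subseteq> {0..<T}" using T by auto
    have "((\<lambda>s. u (x, s)) has_real_derivative \<psi> x) (at 0 within {0..T / 2})"
      using sol sub by (auto simp: classical_solution_def intro: DERIV_subset)
    moreover have "((\<lambda>s. u (x, s)) has_real_derivative ut x 0) (at 0 within {0..T / 2})"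
      using dt(1)[of 0 _ x, OF _ sub] T by auto
    moreover have "at 0 within {0..T / 2} \<noteq> bot"
      using T2 by (simp add: at_within_Icc_at_right)
    ultimately show ?thesis
      unfolding has_real_derivative_iff_has_vector_derivative
      using vector_derivative_unique_within by blast
  qed
  moreover have "u (x, 0) = \<phi> x" for x using sol by (simp add: classical_solution_def)
  ultimately show ?thesis by (intro that[of ut utt ub ubb]) auto
qed

section \<open>Twice continuously differentiable functions of one variable\<close>

text \<open>Unlike \<open>C2_slab\<close> this takes the derivatives from \<open>deriv\<close>, so
  that profiles built by products and compositions are regular without their derivatives being
  written out.\<close>

definition C2_fun :: "real set \<Rightarrow> (real \<Rightarrow> real) \<Rightarrow> bool" where
  "C2_fun S f \<longleftrightarrow> (\<forall>x\<in>S. (f has_real_derivative deriv f x) (at x)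
     \<and> (deriv f has_real_derivative deriv (deriv f) x) (at x)) \<and> continuous_on S (deriv (deriv f))"

lemma C2_funI:
  assumes S: "open S" and f: "\<And>x. x \<in> S \<Longrightarrow> (f has_real_derivative f' x) (at x)"
    "\<And>x. x \<in> S \<Longrightarrow> (f' has_real_derivative f'' x) (at x)" and cont: "continuous_on S f''"
  shows "C2_fun S f"
proof -
  have d1: "deriv f x = f' x" if "x \<in> S" for x using f(1)[OF that] by (rule DERIV_imp_deriv)
  have D2: "(deriv f has_real_derivative f'' x) (at x)" if "x \<in> S" for x
    by (rule has_field_derivative_transform_within_open[OF f(2)[OF that] S that]) (simp add: d1)
  have d2: "deriv (deriv f) x = f'' x" if "x \<in> S" for x using D2[OF that] by (rule DERIV_imp_deriv)
  show ?thesis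
    unfolding C2_fun_def
  proof (intro conjI ballI)
    fix x assume x: "x \<in> S"
    show "(f has_real_derivative deriv f x) (at x)" using f(1)[OF x] d1[OF x] by simp
    show "(deriv f has_real_derivative deriv (deriv f) x) (at x)" using D2[OF x] d2[OF x] by simp
  next
    show "continuous_on S (deriv (deriv f))"
      by (rule continuous_on_eq[OF cont]) (simp add: d2)
  qed
qed

lemma C2_funD:
  assumes "C2_fun S f"
  shows "\<And>x. x \<in> S \<Longrightarrow> (f has_real_derivative deriv f x) (at x)"
    and "\<And>x. x \<in> S \<Longrightarrow> (deriv f has_real_derivative deriv (deriv f) x) (at x)"
    and "continuous_on S f" "continuous_on S (deriv f)" "continuous_on S (deriv (deriv f))"
proof -
  show 1: "\<And>x. x \<in> S \<Longrightarrow> (f has_real_derivative deriv f x) (at x)"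
    and 2: "\<And>x. x \<in> S \<Longrightarrow> (deriv f has_real_derivative deriv (deriv f) x) (at x)"
    and "continuous_on S (deriv (deriv f))"
    using assms by (auto simp: C2_fun_def)
  show "continuous_on S f" "continuous_on S (deriv f)"
    by (rule DERIV_continuous_on[OF has_field_derivative_at_within], rule 1, assumption)
       (rule DERIV_continuous_on[OF has_field_derivative_at_within], rule 2, assumption)
qed

lemma C2_fun_subset: "C2_fun S f \<Longrightarrow> T \<subseteq> S \<Longrightarrow> C2_fun T f"
  unfolding C2_fun_def using continuous_on_subset by blast

lemma C2_fun_linear: "C2_fun UNIV (\<lambda>x. a * x + b)"
  by (rule C2_funI[where f' = "\<lambda>x. a" and f'' = "\<lambda>x. 0"])
     (auto intro!: derivative_eq_intros continuous_intros)

lemma C2_fun_mult: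
  assumes S: "open S" and f: "C2_fun S f" and g: "C2_fun S g"
  shows "C2_fun S (\<lambda>x. f x * g x)"
proof (rule C2_funI[OF S, where f' = "\<lambda>x. deriv f x * g x + deriv g x * f x"
        and f'' = "\<lambda>x. (deriv (deriv f) x * g x + deriv g x * deriv f x) + (deriv (deriv g) x * f x + deriv f x * deriv g x)"])
  note F = C2_funD[OF f] and G = C2_funD[OF g]
  fix x assume x: "x \<in> S"
  show "((\<lambda>x. f x * g x) has_real_derivative deriv f x * g x + deriv g x * f x) (at x)"
    by (rule DERIV_mult[OF F(1)[OF x] G(1)[OF x]])
  show "((\<lambda>x. deriv f x * g x + deriv g x * f x) has_real_derivative
      (deriv (deriv f) x * g x + deriv g x * deriv f x) + (deriv (deriv g) x * f x + deriv f x * deriv g x)) (at x)"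
    by (rule DERIV_add[OF DERIV_mult[OF F(2)[OF x] G(1)[OF x]] DERIV_mult[OF G(2)[OF x] F(1)[OF x]]])
qed (intro continuous_intros C2_funD[OF f] C2_funD[OF g])

lemma C2_fun_diff:
  assumes S: "open S" and f: "C2_fun S f" and g: "C2_fun S g"
  shows "C2_fun S (\<lambda>x. f x - g x)"
proof (rule C2_funI[OF S])
  fix x assume x: "x \<in> S"
  show "((\<lambda>x. f x - g x) has_real_derivative deriv f x - deriv g x) (at x)"
    by (rule DERIV_diff[OF C2_funD(1)[OF f x] C2_funD(1)[OF g x]])
  show "((\<lambda>x. deriv f x - deriv g x) has_real_derivative deriv (deriv f) x - deriv (deriv g) x) (at x)"
    by (rule DERIV_diff[OF C2_funD(2)[OF f x] C2_funD(2)[OF g x]])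
qed (intro continuous_intros C2_funD[OF f] C2_funD[OF g])

lemma C2_fun_compose:
  assumes S: "open S" and g: "C2_fun S g" and f: "C2_fun T f" and sub: "\<And>x. x \<in> S \<Longrightarrow> g x \<in> T"
  shows "C2_fun S (\<lambda>x. f (g x))"
proof (rule C2_funI[OF S, where f' = "\<lambda>x. deriv f (g x) * deriv g x"
      and f'' = "\<lambda>x. deriv (deriv f) (g x) * (deriv g x)\<^sup>2 + deriv f (g x) * deriv (deriv g) x"])
  note F = C2_funD[OF f] and G = C2_funD[OF g]
  show "((\<lambda>x. f (g x)) has_real_derivative deriv f (g x) * deriv g x) (at x)" if "x \<in> S" for x
    by (rule DERIV_chain2[OF F(1)[OF sub[OF that]] G(1)[OF that]])
  show "((\<lambda>x. deriv f (g x) * deriv g x) has_real_derivative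
      deriv (deriv f) (g x) * (deriv g x)\<^sup>2 + deriv f (g x) * deriv (deriv g) x) (at x)" if "x \<in> S" for x
    using DERIV_mult[OF DERIV_chain2[OF F(2)[OF sub[OF that]] G(1)[OF that]] G(2)[OF that]]
    by (simp add: algebra_simps power2_eq_square)
  show "continuous_on S (\<lambda>x. deriv (deriv f) (g x) * (deriv g x)\<^sup>2 + deriv f (g x) * deriv (deriv g) x)"
    using sub by (intro continuous_intros G continuous_on_compose2[OF F(4)] continuous_on_compose2[OF F(5)]) auto
qed

lemma C2_fun_powr: "C2_fun {0<..} (\<lambda>x. x powr a)"
  by (rule C2_funI[where f' = "\<lambda>x. a * x powr (a - 1)" and f'' = "\<lambda>x. a * ((a - 1) * x powr (a - 1 - 1))"])
     (auto intro!: derivative_eq_intros continuous_intros)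

lemma C2_fun_ln: "C2_fun {0<..} ln"
  by (rule C2_funI[where f' = "\<lambda>x. 1 / x" and f'' = "\<lambda>x. - 1 / x\<^sup>2"])
     (auto intro!: derivative_eq_intros continuous_intros simp: power2_eq_square field_simps)

section \<open>Truncation and cutoff functions\<close>

text \<open>The third power is the smallest integer power for which the positive part is
  C^2.\<close>

definition pos3 :: "real \<Rightarrow> real" where "pos3 x = max 0 x ^ 3"

lemma deriv_pos3: "deriv pos3 x = 3 * max 0 x ^ 2"
  unfolding pos3_def[abs_def] by (rule DERIV_imp_deriv[OF DERIV_pos_part(2)])

lemma C2_fun_pos3: "C2_fun UNIV pos3"
proof (rule C2_funI[where f' = "\<lambda>x. 3 * max 0 x ^ 2" and f'' = "\<lambda>x. 3 * (2 * max 0 x)"])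
  show "(pos3 has_real_derivative 3 * max 0 x ^ 2) (at x)" for x
    unfolding pos3_def[abs_def] by (rule DERIV_pos_part(2))
  show "((\<lambda>x. 3 * max 0 x ^ 2) has_real_derivative 3 * (2 * max 0 x)) (at x)" for x :: real
    by (rule DERIV_cmult[OF DERIV_pos_part(1)])
qed (auto intro!: continuous_intros)

lemma pos3_simps: "x \<le> 0 \<Longrightarrow> pos3 x = 0" "x \<ge> 0 \<Longrightarrow> pos3 x = x ^ 3" "pos3 x \<ge> 0"
  by (auto simp: pos3_def max_absorb1 max_absorb2)

text \<open>A C^2 step rising over [0, 1], composed from \<open>pos3\<close> alone so that its
  regularity is inherited. Its slope is at most 9, which is the origin of the constants 18 and 52
  below.\<close>

definition smooth_step :: "real \<Rightarrow> real" where "smooth_step x = 1 - pos3 (1 - pos3 x)"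

lemma C2_fun_smooth_step: "C2_fun UNIV smooth_step"
proof -
  have "C2_fun UNIV (\<lambda>x. (0 * x + 1) - pos3 x)"
    by (intro C2_fun_diff C2_fun_linear C2_fun_pos3 open_UNIV)
  then have "C2_fun UNIV (\<lambda>x. pos3 ((0 * x + 1) - pos3 x))"
    by (intro C2_fun_compose[OF open_UNIV _ C2_fun_pos3]) auto
  then have "C2_fun UNIV (\<lambda>x. (0 * x + 1) - pos3 ((0 * x + 1) - pos3 x))"
    by (intro C2_fun_diff C2_fun_linear open_UNIV)
  then show ?thesis unfolding smooth_step_def[abs_def] by simp
qed

lemma smooth_step_0: "x \<le> 0 \<Longrightarrow> smooth_step x = 0"
  and smooth_step_1: "x \<ge> 1 \<Longrightarrow> smooth_step x = 1"
  and smooth_step_ge_0: "smooth_step x \<ge> 0"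
  and smooth_step_le_1: "smooth_step x \<le> 1"
proof -
  show "x \<le> 0 \<Longrightarrow> smooth_step x = 0" by (simp add: smooth_step_def pos3_def max_absorb1 max_absorb2)
  show "smooth_step x = 1" if "x \<ge> 1"
  proof -
    have "1 \<le> x ^ 3" using that by (rule one_le_power)
    then show ?thesis using that by (simp add: smooth_step_def pos3_simps)
  qed
  have "max 0 (1 - pos3 x) ^ 3 \<le> 1" using pos3_simps(3)[of x] by (intro power_le_one) auto
  then show "smooth_step x \<ge> 0" by (simp add: smooth_step_def pos3_def[of "1 - pos3 x"])
  show "smooth_step x \<le> 1" using pos3_simps(3) by (simp add: smooth_step_def)
qed

lemma deriv_smooth_step: "deriv smooth_step x = 9 * max 0 (1 - pos3 x) ^ 2 * max 0 x ^ 2"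
proof -
  have P: "(pos3 has_real_derivative 3 * max 0 y ^ 2) (at y)" for y
    using C2_funD(1)[OF C2_fun_pos3] deriv_pos3 by simp
  have "(smooth_step has_real_derivative 0 - (3 * max 0 (1 - pos3 x) ^ 2) * (0 - 3 * max 0 x ^ 2)) (at x)"
    unfolding smooth_step_def[abs_def]
    by (intro DERIV_diff DERIV_chain2[OF P] P DERIV_const)
  then show ?thesis by (simp add: DERIV_imp_deriv)
qed

lemma deriv_smooth_step_0: "x \<le> 0 \<Longrightarrow> deriv smooth_step x = 0"
  and deriv_smooth_step_1: "x \<ge> 1 \<Longrightarrow> deriv smooth_step x = 0"
  and deriv_smooth_step_ge_0: "deriv smooth_step x \<ge> 0"
  and deriv_smooth_step_le_9: "deriv smooth_step x \<le> 9"
proof -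
  show z: "x \<le> 0 \<Longrightarrow> deriv smooth_step x = 0" by (simp add: deriv_smooth_step max_absorb1)
  show o: "deriv smooth_step x = 0" if "x \<ge> 1"
  proof -
    have "1 \<le> x ^ 3" using that by (rule one_le_power)
    then show ?thesis using that by (simp add: deriv_smooth_step pos3_simps max_absorb1)
  qed
  show "deriv smooth_step x \<ge> 0" by (simp add: deriv_smooth_step)
  show "deriv smooth_step x \<le> 9"
  proof (cases "x \<ge> 1")
    case False
    have "max 0 (1 - pos3 x) ^ 2 \<le> 1" using pos3_simps(3)[of x] by (intro power_le_one) auto
    moreover have "max 0 x ^ 2 \<le> 1" using False by (intro power_le_one) auto
    ultimately have "max 0 (1 - pos3 x) ^ 2 * max 0 x ^ 2 \<le> 1 * 1" by (intro mult_mono) auto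
    then show ?thesis by (simp add: deriv_smooth_step)
  qed (simp add: o)
qed

lemma smooth_step_mono:
  assumes "x \<le> y"
  shows "smooth_step x \<le> smooth_step y"
proof (rule DERIV_nonneg_imp_nondecreasing[OF assms])
  show "\<exists>d. (smooth_step has_real_derivative d) (at z) \<and> 0 \<le> d" for z
    using C2_funD(1)[OF C2_fun_smooth_step, of z] deriv_smooth_step_ge_0[of z] by blast
qed

lemma deriv2_smooth_step_0: "x < 0 \<or> x > 1 \<Longrightarrow> deriv (deriv smooth_step) x = 0"
proof -
  assume "x < 0 \<or> x > 1"
  define S :: "real set" where "S = (if x < 0 then {..<0} else {1<..})"
  have S: "open S" "x \<in> S" "S = {..<0} \<or> S = {1<..}"
    using \<open>x < 0 \<or> x > 1\<close> by (auto simp: S_def)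
  have "((\<lambda>x. 0) has_real_derivative 0) (at x)" by simp
  then have "(deriv smooth_step has_real_derivative 0) (at x)"
    by (rule has_field_derivative_transform_within_open[OF _ S(1,2)])
       (metis S(3) deriv_smooth_step_0 deriv_smooth_step_1 greaterThan_iff lessThan_iff less_imp_le)
  then show ?thesis by (rule DERIV_imp_deriv)
qed

section \<open>Radial subsolutions\<close>

text \<open>The exponent m = (n - 1)/2 is the one for which the terms with \<open>Vr\<close> cancel
  in n K + H. Profiles that vanish up to radius \<open>a\<close> hide the singularity of the power
  at the centre.\<close>

lemma radial_wave_lift:
  fixes m :: real and V Vr Vrr Vt Vtt :: "real \<Rightarrow> real \<Rightarrow> real" and c :: "'a::euclidean_space"
  assumes dim: "DIM('a) = 2 * m + 1" and a: "a > 0"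
    and r1: "\<And>r t. r > 0 \<Longrightarrow> t \<in> {0..\<tau>} \<Longrightarrow> ((\<lambda>r. V r t) has_real_derivative Vr r t) (at r)"
    and r2: "\<And>r t. r > 0 \<Longrightarrow> t \<in> {0..\<tau>} \<Longrightarrow> ((\<lambda>r. Vr r t) has_real_derivative Vrr r t) (at r)"
    and t1: "\<And>r t. r > 0 \<Longrightarrow> t \<in> {0..\<tau>} \<Longrightarrow> (V r has_real_derivative Vt r t) (at t within {0..\<tau>})"
    and t2: "\<And>r t. r > 0 \<Longrightarrow> t \<in> {0..\<tau>} \<Longrightarrow> (Vt r has_real_derivative Vtt r t) (at t within {0..\<tau>})"
    and cont: "continuous_on ({0<..} \<times> {0..\<tau>}) (\<lambda>z. V (fst z) (snd z))"
      "continuous_on ({0<..} \<times> {0..\<tau>}) (\<lambda>z. Vr (fst z) (snd z))"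
      "continuous_on ({0<..} \<times> {0..\<tau>}) (\<lambda>z. Vrr (fst z) (snd z))"
      "continuous_on ({0<..} \<times> {0..\<tau>}) (\<lambda>z. Vt (fst z) (snd z))"
      "continuous_on ({0<..} \<times> {0..\<tau>}) (\<lambda>z. Vtt (fst z) (snd z))"
    and zero: "\<And>r t. 0 < r \<Longrightarrow> r \<le> a \<Longrightarrow> t \<in> {0..\<tau>} \<Longrightarrow>
      V r t = 0 \<and> Vr r t = 0 \<and> Vrr r t = 0 \<and> Vt r t = 0 \<and> Vtt r t = 0"
  obtains wtt wb wbb where
    "C2_slab \<tau> (\<lambda>x t. norm (x - c) powr (- m) * V (norm (x - c)) t)
       (\<lambda>x t. norm (x - c) powr (- m) * Vt (norm (x - c)) t) wtt wb wbb"
    "\<forall>x t. t \<in> {0..\<tau>} \<longrightarrow> wtt x t - (\<Sum>b\<in>Basis. wbb b x t) =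
       norm (x - c) powr (- m) *
         (Vtt (norm (x - c)) t - Vrr (norm (x - c)) t - m * (1 - m) * V (norm (x - c)) t / (norm (x - c))\<^sup>2)"
proof -
  define e where "e r t = r powr (- m) * V r t" for r t
  define K where "K r t = r powr (- m) * (Vr r t / r - m * V r t / r\<^sup>2)" for r t
  define H where "H r t = r powr (- m) * (Vrr r t - (2 * m + 1) * Vr r t / r + m * (m + 2) * V r t / r\<^sup>2)" for r t
  define et where "et r t = r powr (- m) * Vt r t" for r t
  define ett where "ett r t = r powr (- m) * Vtt r t" for r t
  have pw: "((\<lambda>r. r powr (- m)) has_real_derivative r powr (- m) * (- m / r)) (at r)" if "r > 0" for r
    using that by (auto intro!: derivative_eq_intros simp: powr_diff)
  have ext: "continuous_on ({0..} \<times> {0..\<tau>}) (\<lambda>z. F (fst z) (snd z))"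
    if F: "continuous_on ({0<..} \<times> {0..\<tau>}) (\<lambda>z. F (fst z) (snd z))"
      and z: "\<And>r t. 0 \<le> r \<Longrightarrow> r \<le> a \<Longrightarrow> t \<in> {0..\<tau>} \<Longrightarrow> F r t = 0" for F :: "real \<Rightarrow> real \<Rightarrow> real"
  proof -
    have "continuous_on ({0..a} \<times> {0..\<tau>}) (\<lambda>z. F (fst z) (snd z))"
      by (rule continuous_on_eq[OF continuous_on_const[of _ 0]]) (use z in auto)
    moreover have "continuous_on ({a..} \<times> {0..\<tau>}) (\<lambda>z. F (fst z) (snd z))"
      by (rule continuous_on_subset[OF F]) (use a in auto)
    ultimately have "continuous_on ({0..a} \<times> {0..\<tau>} \<union> {a..} \<times> {0..\<tau>}) (\<lambda>z. F (fst z) (snd z))"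
      by (intro continuous_on_closed_Un closed_Times) auto
    moreover have "{0..a} \<times> {0..\<tau>} \<union> {a..} \<times> {0..\<tau>} = {0..} \<times> {0..\<tau>}" using a by force
    ultimately show ?thesis by simp
  qed
  \<comment> \<open>Nothing is assumed about \<open>V\<close> at r = 0; there the value
    \<open>0 powr (- m) = 0\<close> makes all five functions vanish.\<close>
  have zero': "e r t = 0 \<and> K r t = 0 \<and> H r t = 0 \<and> et r t = 0 \<and> ett r t = 0"
    if "0 \<le> r" "r \<le> a" "t \<in> {0..\<tau>}" for r t
    using zero[of r t] that by (cases "r = 0") (auto simp: e_def K_def H_def et_def ett_def)
  have er: "((\<lambda>r. e r t) has_real_derivative r * K r t) (at r)" if "r > 0" "t \<in> {0..\<tau>}" for r t
    unfolding e_def K_def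
    by (rule DERIV_cong[OF DERIV_mult[OF pw[OF that(1)] r1[OF that]]])
       (use that in \<open>simp add: field_simps power2_eq_square\<close>)
  have Kr: "((\<lambda>r. K r t) has_real_derivative H r t / r) (at r)" if r: "r > 0" and t: "t \<in> {0..\<tau>}" for r t
  proof -
    have inner: "((\<lambda>r. Vr r t / r - m * V r t / r\<^sup>2) has_real_derivative
        (Vrr r t * r - Vr r t) / (r * r) - (m * Vr r t * r\<^sup>2 - m * V r t * (2 * r)) / (r\<^sup>2 * r\<^sup>2)) (at r)"
      using r by (auto intro!: derivative_eq_intros r1[OF r t] r2[OF r t])
    show ?thesis
      unfolding K_def H_def
      by (rule DERIV_cong[OF DERIV_mult[OF pw[OF r] inner]])
         (use r in \<open>simp add: field_simps power2_eq_square\<close>)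
  qed
  have e0: "((\<lambda>r. e r t) has_real_derivative 0) (at 0 within {0..})" if t: "t \<in> {0..\<tau>}" for t
    by (rule has_field_derivative_transform_within[where f = "\<lambda>r. 0" and d = a])
       (use a zero'[OF _ _ t] in \<open>auto simp: dist_real_def\<close>)
  have et: "(e r has_real_derivative et r t) (at t within {0..\<tau>})" if "r \<ge> 0" "t \<in> {0..\<tau>}" for r t
  proof (cases "r = 0")
    case False
    then show ?thesis
      using that unfolding e_def[abs_def] et_def by (intro DERIV_cmult t1) auto
  qed (simp add: e_def[abs_def] et_def)
  have ett: "(et r has_real_derivative ett r t) (at t within {0..\<tau>})" if "r \<ge> 0" "t \<in> {0..\<tau>}" for r t
  proof (cases "r = 0")
    case False
    then show ?thesis
      using that unfolding et_def[abs_def] ett_def by (intro DERIV_cmult t2) auto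
  qed (simp add: et_def[abs_def] ett_def)
  have pwc: "continuous_on ({0<..} \<times> {0..\<tau>}) (\<lambda>z. fst z powr (- m))"
    by (auto intro!: continuous_intros)
  note radial = radial_C2_slab[where e = e and K = K and H = H and et = et and ett = ett and \<tau> = \<tau>
      and c = c, OF er Kr e0 _ et ett ext ext ext ext ext]
  have c1: "continuous_on ({0<..} \<times> {0..\<tau>}) (\<lambda>z. e (fst z) (snd z))"
    "continuous_on ({0<..} \<times> {0..\<tau>}) (\<lambda>z. K (fst z) (snd z))"
    "continuous_on ({0<..} \<times> {0..\<tau>}) (\<lambda>z. H (fst z) (snd z))"
    "continuous_on ({0<..} \<times> {0..\<tau>}) (\<lambda>z. et (fst z) (snd z))"
    "continuous_on ({0<..} \<times> {0..\<tau>}) (\<lambda>z. ett (fst z) (snd z))"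
    unfolding e_def K_def H_def et_def ett_def
    by (intro continuous_intros pwc cont; auto)+
  show ?thesis
  proof (rule that)
    show "C2_slab \<tau> (\<lambda>x t. norm (x - c) powr (- m) * V (norm (x - c)) t)
       (\<lambda>x t. norm (x - c) powr (- m) * Vt (norm (x - c)) t) (\<lambda>x t. ett (norm (x - c)) t)
      (\<lambda>b x t. K (norm (x - c)) t * ((x - c) \<bullet> b))
      (\<lambda>b x t. K (norm (x - c)) t + H (norm (x - c)) t * (((x - c) \<bullet> b) / norm (x - c))\<^sup>2)"
      using radial(1) c1 zero' a unfolding e_def et_def by auto
    show "\<forall>x t. t \<in> {0..\<tau>} \<longrightarrow> ett (norm (x - c)) t -
       (\<Sum>b\<in>Basis. K (norm (x - c)) t + H (norm (x - c)) t * (((x - c) \<bullet> b) / norm (x - c))\<^sup>2) =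
       norm (x - c) powr (- m) *
         (Vtt (norm (x - c)) t - Vrr (norm (x - c)) t - m * (1 - m) * V (norm (x - c)) t / (norm (x - c))\<^sup>2)"
    proof (intro allI impI)
      fix x t assume t: "t \<in> {0..\<tau>}"
      have "(\<Sum>b\<in>Basis. K (norm (x - c)) t + H (norm (x - c)) t * (((x - c) \<bullet> b) / norm (x - c))\<^sup>2) =
        (2 * m + 1) * K (norm (x - c)) t + H (norm (x - c)) t"
        using radial(2) c1 zero' a t dim by auto
      also have "\<dots> = norm (x - c) powr (- m) *
         (Vrr (norm (x - c)) t + m * (1 - m) * V (norm (x - c)) t / (norm (x - c))\<^sup>2)"
        unfolding K_def H_def by (cases "x = c") (simp_all add: field_simps power2_eq_square)
      finally show "ett (norm (x - c)) t -
       (\<Sum>b\<in>Basis. K (norm (x - c)) t + H (norm (x - c)) t * (((x - c) \<bullet> b) / norm (x - c))\<^sup>2) =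
       norm (x - c) powr (- m) *
         (Vtt (norm (x - c)) t - Vrr (norm (x - c)) t - m * (1 - m) * V (norm (x - c)) t / (norm (x - c))\<^sup>2)"
        unfolding ett_def by (simp add: algebra_simps)
    qed
  qed
qed

lemma smooth_step_DERIV:
  "(smooth_step has_real_derivative deriv smooth_step x) (at x within A)"
  "(deriv smooth_step has_real_derivative deriv (deriv smooth_step) x) (at x within A)"
  using C2_funD(1,2)[OF C2_fun_smooth_step, of x] by (auto intro: has_field_derivative_at_within)

section \<open>The free wave and the strip along the light cone\<close>

locale semilinear_wave =
  fixes m p T :: real and u ut utt :: "'a::euclidean_space \<Rightarrow> real \<Rightarrow> real"
    and ub ubb :: "'a \<Rightarrow> 'a \<Rightarrow> real \<Rightarrow> real"
  assumes dim: "DIM('a) \<in> {2, 3}" "DIM('a) = 2 * m + 1" and p: "p > 1"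
    and slab: "\<And>\<tau>. \<tau> < T \<Longrightarrow> C2_slab \<tau> u ut utt ub ubb"
    and eq: "\<And>x t. 0 < t \<Longrightarrow> t < T \<Longrightarrow> utt x t - (\<Sum>b\<in>Basis. ubb b x t) = \<bar>u x t\<bar> powr p"
    and init: "\<And>x. u x 0 = 0" "\<And>x. ut x 0 \<ge> 0"
begin

lemma m: "0 < m" "m \<le> 1" "m * (1 - m) \<ge> 0"
proof -
  show "0 < m" "m \<le> 1" using dim by auto
  then show "m * (1 - m) \<ge> 0" by simp
qed

lemma nonneg:
  assumes "0 < t" "t < T"
  shows "u x t \<ge> 0"
  by (rule wave_positivity[OF dim(1) slab[OF assms(2)] assms(1)])
     (use assms init in \<open>auto simp: eq\<close>)

text \<open>For \<open>n = 2, 3\<close> an outgoing wave \<open>r powr (- m) * h (t - r)\<close> with \<open>h \<ge> 0\<close> is a subsolution of the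
  linear equation away from \<open>r = 0\<close>. The difference of an outgoing and an incoming one has vanishing
  initial values. The backward cones of the points considered stay away from \<open>r = 0\<close>, so that
  cutting off there does no harm.\<close>

lemma strip_lower_bound:
  fixes c :: 'a
  assumes \<kappa>: "\<kappa> > 0" and \<gamma>: "\<gamma> > 0"
    and vel: "\<And>x. norm (x - c) \<le> 4 / \<kappa> \<Longrightarrow> \<gamma> \<le> ut x 0"
    and t: "2 / \<kappa> \<le> t" "t < T"
    and X: "1 \<le> \<kappa> * (t - norm (x - c)) + 4" "\<kappa> * (t - norm (x - c)) + 4 \<le> 2"
  shows "\<gamma> * (2 / \<kappa>) powr m / (18 * \<kappa>) * norm (x - c) powr (- m) \<le> u x t"
proof -
  let ?S = smooth_step and ?S1 = "deriv smooth_step" and ?S2 = "deriv (deriv smooth_step)"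
  \<comment> \<open>With this constant the initial velocity of the free wave is at most \<gamma>: it
    is bounded by 2 \<kappa> c1 r^(-m) times the slope bound 9, and r \<ge> 2/\<kappa> on the cones
    considered.\<close>
  define c1 where "c1 = \<gamma> * (2 / \<kappa>) powr m / (18 * \<kappa>)"
  have c1: "c1 > 0" using \<kappa> \<gamma> by (simp add: c1_def)
  have tpos: "t > 0" using t \<kappa> by (smt (verit) divide_pos_pos)
  \<comment> \<open>Outgoing minus incoming wave. The difference vanishes at time 0, and its initial
    velocity is supported in 3/\<kappa> \<le> r \<le> 4/\<kappa>, where \<open>vel\<close> applies.
    In the strip at times beyond 2/\<kappa> the outgoing part is 1 and the incoming part 0.\<close>
  define W where "W r s = ?S (\<kappa> * (s - r) + 4) - ?S (4 - \<kappa> * (s + r))" for r s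
  define Wr where "Wr r s = - \<kappa> * ?S1 (\<kappa> * (s - r) + 4) + \<kappa> * ?S1 (4 - \<kappa> * (s + r))" for r s
  define Wt where "Wt r s = \<kappa> * ?S1 (\<kappa> * (s - r) + 4) + \<kappa> * ?S1 (4 - \<kappa> * (s + r))" for r s
  define W2 where "W2 r s = \<kappa>\<^sup>2 * ?S2 (\<kappa> * (s - r) + 4) - \<kappa>\<^sup>2 * ?S2 (4 - \<kappa> * (s + r))" for r s
  \<comment> \<open>The factor \<open>?S (\<kappa> * r - 1)\<close> is 0 up to r = 1/\<kappa> and 1
    from r = 2/\<kappa> on, so it does not show on the backward cones.\<close>
  define V where "V r s = c1 * (?S (\<kappa> * r - 1) * W r s)" for r s
  define Vr where "Vr r s = c1 * (\<kappa> * ?S1 (\<kappa> * r - 1) * W r s + ?S (\<kappa> * r - 1) * Wr r s)" for r s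
  define Vrr where "Vrr r s = c1 * (\<kappa>\<^sup>2 * ?S2 (\<kappa> * r - 1) * W r s + 2 * \<kappa> * ?S1 (\<kappa> * r - 1) * Wr r s
      + ?S (\<kappa> * r - 1) * W2 r s)" for r s
  define Vt where "Vt r s = c1 * (?S (\<kappa> * r - 1) * Wt r s)" for r s
  define Vtt where "Vtt r s = c1 * (?S (\<kappa> * r - 1) * W2 r s)" for r s
  note [derivative_intros] = DERIV_chain2[OF smooth_step_DERIV(1)] DERIV_chain2[OF smooth_step_DERIV(2)]
  have D: "((\<lambda>r. W r s) has_real_derivative Wr r s) (at r within A)"
    "((\<lambda>r. Wr r s) has_real_derivative W2 r s) (at r within A)"
    "((\<lambda>s. W r s) has_real_derivative Wt r s) (at s within A)"
    "((\<lambda>s. Wt r s) has_real_derivative W2 r s) (at s within A)" for r s A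
    unfolding W_def Wr_def Wt_def W2_def
    by (rule derivative_eq_intros refl | simp add: power2_eq_square algebra_simps)+
  have cS: "continuous_on A (\<lambda>z. ?S (f z))" "continuous_on A (\<lambda>z. ?S1 (f z))" "continuous_on A (\<lambda>z. ?S2 (f z))"
    if "continuous_on A f" for A :: "(real \<times> real) set" and f
    using C2_funD(3-5)[OF C2_fun_smooth_step] that continuous_on_compose2[OF _ that, of UNIV] by auto
  have C2u: "C2_slab t u ut utt ub ubb" using slab t by simp
  obtain vtt vb vbb where
    v: "C2_slab t (\<lambda>x s. norm (x - c) powr (- m) * V (norm (x - c)) s)
         (\<lambda>x s. norm (x - c) powr (- m) * Vt (norm (x - c)) s) vtt vb vbb"
    and box: "\<forall>x s. s \<in> {0..t} \<longrightarrow> vtt x s - (\<Sum>b\<in>Basis. vbb b x s) =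
       norm (x - c) powr (- m) *
         (Vtt (norm (x - c)) s - Vrr (norm (x - c)) s - m * (1 - m) * V (norm (x - c)) s / (norm (x - c))\<^sup>2)"
  proof (rule radial_wave_lift[OF dim(2), of "1 / (2 * \<kappa>)" t V Vr Vrr Vt Vtt c])
    show "((\<lambda>r. V r s) has_real_derivative Vr r s) (at r)" for r s
      unfolding V_def Vr_def
      by (rule derivative_eq_intros D refl | simp add: algebra_simps)+
    show "((\<lambda>r. Vr r s) has_real_derivative Vrr r s) (at r)" for r s
      unfolding Vr_def Vrr_def
      by (rule derivative_eq_intros D refl | simp add: algebra_simps power2_eq_square)+
    show "(V r has_real_derivative Vt r s) (at s within {0..t})" for r s
      unfolding V_def[abs_def] Vt_def by (intro DERIV_cmult D)
    show "(Vt r has_real_derivative Vtt r s) (at s within {0..t})" for r s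
      unfolding Vt_def[abs_def] Vtt_def by (intro DERIV_cmult D)
    show "V r s = 0 \<and> Vr r s = 0 \<and> Vrr r s = 0 \<and> Vt r s = 0 \<and> Vtt r s = 0"
      if "0 < r" "r \<le> 1 / (2 * \<kappa>)" for r s
    proof -
      have "\<kappa> * r - 1 < 0" using that \<kappa> by (simp add: field_simps)
      then show ?thesis
        by (simp add: V_def Vr_def Vrr_def Vt_def Vtt_def smooth_step_0 deriv_smooth_step_0 deriv2_smooth_step_0)
    qed
  qed (use \<kappa> in \<open>auto simp: V_def Vr_def Vrr_def Vt_def Vtt_def W_def Wr_def Wt_def W2_def
        intro!: continuous_intros cS\<close>)
  have C2: "C2_slab t (\<lambda>x s. u x s - norm (x - c) powr (- m) * V (norm (x - c)) s)
      (\<lambda>x s. ut x s - norm (x - c) powr (- m) * Vt (norm (x - c)) s) (\<lambda>x s. utt x s - vtt x s)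
      (\<lambda>b x s. ub b x s - vb b x s) (\<lambda>b x s. ubb b x s - vbb b x s)"
    by (rule C2_slab_diff[OF C2u v])
  \<comment> \<open>X \<le> 2 places x at distance at least t + 2/\<kappa> from c; going back in
    time by t - s loses at most t - s of it.\<close>
  have far: "norm (y - c) \<ge> 2 / \<kappa> + s" if "norm (y - x) \<le> t - s" for y s
  proof -
    have "t + 2 / \<kappa> \<le> norm (x - c)" using X \<kappa> by (simp add: field_simps)
    then show ?thesis using norm_triangle_ineq[of "x - y" "y - c"] that by (simp add: norm_minus_commute)
  qed
  have "0 \<le> u x t - norm (x - c) powr (- m) * V (norm (x - c)) t"
  proof (rule wave_positivity[OF dim(1) C2 tpos])
    show "u y 0 - norm (y - c) powr (- m) * V (norm (y - c)) 0 = 0" for y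
      by (simp add: init V_def W_def)
    show "0 \<le> ut y 0 - norm (y - c) powr (- m) * Vt (norm (y - c)) 0" if y: "norm (y - x) \<le> t" for y
    proof (cases "norm (y - c) \<le> 4 / \<kappa>")
      case True
      let ?r = "norm (y - c)"
      have r: "2 / \<kappa> \<le> ?r" using far[of y 0] y by simp
      have "?r powr (- m) * Vt ?r 0 \<le> (2 / \<kappa>) powr (- m) * (c1 * (1 * (18 * \<kappa>)))"
      proof (intro mult_mono)
        show "?r powr (- m) \<le> (2 / \<kappa>) powr (- m)" using r \<kappa> m by (intro powr_mono2') auto
        have "Wt ?r 0 = 2 * \<kappa> * ?S1 (4 - \<kappa> * ?r)" by (simp add: Wt_def)
        moreover have "2 * \<kappa> * ?S1 (4 - \<kappa> * ?r) \<le> 2 * \<kappa> * 9"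
          using \<kappa> deriv_smooth_step_le_9 by (intro mult_left_mono) auto
        moreover have "2 * \<kappa> * ?S1 (4 - \<kappa> * ?r) \<ge> 0"
          using \<kappa> deriv_smooth_step_ge_0[of "4 - \<kappa> * ?r"] by simp
        ultimately have W: "0 \<le> Wt ?r 0" "Wt ?r 0 \<le> 18 * \<kappa>" by auto
        show "Vt ?r 0 \<le> c1 * (1 * (18 * \<kappa>))"
          unfolding Vt_def using c1 W smooth_step_le_1 smooth_step_ge_0
          by (intro mult_left_mono mult_mono) auto
        show "0 \<le> Vt ?r 0" unfolding Vt_def using c1 W smooth_step_ge_0 by (intro mult_nonneg_nonneg) auto
      qed auto
      also have "\<dots> = \<gamma>" using \<kappa> by (simp add: c1_def powr_minus field_simps)
      also have "\<dots> \<le> ut y 0" by (rule vel[OF True])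
      finally show ?thesis by simp
    next
      case False
      then have "4 - \<kappa> * norm (y - c) \<le> 0" using \<kappa> by (simp add: field_simps)
      then show ?thesis using init(2)[of y] by (simp add: Vt_def Wt_def deriv_smooth_step_0 algebra_simps)
    qed
    fix y s assume s: "0 < s" "s < t" and y: "norm (y - x) \<le> t - s"
    let ?r = "norm (y - c)"
    have r: "2 / \<kappa> < ?r" using far[OF y] s by simp
    then have r1: "\<kappa> * ?r - 1 > 1" using \<kappa> by (simp add: field_simps)
    have r0: "?r > 0" using r \<kappa> by (smt (verit) divide_pos_pos)
    have st: "s \<in> {0..t}" using s by auto
    have "Vtt ?r s - Vrr ?r s = 0"
      using r1 by (simp add: Vtt_def Vrr_def smooth_step_1 deriv_smooth_step_1 deriv2_smooth_step_0)
    moreover have "V ?r s \<ge> 0"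
    proof -
      have "4 - \<kappa> * (s + ?r) \<le> \<kappa> * (s - ?r) + 4" using s \<kappa> by (simp add: algebra_simps)
      then have "W ?r s \<ge> 0" unfolding W_def using smooth_step_mono by simp
      then show ?thesis unfolding V_def using c1 smooth_step_ge_0 by (intro mult_nonneg_nonneg) auto
    qed
    then have "m * (1 - m) * V ?r s / ?r\<^sup>2 \<ge> 0" using m(3) by simp
    ultimately have "?r powr (- m) * (Vtt ?r s - Vrr ?r s - m * (1 - m) * V ?r s / ?r\<^sup>2) \<le> 0"
      by (intro mult_nonneg_nonpos) auto
    then have "vtt y s - (\<Sum>b\<in>Basis. vbb b y s) \<le> 0"
      unfolding box[rule_format, OF st] .
    moreover have "utt y s - (\<Sum>b\<in>Basis. ubb b y s) \<ge> 0" using eq[of s y] s t by simp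
    ultimately show "0 \<le> utt y s - vtt y s - (\<Sum>b\<in>Basis. ubb b y s - vbb b y s)"
      by (simp add: sum_subtractf)
  qed
  moreover have "V (norm (x - c)) t = c1"
  proof -
    have r: "\<kappa> * norm (x - c) \<ge> \<kappa> * t + 2" using X by (simp add: algebra_simps)
    moreover have "\<kappa> * t \<ge> 2" using t \<kappa> by (simp add: field_simps)
    ultimately have "?S (\<kappa> * norm (x - c) - 1) = 1" "?S (4 - \<kappa> * (t + norm (x - c))) = 0"
      by (auto intro!: smooth_step_0 smooth_step_1 simp: algebra_simps)
    then show ?thesis using smooth_step_1[OF X(1)] by (simp add: V_def W_def)
  qed
  ultimately show ?thesis by (simp add: c1_def mult.commute)
qed

end

section \<open>Profiles in characteristic coordinates\<close>

text \<open>With X = \<kappa> (t - r) + 4 and Y = \<kappa> (t + r) the operator V_tt - V_rr is 4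
  \<kappa>^2 times the mixed derivative V_XY. Since Y enters through \<open>h\<close> alone, the
  second derivatives of \<open>B\<close>, \<open>g\<close> and \<open>h\<close> all drop out. The
  bound \<open>b\<close> is there because \<open>B\<close> will be regular only below the
  singularity of N.\<close>

lemma characteristic_lift:
  fixes c :: "'a::euclidean_space" and m :: real
  assumes dim: "DIM('a) = 2 * m + 1" and a: "a > 0" and \<kappa>: "\<kappa> > 0"
    and B: "C2_fun {..<b} B" and g: "C2_fun {..<b} g" and h: "C2_fun {0<..} h" and b: "\<kappa> * \<tau> + 4 < b"
    and zero: "\<And>r t. 0 < r \<Longrightarrow> r \<le> a \<Longrightarrow> t \<in> {0..\<tau>} \<Longrightarrow> g (\<kappa> * (t - r) + 4) \<le> h (\<kappa> * (t + r))"
  defines "V \<equiv> (\<lambda>r t. B (\<kappa> * (t - r) + 4) * pos3 (g (\<kappa> * (t - r) + 4) - h (\<kappa> * (t + r))))"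
    and "Vt \<equiv> (\<lambda>r t. \<kappa> * (deriv B (\<kappa> * (t - r) + 4) * pos3 (g (\<kappa> * (t - r) + 4) - h (\<kappa> * (t + r))) +
       B (\<kappa> * (t - r) + 4) * (3 * max 0 (g (\<kappa> * (t - r) + 4) - h (\<kappa> * (t + r))) ^ 2 *
         (deriv g (\<kappa> * (t - r) + 4) - deriv h (\<kappa> * (t + r))))))"
  obtains vtt vb vbb where
    "C2_slab \<tau> (\<lambda>x t. norm (x - c) powr (- m) * V (norm (x - c)) t)
       (\<lambda>x t. norm (x - c) powr (- m) * Vt (norm (x - c)) t) vtt vb vbb"
    "\<forall>x t. t \<in> {0..\<tau>} \<longrightarrow> vtt x t - (\<Sum>b\<in>Basis. vbb b x t) =
       norm (x - c) powr (- m) * (- 4 * \<kappa>\<^sup>2 * deriv h (\<kappa> * (t + norm (x - c))) *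
         (deriv B (\<kappa> * (t - norm (x - c)) + 4) *
            (3 * max 0 (g (\<kappa> * (t - norm (x - c)) + 4) - h (\<kappa> * (t + norm (x - c)))) ^ 2) +
          B (\<kappa> * (t - norm (x - c)) + 4) *
            (6 * max 0 (g (\<kappa> * (t - norm (x - c)) + 4) - h (\<kappa> * (t + norm (x - c))))) *
            deriv g (\<kappa> * (t - norm (x - c)) + 4))
         - m * (1 - m) * V (norm (x - c)) t / (norm (x - c))\<^sup>2)"
proof -
  let ?X = "\<lambda>r t. \<kappa> * (t - r) + 4" and ?Y = "\<lambda>r t. \<kappa> * (t + r)"
  define B1 B2 g1 g2 h1 h2 where "B1 = deriv B" and "B2 = deriv B1" and "g1 = deriv g" and "g2 = deriv g1"
    and "h1 = deriv h" and "h2 = deriv h1"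
  note defs = B1_def B2_def g1_def g2_def h1_def h2_def
  note BD = C2_funD[OF B, folded defs, folded defs] and gD = C2_funD[OF g, folded defs, folded defs]
    and hD = C2_funD[OF h, folded defs, folded defs]
  have Xb: "?X r t \<in> {..<b}" and Y0: "?Y r t \<in> {0<..}" if "r > 0" "t \<in> {0..\<tau>}" for r t
  proof -
    have "\<kappa> * (t - r) \<le> \<kappa> * \<tau>" using that \<kappa> by (intro mult_left_mono) auto
    then show "?X r t \<in> {..<b}" using b by simp
    show "?Y r t \<in> {0<..}" using that \<kappa> by simp
  qed
  define f where "f r t = g (?X r t) - h (?Y r t)" for r t
  define fr where "fr r t = - \<kappa> * g1 (?X r t) - \<kappa> * h1 (?Y r t)" for r t
  define ft where "ft r t = \<kappa> * g1 (?X r t) - \<kappa> * h1 (?Y r t)" for r t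
  define f2 where "f2 r t = \<kappa>\<^sup>2 * g2 (?X r t) - \<kappa>\<^sup>2 * h2 (?Y r t)" for r t
  let ?P = "\<lambda>r t. pos3 (f r t)" and ?P1 = "\<lambda>r t. 3 * max 0 (f r t) ^ 2" and ?P2 = "\<lambda>r t. 6 * max 0 (f r t)"
  define Vr where "Vr r t = (- \<kappa> * B1 (?X r t)) * ?P r t + B (?X r t) * (?P1 r t * fr r t)" for r t
  define Vrr where "Vrr r t = \<kappa>\<^sup>2 * B2 (?X r t) * ?P r t + 2 * (- \<kappa> * B1 (?X r t)) * (?P1 r t * fr r t)
     + B (?X r t) * (?P2 r t * (fr r t)\<^sup>2 + ?P1 r t * f2 r t)" for r t
  define Vtt where "Vtt r t = \<kappa>\<^sup>2 * B2 (?X r t) * ?P r t + 2 * (\<kappa> * B1 (?X r t)) * (?P1 r t * ft r t)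
     + B (?X r t) * (?P2 r t * (ft r t)\<^sup>2 + ?P1 r t * f2 r t)" for r t
  have V: "V r t = B (?X r t) * ?P r t" for r t by (simp add: V_def f_def)
  have Vt: "Vt r t = \<kappa> * B1 (?X r t) * ?P r t + B (?X r t) * (?P1 r t * ft r t)" for r t
    by (simp add: Vt_def f_def ft_def defs algebra_simps)
  have Xr: "((\<lambda>r. ?X r t) has_real_derivative - \<kappa>) (at r within A)"
    and Xt: "((\<lambda>t. ?X r t) has_real_derivative \<kappa>) (at t within A)"
    and Yr: "((\<lambda>r. ?Y r t) has_real_derivative \<kappa>) (at r within A)"
    and Yt: "((\<lambda>t. ?Y r t) has_real_derivative \<kappa>) (at t within A)" for r t A
    by (auto intro!: derivative_eq_intros)
  have P01: "(pos3 has_real_derivative 3 * max 0 x ^ 2) (at x)" for x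
    using C2_funD(1)[OF C2_fun_pos3] deriv_pos3 by simp
  have P12: "((\<lambda>x. 3 * max 0 x ^ 2) has_real_derivative 6 * max 0 x) (at x)" for x :: real
    using DERIV_cmult[OF DERIV_pos_part(1), of 3 x] by simp
  note ch = DERIV_chain2[OF BD(1)] DERIV_chain2[OF BD(2)] DERIV_chain2[OF gD(1)] DERIV_chain2[OF gD(2)]
    DERIV_chain2[OF hD(1)] DERIV_chain2[OF hD(2)]
  have D: "((\<lambda>r. B (?X r t)) has_real_derivative - \<kappa> * B1 (?X r t)) (at r within A)"
    "((\<lambda>r. B1 (?X r t)) has_real_derivative - \<kappa> * B2 (?X r t)) (at r within A)"
    "((\<lambda>t. B (?X r t)) has_real_derivative \<kappa> * B1 (?X r t)) (at t within A)"
    "((\<lambda>t. B1 (?X r t)) has_real_derivative \<kappa> * B2 (?X r t)) (at t within A)"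
    "((\<lambda>r. f r t) has_real_derivative fr r t) (at r within A)"
    "((\<lambda>r. fr r t) has_real_derivative f2 r t) (at r within A)"
    "((\<lambda>t. f r t) has_real_derivative ft r t) (at t within A)"
    "((\<lambda>t. ft r t) has_real_derivative f2 r t) (at t within A)"
    if rt: "r > 0" "t \<in> {0..\<tau>}" for r t A
  proof -
    show "((\<lambda>r. B (?X r t)) has_real_derivative - \<kappa> * B1 (?X r t)) (at r within A)"
      "((\<lambda>r. B1 (?X r t)) has_real_derivative - \<kappa> * B2 (?X r t)) (at r within A)"
      "((\<lambda>t. B (?X r t)) has_real_derivative \<kappa> * B1 (?X r t)) (at t within A)"
      "((\<lambda>t. B1 (?X r t)) has_real_derivative \<kappa> * B2 (?X r t)) (at t within A)"
      using ch(1,2)[OF Xb[OF rt] Xr] ch(1,2)[OF Xb[OF rt] Xt] by (simp_all add: mult.commute)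
    have G: "((\<lambda>r. g (?X r t)) has_real_derivative - \<kappa> * g1 (?X r t)) (at r within A)"
      "((\<lambda>r. g1 (?X r t)) has_real_derivative - \<kappa> * g2 (?X r t)) (at r within A)"
      "((\<lambda>t. g (?X r t)) has_real_derivative \<kappa> * g1 (?X r t)) (at t within A)"
      "((\<lambda>t. g1 (?X r t)) has_real_derivative \<kappa> * g2 (?X r t)) (at t within A)"
      using ch(3,4)[OF Xb[OF rt] Xr] ch(3,4)[OF Xb[OF rt] Xt] by (simp_all add: mult.commute)
    have H: "((\<lambda>r. h (?Y r t)) has_real_derivative \<kappa> * h1 (?Y r t)) (at r within A)"
      "((\<lambda>r. h1 (?Y r t)) has_real_derivative \<kappa> * h2 (?Y r t)) (at r within A)"
      "((\<lambda>t. h (?Y r t)) has_real_derivative \<kappa> * h1 (?Y r t)) (at t within A)"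
      "((\<lambda>t. h1 (?Y r t)) has_real_derivative \<kappa> * h2 (?Y r t)) (at t within A)"
      using ch(5,6)[OF Y0[OF rt] Yr] ch(5,6)[OF Y0[OF rt] Yt] by (simp_all add: mult.commute)
    show "((\<lambda>r. f r t) has_real_derivative fr r t) (at r within A)"
      unfolding f_def fr_def by (rule DERIV_diff[OF G(1) H(1)])
    show "((\<lambda>r. fr r t) has_real_derivative f2 r t) (at r within A)"
      unfolding fr_def f2_def
      by (rule DERIV_cong[OF DERIV_diff[OF DERIV_cmult[OF G(2)] DERIV_cmult[OF H(2)]]])
         (simp add: power2_eq_square)
    show "((\<lambda>t. f r t) has_real_derivative ft r t) (at t within A)"
      unfolding f_def ft_def by (rule DERIV_diff[OF G(3) H(3)])
    show "((\<lambda>t. ft r t) has_real_derivative f2 r t) (at t within A)"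
      unfolding ft_def f2_def
      by (rule DERIV_cong[OF DERIV_diff[OF DERIV_cmult[OF G(4)] DERIV_cmult[OF H(4)]]])
         (simp add: power2_eq_square)
  qed
  have cX: "continuous_on ({0<..} \<times> {0..\<tau>}) (\<lambda>z. ?X (fst z) (snd z))"
    and cY: "continuous_on ({0<..} \<times> {0..\<tau>}) (\<lambda>z. ?Y (fst z) (snd z))"
    by (intro continuous_intros)+
  have cB: "continuous_on ({0<..} \<times> {0..\<tau>}) (\<lambda>z. F (?X (fst z) (snd z)))" if "continuous_on {..<b} F" for F :: "real \<Rightarrow> real"
    by (rule continuous_on_compose2[OF that cX]) (use Xb in auto)
  have cH: "continuous_on ({0<..} \<times> {0..\<tau>}) (\<lambda>z. F (?Y (fst z) (snd z)))" if "continuous_on {0<..} F" for F :: "real \<Rightarrow> real"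
    by (rule continuous_on_compose2[OF that cY]) (use Y0 in auto)
  note cs = cB[OF BD(3)] cB[OF BD(4)] cB[OF BD(5)] cB[OF gD(3)] cB[OF gD(4)] cB[OF gD(5)]
    cH[OF hD(3)] cH[OF hD(4)] cH[OF hD(5)]
  have cf: "continuous_on ({0<..} \<times> {0..\<tau>}) (\<lambda>z. f (fst z) (snd z))"
    "continuous_on ({0<..} \<times> {0..\<tau>}) (\<lambda>z. fr (fst z) (snd z))"
    "continuous_on ({0<..} \<times> {0..\<tau>}) (\<lambda>z. ft (fst z) (snd z))"
    "continuous_on ({0<..} \<times> {0..\<tau>}) (\<lambda>z. f2 (fst z) (snd z))"
    unfolding f_def fr_def ft_def f2_def by (intro continuous_intros cs)+
  have cP: "continuous_on ({0<..} \<times> {0..\<tau>}) (\<lambda>z. pos3 (f (fst z) (snd z)))"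
    unfolding pos3_def by (intro continuous_intros cf)
  show ?thesis
  proof (rule radial_wave_lift[OF dim a, of \<tau> V Vr Vrr Vt Vtt c])
    fix r t :: real assume rt: "r > 0" "t \<in> {0..\<tau>}"
    note DP = DERIV_chain2[OF P01 D(5)[OF rt]] DERIV_chain2[OF P01 D(7)[OF rt]]
      DERIV_chain2[OF P12 D(5)[OF rt]] DERIV_chain2[OF P12 D(7)[OF rt]]
    show "((\<lambda>r. V r t) has_real_derivative Vr r t) (at r)"
      unfolding V Vr_def
      by (rule DERIV_cong[OF DERIV_mult[OF D(1)[OF rt] DP(1)]]) (simp add: algebra_simps)
    show "((\<lambda>r. Vr r t) has_real_derivative Vrr r t) (at r)"
      unfolding Vr_def Vrr_def
      by (rule DERIV_cong[OF DERIV_add[OF DERIV_mult[OF DERIV_cmult[OF D(2)[OF rt]] DP(1)]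
            DERIV_mult[OF D(1)[OF rt] DERIV_mult[OF DP(3) D(6)[OF rt]]]]])
         (simp add: algebra_simps power2_eq_square)
    show "(V r has_real_derivative Vt r t) (at t within {0..\<tau>})"
      unfolding V[abs_def] Vt
      by (rule DERIV_cong[OF DERIV_mult[OF D(3)[OF rt] DP(2)]]) (simp add: algebra_simps)
    show "(Vt r has_real_derivative Vtt r t) (at t within {0..\<tau>})"
      unfolding Vt[abs_def] Vtt_def
      by (rule DERIV_cong[OF DERIV_add[OF DERIV_mult[OF DERIV_cmult[OF D(4)[OF rt]] DP(2)]
            DERIV_mult[OF D(3)[OF rt] DERIV_mult[OF DP(4) D(8)[OF rt]]]]])
         (simp add: algebra_simps power2_eq_square)
  next
    show "continuous_on ({0<..} \<times> {0..\<tau>}) (\<lambda>z. V (fst z) (snd z))"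
      "continuous_on ({0<..} \<times> {0..\<tau>}) (\<lambda>z. Vr (fst z) (snd z))"
      "continuous_on ({0<..} \<times> {0..\<tau>}) (\<lambda>z. Vrr (fst z) (snd z))"
      "continuous_on ({0<..} \<times> {0..\<tau>}) (\<lambda>z. Vt (fst z) (snd z))"
      "continuous_on ({0<..} \<times> {0..\<tau>}) (\<lambda>z. Vtt (fst z) (snd z))"
      unfolding V Vr_def Vrr_def Vt Vtt_def by (intro continuous_intros cs cf cP)+
  next
    fix r t :: real assume "0 < r" "r \<le> a" "t \<in> {0..\<tau>}"
    then have "f r t \<le> 0" using zero[of r t] by (simp add: f_def)
    then show "V r t = 0 \<and> Vr r t = 0 \<and> Vrr r t = 0 \<and> Vt r t = 0 \<and> Vtt r t = 0"
      by (simp add: V Vr_def Vrr_def Vt Vtt_def pos3_simps max_absorb1)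
  next
    fix wtt wb wbb
    assume w: "C2_slab \<tau> (\<lambda>x t. norm (x - c) powr (- m) * V (norm (x - c)) t)
       (\<lambda>x t. norm (x - c) powr (- m) * Vt (norm (x - c)) t) wtt wb wbb"
      and box: "\<forall>x t. t \<in> {0..\<tau>} \<longrightarrow> wtt x t - (\<Sum>b\<in>Basis. wbb b x t) =
       norm (x - c) powr (- m) *
         (Vtt (norm (x - c)) t - Vrr (norm (x - c)) t - m * (1 - m) * V (norm (x - c)) t / (norm (x - c))\<^sup>2)"
    have diff: "Vtt r t - Vrr r t = - 4 * \<kappa>\<^sup>2 * h1 (?Y r t) * (B1 (?X r t) * ?P1 r t + B (?X r t) * ?P2 r t * g1 (?X r t))" for r t
      unfolding Vtt_def Vrr_def ft_def fr_def by (simp add: algebra_simps power2_eq_square)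
    show ?thesis
      using that[OF w] box unfolding diff unfolding f_def defs by simp
  qed
qed

section \<open>Growth along the light cone\<close>

text \<open>The factor N (ln X) X^(2q) of the subsolution, with N s = \<mu> (A - s)^(-\<nu>) and
  \<nu> = 1/(p - 1).\<close>

definition log_profile :: "real \<Rightarrow> real \<Rightarrow> real \<Rightarrow> real \<Rightarrow> real \<Rightarrow> real" where
  "log_profile q \<nu> A \<mu> y = \<mu> * (A - ln y) powr (- \<nu>) * y powr (2 * q)"

lemma C2_fun_log_profile: "C2_fun {0<..<exp A} (log_profile q \<nu> A \<mu>)"
proof -
  have o: "open {0<..<exp A}" by simp
  have lnA: "A - ln y > 0" if "y \<in> {0<..<exp A}" for y
  proof -
    have "ln y < ln (exp A)" using that by (subst ln_less_cancel_iff) auto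
    then show ?thesis by simp
  qed
  have sub: "{0<..<exp A} \<subseteq> {0<..}" by auto
  have "C2_fun {0<..<exp A} (\<lambda>y. A - ln y)"
    using C2_fun_diff[OF o C2_fun_subset[OF C2_fun_linear[of 0 A]] C2_fun_subset[OF C2_fun_ln sub]] by simp
  then have "C2_fun {0<..<exp A} (\<lambda>y. (A - ln y) powr (- \<nu>))"
    using lnA by (intro C2_fun_compose[OF o _ C2_fun_powr]) auto
  then have "C2_fun {0<..<exp A} (\<lambda>y. (A - ln y) powr (- \<nu>) * y powr (2 * q))"
    by (intro C2_fun_mult o C2_fun_subset[OF C2_fun_powr sub])
  from C2_fun_mult[OF o C2_fun_subset[OF C2_fun_linear[of 0 \<mu>]] this] show ?thesis by (simp add: log_profile_def[abs_def] mult.assoc)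
qed

lemma DERIV_log_profile:
  assumes "0 < y" "ln y < A"
  shows "(log_profile q \<nu> A \<mu> has_real_derivative
    log_profile q \<nu> A \<mu> y / y * (\<nu> / (A - ln y) + 2 * q)) (at y)"
proof -
  have L: "((\<lambda>y. (A - ln y) powr (- \<nu>)) has_real_derivative (A - ln y) powr (- \<nu>) * (\<nu> / (A - ln y) / y)) (at y)"
    using assms by (auto intro!: derivative_eq_intros simp: powr_diff field_simps)
  have "((\<lambda>y. y powr (2 * q)) has_real_derivative y powr (2 * q) * (2 * q / y)) (at y)"
    using assms by (auto intro!: derivative_eq_intros simp: powr_diff field_simps)
  from DERIV_cmult[OF DERIV_mult[OF L this], of \<mu>] show ?thesis
    unfolding log_profile_def[abs_def] mult.assoc
    by (rule DERIV_cong) (simp add: ring_distribs add_divide_distrib mult_ac)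
qed

text \<open>Replaces the characteristic variable \<open>X\<close>, so that its powers and its logarithm are defined and
  \<open>C\<^sup>2\<close> also for \<open>X < 1\<close>, where the subsolution vanishes.\<close>

definition clamp_id :: "real \<Rightarrow> real" where
  "clamp_id x = 1 + (x - 1) / (1 + pos3 (1 - x))"

lemma clamp_id_ge_1: "x \<ge> 1 \<Longrightarrow> clamp_id x = x"
  by (simp add: clamp_id_def pos3_simps)

lemma clamp_id_pos: "clamp_id x > 0" and clamp_id_le: "clamp_id x \<le> max 1 x"
proof -
  have "clamp_id x > 0 \<and> clamp_id x \<le> max 1 x"
  proof (cases "x \<ge> 1")
    case False
    define v where "v = 1 - x"
    have v: "v > 0" using False by (simp add: v_def)
    have lt: "v < 1 + v ^ 3"
    proof (cases "v \<le> 1")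
      case True
      then show ?thesis using v zero_less_power[OF v, of 3] by linarith
    next
      case False
      then have "v ^ 1 < v ^ 3" by (intro power_strict_increasing) auto
      then show ?thesis by simp
    qed
    have "clamp_id x = 1 - v / (1 + v ^ 3)"
      using v by (simp add: clamp_id_def v_def[symmetric] pos3_simps) (simp add: v_def minus_divide_left)
    moreover have "0 < v / (1 + v ^ 3)" "v / (1 + v ^ 3) < 1"
      using v lt zero_less_power[OF v, of 3] by (auto simp: divide_less_eq)
    ultimately show ?thesis by simp
  qed (simp add: clamp_id_ge_1)
  then show "clamp_id x > 0" "clamp_id x \<le> max 1 x" by auto
qed

lemma C2_fun_clamp_id: "C2_fun UNIV clamp_id"
proof -
  have "C2_fun UNIV (\<lambda>x. pos3 ((-1) * x + 1))"
    by (intro C2_fun_compose[OF open_UNIV C2_fun_linear C2_fun_pos3]) auto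
  then have "C2_fun UNIV (\<lambda>x. (0 * x + 1) - ((-1) * pos3 ((-1) * x + 1) + 0))"
    by (intro C2_fun_diff open_UNIV C2_fun_linear C2_fun_compose[OF open_UNIV _ C2_fun_linear]) auto
  then have "C2_fun UNIV (\<lambda>x. 1 + pos3 (1 - x))" by simp
  then have "C2_fun UNIV (\<lambda>x. (1 + pos3 (1 - x)) powr (-1))"
    by (intro C2_fun_compose[OF open_UNIV _ C2_fun_powr]) (auto simp: add_pos_nonneg pos3_simps)
  then have "C2_fun UNIV (\<lambda>x. ((-1) * x + 1) * (1 + pos3 (1 - x)) powr (-1))"
    by (intro C2_fun_mult open_UNIV C2_fun_linear)
  then have "C2_fun UNIV (\<lambda>x. (0 * x + 1) - ((-1) * x + 1) * (1 + pos3 (1 - x)) powr (-1))"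
    by (intro C2_fun_diff open_UNIV C2_fun_linear)
  moreover have "clamp_id x = (0 * x + 1) - ((-1) * x + 1) * (1 + pos3 (1 - x)) powr (-1)" for x
    using pos3_simps(3)[of "1 - x"] by (simp add: clamp_id_def powr_minus_divide field_simps)
  ultimately show ?thesis by (metis (no_types, lifting) ext)
qed

text \<open>Put \<rho> = \<nu>/L, which is N'/N, and g = (8 X)^(-q). The left side is a positive
  multiple of (\<rho> + 2q) f - 2q g. If this is positive, then \<rho> \<le> 2q forces f > g/2, and
  f \<le> g leaves at most \<rho> f. The source is split as N N^(p-1) f^2 f^(3p-2): N^(p-1) supplies
  the 1/L of \<rho>, and the last factor is estimated by g/2, which explains the powers of 8 and 2
  in \<open>large\<close>.\<close>

lemma growth_inequality:
  fixes p q \<nu> \<mu> L X f \<kappa> :: real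
  assumes p: "p > 1" and pq: "p * q = 1" and \<nu>: "\<nu> = 1 / (p - 1)" and X: "X > 0" and \<mu>: "\<mu> > 0" and \<kappa>: "\<kappa> > 0"
    and L: "L > 0" "\<nu> / L \<le> 2 * q" and f: "0 < f" "f \<le> (8 * X) powr (- q)"
    and large: "12 * \<kappa>\<^sup>2 * q * \<nu> \<le> \<kappa> powr (1 + q) * \<mu> powr (p - 1) * 8 powr (- (3 - 2 * q)) * 2 powr (- (3 * p - 2))"
  defines "N \<equiv> \<mu> * L powr (- \<nu>) * X powr (2 * q)"
  shows "4 * \<kappa>\<^sup>2 * q * (N / X * (\<nu> / L + 2 * q) * (3 * f\<^sup>2) + N * (6 * f) * (- q * (8 * X) powr (- q) / X))
    \<le> \<kappa> powr (1 + q) * (N * f ^ 3) powr p"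
proof -
  define g where "g = (8 * X) powr (- q)"
  define \<rho> where "\<rho> = \<nu> / L"
  have q: "q > 0" using p pq by (smt (verit) zero_less_mult_iff)
  have g: "g > 0" using X by (simp add: g_def)
  have \<rho>: "0 < \<rho>" "\<rho> \<le> 2 * q" using p \<nu> L by (auto simp: \<rho>_def)
  have N: "N > 0" using \<mu> L X by (simp add: N_def)
  have eq: "N / X * (\<rho> + 2 * q) * (3 * f\<^sup>2) + N * (6 * f) * (- q * g / X) = 3 * f * N / X * ((\<rho> + 2 * q) * f - 2 * q * g)"
    using X by (simp add: power2_eq_square divide_simps) (simp add: algebra_simps)
  have "4 * \<kappa>\<^sup>2 * q * (3 * f * N / X * ((\<rho> + 2 * q) * f - 2 * q * g)) \<le> \<kappa> powr (1 + q) * (N * f ^ 3) powr p"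
  proof (cases "(\<rho> + 2 * q) * f \<le> 2 * q * g")
    case True
    then have "4 * \<kappa>\<^sup>2 * q * (3 * f * N / X * ((\<rho> + 2 * q) * f - 2 * q * g)) \<le> 0"
      using q f N X by (intro mult_nonneg_nonpos) auto
    also have "\<dots> \<le> \<kappa> powr (1 + q) * (N * f ^ 3) powr p" by simp
    finally show ?thesis .
  next
    case False
    have "(\<rho> + 2 * q) * f \<le> 4 * q * f" using \<rho> f by (intro mult_right_mono) auto
    then have "2 * q * g < 4 * q * f" using False by linarith
    then have "(2 * q) * g < (2 * q) * (2 * f)" by (simp add: mult_ac)
    then have fg: "g / 2 \<le> f" using q by (subst (asm) mult_less_cancel_left_pos) auto
    have "2 * q * f \<le> 2 * q * g" using f q by (simp add: g_def)
    then have "(\<rho> + 2 * q) * f - 2 * q * g \<le> \<rho> * f" by (simp add: algebra_simps)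
    then have "4 * \<kappa>\<^sup>2 * q * (3 * f * N / X * ((\<rho> + 2 * q) * f - 2 * q * g)) \<le> 4 * \<kappa>\<^sup>2 * q * (3 * f * N / X * (\<rho> * f))"
      using q f N X by (intro mult_left_mono) auto
    also have "\<dots> = (12 * \<kappa>\<^sup>2 * q * \<nu>) * (N * f\<^sup>2 / (L * X))"
      by (simp add: \<rho>_def power2_eq_square mult_ac)
    also have "\<dots> \<le> (\<kappa> powr (1 + q) * \<mu> powr (p - 1) * 8 powr (- (3 - 2 * q)) * 2 powr (- (3 * p - 2))) * (N * f\<^sup>2 / (L * X))"
      using N L X by (intro mult_right_mono large) auto
    also have "\<dots> = \<kappa> powr (1 + q) * (N * N powr (p - 1)) * (f\<^sup>2 * (g / 2) powr (3 * p - 2))"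
    proof -
      have e: "- q * (3 * p - 2) = - (3 - 2 * q)" using pq by (simp add: algebra_simps)
      have n1: "N powr (p - 1) = \<mu> powr (p - 1) * (1 / L) * X powr (2 * q * (p - 1))"
      proof -
        have "- \<nu> * (p - 1) = -1" using \<nu> p by simp
        then have "(L powr (- \<nu>)) powr (p - 1) = 1 / L"
          using L by (simp only: powr_powr) (simp add: powr_minus_divide)
        moreover have "N powr (p - 1) = \<mu> powr (p - 1) * (L powr (- \<nu>)) powr (p - 1) * (X powr (2 * q)) powr (p - 1)"
          using \<mu> L X by (simp only: N_def powr_mult)
        ultimately show ?thesis by (simp only: powr_powr)
      qed
      have n2: "(g / 2) powr (3 * p - 2) = 8 powr (- (3 - 2 * q)) * X powr (- (3 - 2 * q)) * 2 powr (- (3 * p - 2))"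
      proof -
        have "(g / 2) powr (3 * p - 2) = g powr (3 * p - 2) * 2 powr (- (3 * p - 2))"
          unfolding powr_minus_divide[of 2 "3 * p - 2"] using g by (simp add: powr_divide)
        also have "g powr (3 * p - 2) = (8 * X) powr (- (3 - 2 * q))"
          unfolding g_def powr_powr e ..
        finally show ?thesis using X by (simp add: powr_mult)
      qed
      \<comment> \<open>Criticality in the form p q = 1: the powers of X from N^(p-1) and from
        g^(3p-2) combine to exactly 1/X, so no power of X is left over.\<close>
      have n3: "X powr (2 * q * (p - 1)) * X powr (- (3 - 2 * q)) = 1 / X"
      proof -
        have "2 * q * (p - 1) + - (3 - 2 * q) = -1" using pq by (simp add: algebra_simps)
        then show ?thesis using X by (simp only: powr_add[symmetric]) (simp add: powr_minus_divide)
      qed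
      have "\<kappa> powr (1 + q) * (N * N powr (p - 1)) * (f\<^sup>2 * (g / 2) powr (3 * p - 2)) =
        (\<kappa> powr (1 + q) * \<mu> powr (p - 1) * 8 powr (- (3 - 2 * q)) * 2 powr (- (3 * p - 2))) *
        (N * f\<^sup>2 * (1 / L)) * (X powr (2 * q * (p - 1)) * X powr (- (3 - 2 * q)))"
        unfolding n1 n2 by (simp only: mult_ac)
      then show ?thesis unfolding n3 by simp
    qed
    also have "\<dots> \<le> \<kappa> powr (1 + q) * (N * N powr (p - 1)) * (f\<^sup>2 * f powr (3 * p - 2))"
      using N fg g p by (intro mult_left_mono powr_mono2) auto
    also have "\<dots> = \<kappa> powr (1 + q) * (N * f ^ 3) powr p"
    proof -
      have "N * N powr (p - 1) = N powr p" using N by (simp add: powr_mult_base)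
      moreover have "f\<^sup>2 * f powr (3 * p - 2) = (f ^ 3) powr p"
      proof -
        have "f\<^sup>2 * f powr (3 * p - 2) = f powr (2 + (3 * p - 2))"
          unfolding powr_add using f by (simp add: powr_numeral)
        also have "\<dots> = (f powr 3) powr p" by (simp add: powr_powr)
        finally show ?thesis using f by (simp add: powr_numeral)
      qed
      ultimately show ?thesis using N f by (simp add: powr_mult)
    qed
    finally show ?thesis .
  qed
  then show ?thesis unfolding eq[unfolded g_def \<rho>_def] g_def \<rho>_def .
qed

context semilinear_wave
begin

text \<open>The subsolution is treated in three zones. For X \<le> 1 it vanishes; for 1 \<le> X
  \<le> 2 a cutoff switches it on, and its cost is paid by the strip bound through
  \<open>small\<close>; beyond X = 2 it feeds on its own source by \<open>growth_inequality\<close>.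
  The condition on \<tau> keeps ln X far enough below A.\<close>

lemma growth:
  fixes c :: 'a
  assumes \<kappa>: "\<kappa> > 0" and \<delta>: "\<delta> > 0" and \<mu>: "\<mu> > 0" and A: "A \<ge> 2"
    and pq: "p * q = 1" and mq: "m * (p - 1) = 1 + q" and \<nu>: "\<nu> = 1 / (p - 1)"
    and strip: "\<And>x t. 2 / \<kappa> \<le> t \<Longrightarrow> t < T \<Longrightarrow> 1 \<le> \<kappa> * (t - norm (x - c)) + 4 \<Longrightarrow>
      \<kappa> * (t - norm (x - c)) + 4 \<le> 2 \<Longrightarrow> \<delta> * norm (x - c) powr (- m) \<le> u x t"
    and small: "12 * \<kappa>\<^sup>2 * q * (52 * \<mu> * (A / 2) powr (- \<nu>)) \<le> \<kappa> powr (1 + q) * \<delta> powr p"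
    and large: "12 * \<kappa>\<^sup>2 * q * \<nu> \<le> \<kappa> powr (1 + q) * \<mu> powr (p - 1) * 8 powr (- (3 - 2 * q)) * 2 powr (- (3 * p - 2))"
    and \<tau>: "0 < \<tau>" "\<tau> < T" "\<kappa> * \<tau> + 4 \<le> exp (A - \<nu> / (2 * q))"
    and X: "\<kappa> * (\<tau> - norm (x - c)) + 4 \<ge> 2"
    and f: "(\<kappa> * (\<tau> + norm (x - c))) powr (- q) \<le> (8 * (\<kappa> * (\<tau> - norm (x - c)) + 4)) powr (- q)"
  shows "norm (x - c) powr (- m) * (log_profile q \<nu> A \<mu> (\<kappa> * (\<tau> - norm (x - c)) + 4) *
      ((8 * (\<kappa> * (\<tau> - norm (x - c)) + 4)) powr (- q) - (\<kappa> * (\<tau> + norm (x - c))) powr (- q)) ^ 3) \<le> u x \<tau>"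
proof -
  let ?X = "\<lambda>r t. \<kappa> * (t - r) + 4" and ?Y = "\<lambda>r t. \<kappa> * (t + r)"
  have q: "q > 0" using p pq by (smt (verit) zero_less_mult_iff)
  have "1 * q < p * q" using p q by (rule mult_strict_right_mono)
  then have q1: "q < 1" using pq by simp
  have \<nu>0: "\<nu> > 0" using p by (simp add: \<nu>)
  define n where "n = log_profile q \<nu> A \<mu>"
  define B where "B X = smooth_step (X - 1) * n (clamp_id X)" for X
  define g where "g X = (8 * clamp_id X) powr (- q)" for X
  define h where "h Y = Y powr (- q)" for Y :: real
  have A0: "1 < exp A" using A by simp
  have clamp_in: "clamp_id X \<in> {0<..<exp A}" if "X < exp A" for X
  proof -
    have "max 1 X < exp A" using that A0 by (simp only: max_less_iff_conj)
    then show ?thesis using clamp_id_pos[of X] order_le_less_trans[OF clamp_id_le[of X]] by auto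
  qed
  have nY: "C2_fun {..<exp A} (\<lambda>X. n (clamp_id X))"
    unfolding n_def using clamp_in
    by (intro C2_fun_compose[OF open_lessThan C2_fun_subset[OF C2_fun_clamp_id subset_UNIV] C2_fun_log_profile]) auto
  have step1: "C2_fun {..<exp A} (\<lambda>X. smooth_step (X - 1))"
    using C2_fun_compose[OF open_lessThan C2_fun_subset[OF C2_fun_linear[of 1 "-1"] subset_UNIV] C2_fun_smooth_step,
        of "exp A"] by simp
  have BC: "C2_fun {..<exp A} B"
    unfolding B_def[abs_def] by (rule C2_fun_mult[OF open_lessThan step1 nY])
  have "C2_fun UNIV (\<lambda>X. (8 * clamp_id X + 0) powr (- q))"
    by (intro C2_fun_compose[OF open_UNIV _ C2_fun_powr] C2_fun_compose[OF open_UNIV C2_fun_clamp_id C2_fun_linear])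
       (auto simp: clamp_id_pos)
  then have gC: "C2_fun {..<exp A} g"
    unfolding g_def[abs_def] using C2_fun_subset by auto
  have hC: "C2_fun {0<..} h" unfolding h_def[abs_def] by (rule C2_fun_powr)
  have b: "\<kappa> * \<tau> + 4 < exp A"
  proof -
    have "exp (A - \<nu> / (2 * q)) < exp A" using \<nu>0 q by (subst exp_less_cancel_iff) simp
    with \<tau>(3) show ?thesis by (rule order_le_less_trans)
  qed
  have Xle: "?X r t \<le> exp (A - \<nu> / (2 * q))" if "0 \<le> r" "t \<le> \<tau>" for r t
  proof -
    have "\<kappa> * (t - r) \<le> \<kappa> * \<tau>" using that \<kappa> by (intro mult_left_mono) auto
    then show ?thesis using \<tau>(3) by simp
  qed
  \<comment> \<open>Staying \<nu>/(2q) below the singularity of N is what bounds N'/N by 2q.\<close>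
  have L: "A - ln X > 0" "\<nu> / (A - ln X) \<le> 2 * q" if "0 < X" "X \<le> exp (A - \<nu> / (2 * q))" for X
  proof -
    have "ln X \<le> ln (exp (A - \<nu> / (2 * q)))" using that by (subst ln_le_cancel_iff) auto
    then have L: "\<nu> / (2 * q) \<le> A - ln X" by simp
    have pos: "\<nu> / (2 * q) > 0" using \<nu>0 q by simp
    then show "A - ln X > 0" using L by linarith
    then show "\<nu> / (A - ln X) \<le> 2 * q" using L q by (simp add: field_simps)
  qed
  have n_nonneg: "n y \<ge> 0" for y using \<mu> by (simp add: n_def log_profile_def)
  have n_deriv: "deriv B X = deriv smooth_step (X - 1) * n X + smooth_step (X - 1) * (n X / X * (\<nu> / (A - ln X) + 2 * q))"
    if X: "1 < X" "X \<le> exp (A - \<nu> / (2 * q))" for X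
  proof -
    have lnX: "ln X < A" using L(1)[of X] X by simp
    have "(n has_real_derivative n X / X * (\<nu> / (A - ln X) + 2 * q)) (at X)"
      unfolding n_def using X lnX by (intro DERIV_log_profile) auto
    then have nd: "((\<lambda>X. n (clamp_id X)) has_real_derivative n X / X * (\<nu> / (A - ln X) + 2 * q)) (at X)"
      by (rule has_field_derivative_transform_within_open[where S = "{1<..}"])
         (use X in \<open>auto simp: clamp_id_ge_1\<close>)
    have "((\<lambda>X. smooth_step (X - 1)) has_real_derivative deriv smooth_step (X - 1)) (at X)"
      by (rule DERIV_cong[OF DERIV_chain2[OF smooth_step_DERIV(1)]]) (auto intro!: derivative_eq_intros)
    from DERIV_imp_deriv[OF DERIV_mult[OF this nd]] show ?thesis
      using X unfolding B_def by (simp add: clamp_id_ge_1 mult.commute)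
  qed
  have B_low: "B X = 0" if "X \<le> 1" for X using that by (simp add: B_def smooth_step_0)
  have B1_low: "deriv B X = 0" if X: "X \<le> 1" for X
  proof -
    have XA: "X < exp A" using X A0 by linarith
    have "((\<lambda>X. smooth_step (X - 1)) has_real_derivative deriv smooth_step (X - 1)) (at X)"
      by (rule DERIV_cong[OF DERIV_chain2[OF smooth_step_DERIV(1)]]) (auto intro!: derivative_eq_intros)
    from DERIV_imp_deriv[OF DERIV_mult[OF this C2_funD(1)[OF nY]]] XA show ?thesis
      using X unfolding B_def[abs_def] by (simp add: smooth_step_0 deriv_smooth_step_0)
  qed
  have g1: "deriv g X = - q * (8 * X) powr (- q) / X" if X: "1 < X" for X
  proof -
    have "((\<lambda>X. (8 * X) powr (- q)) has_real_derivative - q * (8 * X) powr (- q) / X) (at X)"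
      using X by (auto intro!: derivative_eq_intros simp: powr_diff field_simps)
    then have "(g has_real_derivative - q * (8 * X) powr (- q) / X) (at X)"
      by (rule has_field_derivative_transform_within_open[where S = "{1<..}"])
         (use X in \<open>auto simp: g_def clamp_id_ge_1\<close>)
    then show ?thesis by (rule DERIV_imp_deriv)
  qed
  have h1: "deriv h Y = - q * Y powr (- q - 1)" if "Y > 0" for Y
    unfolding h_def[abs_def] using that by (intro DERIV_imp_deriv) (auto intro!: derivative_eq_intros)
  have gle: "g X \<le> 1" if "X \<ge> 1" for X
  proof -
    have "(8 * X) powr (- q) \<le> 1 powr (- q)" using that q by (intro powr_mono2') auto
    then show ?thesis using that by (simp add: g_def clamp_id_ge_1)
  qed
  \<comment> \<open>The factor 8 in \<open>g\<close> has three uses: on the support of the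
    subsolution Y > 8 X, which excludes r \<le> 2/\<kappa>, excludes time 0, and in the switching
    zone forces t \<ge> 2/\<kappa>, where \<open>strip\<close> is available.\<close>
  have gh: "8 * X < Y" if "h Y < g X" "X \<ge> 1" "Y > 0" for X Y
  proof (rule ccontr)
    assume "\<not> ?thesis"
    then have "(8 * X) powr (- q) \<le> Y powr (- q)" using that q by (intro powr_mono2') auto
    then show False using that by (simp add: g_def h_def clamp_id_ge_1)
  qed
  have zero: "g (?X r t) \<le> h (?Y r t)" if r: "0 < r" "r \<le> 2 / \<kappa>" and t: "t \<in> {0..\<tau>}" for r t
  proof (rule ccontr)
    assume n: "\<not> ?thesis"
    have kr: "\<kappa> * r \<le> 2" using r \<kappa> by (simp add: field_simps)
    have kt: "\<kappa> * t \<ge> 0" and krp: "\<kappa> * r > 0" using \<kappa> t r by auto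
    have "8 * ?X r t < ?Y r t"
      using n kr kt krp by (intro gh) (auto simp: algebra_simps)
    then show False using kr kt krp by (simp add: algebra_simps)
  qed
  define V where "V r t = B (?X r t) * pos3 (g (?X r t) - h (?Y r t))" for r t
  define Vt where "Vt r t = \<kappa> * (deriv B (?X r t) * pos3 (g (?X r t) - h (?Y r t)) +
       B (?X r t) * (3 * max 0 (g (?X r t) - h (?Y r t)) ^ 2 * (deriv g (?X r t) - deriv h (?Y r t))))" for r t
  obtain vtt vb vbb where
    v: "C2_slab \<tau> (\<lambda>x t. norm (x - c) powr (- m) * V (norm (x - c)) t)
       (\<lambda>x t. norm (x - c) powr (- m) * Vt (norm (x - c)) t) vtt vb vbb"
    and box: "\<forall>x t. t \<in> {0..\<tau>} \<longrightarrow> vtt x t - (\<Sum>b\<in>Basis. vbb b x t) =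
       norm (x - c) powr (- m) * (- 4 * \<kappa>\<^sup>2 * deriv h (?Y (norm (x - c)) t) *
         (deriv B (?X (norm (x - c)) t) * (3 * max 0 (g (?X (norm (x - c)) t) - h (?Y (norm (x - c)) t)) ^ 2) +
          B (?X (norm (x - c)) t) * (6 * max 0 (g (?X (norm (x - c)) t) - h (?Y (norm (x - c)) t))) *
            deriv g (?X (norm (x - c)) t))
         - m * (1 - m) * V (norm (x - c)) t / (norm (x - c))\<^sup>2)"
    unfolding V_def[abs_def] Vt_def[abs_def]
    by (rule characteristic_lift[OF dim(2) _ \<kappa> BC gC hC b, of "2 / \<kappa>" c])
       (use zero \<kappa> in auto)
  have early: "?X r 0 \<le> 1 \<or> g (?X r 0) \<le> h (?Y r 0)" if "r > 0" for r
  proof (rule ccontr)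
    assume "\<not> ?thesis"
    then have n: "1 < ?X r 0" "h (?Y r 0) < g (?X r 0)" by (simp_all only: not_le not_less de_Morgan_disj)
    have "8 * ?X r 0 < ?Y r 0" by (rule gh[OF n(2)]) (use n(1) that \<kappa> in auto)
    then show False using n(1) by (simp add: algebra_simps)
  qed
  have V0: "V r 0 = 0 \<and> Vt r 0 = 0" if "r > 0" for r
    using early[OF that] by (auto simp: V_def Vt_def B_low B1_low pos3_simps max_absorb1)
  have Vnn: "V r t \<ge> 0" for r t
    unfolding V_def B_def by (intro mult_nonneg_nonneg smooth_step_ge_0 n_nonneg pos3_simps)
  define l where "l y t = (if 2 / \<kappa> \<le> t \<and> 1 \<le> ?X (norm (y - c)) t \<and> ?X (norm (y - c)) t \<le> 2
      then \<delta> * norm (y - c) powr (- m) else 0)" for y t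
  have mp: "- m + (- q - 1) = - m * p" using mq by (simp add: algebra_simps)
  \<comment> \<open>Removes the powers of r. Y is at least \<kappa> r, and m (p - 1) = 1 + q turns
    r^(-m) r^(-q-1) into r^(-m p), the power in the source. It remains to bound M by \<kappa>^(1+q)
    W^p, with W = \<delta> in the strip and W = V beyond it.\<close>
  have key: "r powr (- m) * (?Y r t powr (- q - 1) * M) \<le> (r powr (- m) * W) powr p"
    if "r > 0" "t \<ge> 0" "W \<ge> 0" "M \<le> \<kappa> powr (1 + q) * W powr p" for r t W M
  proof -
    have "?Y r t powr (- q - 1) * M \<le> ?Y r t powr (- q - 1) * (\<kappa> powr (1 + q) * W powr p)"
      using that by (intro mult_left_mono) auto
    also have "\<dots> \<le> (\<kappa> * r) powr (- q - 1) * (\<kappa> powr (1 + q) * W powr p)"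
      using that \<kappa> q by (intro mult_right_mono powr_mono2') auto
    also have "\<dots> = r powr (- q - 1) * W powr p"
    proof -
      have "\<kappa> powr (- q - 1) * \<kappa> powr (1 + q) = 1" using \<kappa> by (simp add: powr_add[symmetric])
      moreover have "(\<kappa> * r) powr (- q - 1) * (\<kappa> powr (1 + q) * W powr p) =
          (\<kappa> powr (- q - 1) * \<kappa> powr (1 + q)) * (r powr (- q - 1) * W powr p)"
        using that \<kappa> by (subst powr_mult) (simp_all only: less_imp_le mult_ac)
      ultimately show ?thesis by (simp only: mult_1_left)
    qed
    finally have "r powr (- m) * (?Y r t powr (- q - 1) * M) \<le> r powr (- m) * (r powr (- q - 1) * W powr p)"
      by (intro mult_left_mono) auto
    also have "\<dots> = r powr (- m + (- q - 1)) * W powr p" by (simp only: powr_add mult.assoc)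
    also have "\<dots> = (r powr (- m) * W) powr p"
      unfolding mp using that by (simp add: powr_mult powr_powr)
    finally show ?thesis .
  qed
  have C2u: "C2_slab \<tau> u ut utt ub ubb" using slab \<tau> by simp
  have "norm (x - c) powr (- m) * V (norm (x - c)) \<tau> \<le> u x \<tau>"
  proof (rule semilinear_comparison[OF dim(1) p \<tau>(1) C2u v, where l = l])
    show "u y 0 = 0" for y by (rule init)
    show "norm (y - c) powr (- m) * V (norm (y - c)) 0 = 0" for y
      using V0[of "norm (y - c)"] by (cases "y = c") auto
    show "norm (y - c) powr (- m) * Vt (norm (y - c)) 0 \<le> ut y 0" for y
      using V0[of "norm (y - c)"] init(2)[of y] by (cases "y = c") auto
    fix y t assume t: "0 < t" "t < \<tau>"
    show "utt y t - (\<Sum>b\<in>Basis. ubb b y t) = \<bar>u y t\<bar> powr p" using eq t \<tau> by simp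
    show "0 \<le> l y t \<and> l y t \<le> u y t"
      using strip[of t y] nonneg[of t y] t \<tau> \<delta> by (auto simp: l_def)
    let ?r = "norm (y - c)"
    let ?x = "?X ?r t" and ?y = "?Y ?r t"
    define F where "F = max 0 (g ?x - h ?y)"
    define M where "M = 4 * \<kappa>\<^sup>2 * q * (deriv B ?x * (3 * F\<^sup>2) + B ?x * (6 * F) * deriv g ?x)"
    have tt: "t \<in> {0..\<tau>}" using t by simp
    have d: "0 \<le> m * (1 - m) * V ?r t / ?r\<^sup>2"
      using m(3) Vnn[of ?r t] by (intro divide_nonneg_nonneg mult_nonneg_nonneg[of "m * (1 - m)"]) auto
    have "vtt y t - (\<Sum>b\<in>Basis. vbb b y t) \<le> ?r powr (- m) * (- 4 * \<kappa>\<^sup>2 * deriv h ?y *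
         (deriv B ?x * (3 * F\<^sup>2) + B ?x * (6 * F) * deriv g ?x))"
      unfolding box[rule_format, OF tt] F_def
      by (rule mult_left_mono, use d in linarith, simp)
    also have "\<dots> \<le> max (?r powr (- m) * V ?r t) (l y t) powr p"
    proof (cases "?r = 0 \<or> F = 0 \<or> ?x \<le> 1")
      case True
      then have "?r powr (- m) * (- 4 * \<kappa>\<^sup>2 * deriv h ?y *
         (deriv B ?x * (3 * F\<^sup>2) + B ?x * (6 * F) * deriv g ?x)) = 0"
        using B_low B1_low by auto
      then show ?thesis by (simp only: powr_ge_zero)
    next
      case False
      then have r: "?r > 0" and F: "F > 0" "F = g ?x - h ?y" and x1: "1 < ?x" by (auto simp: F_def max_def split: if_splits)
      have y0: "?y > 0" using r t \<kappa> by (intro mult_pos_pos add_pos_pos)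
      have M: "?r powr (- m) * (- 4 * \<kappa>\<^sup>2 * deriv h ?y *
         (deriv B ?x * (3 * F\<^sup>2) + B ?x * (6 * F) * deriv g ?x)) = ?r powr (- m) * (?y powr (- q - 1) * M)"
        unfolding M_def h1[OF y0] by (simp add: mult_ac)
      have xE: "?x \<le> exp (A - \<nu> / (2 * q))" using t by (intro Xle) auto
      have Fle: "F \<le> (8 * ?x) powr (- q)" using F x1 by (simp add: g_def h_def clamp_id_ge_1)
      have Bx: "B ?x \<ge> 0" unfolding B_def by (intro mult_nonneg_nonneg smooth_step_ge_0 n_nonneg)
      show ?thesis
      proof (cases "?x \<le> 2")
        case True
        have "8 * ?x < ?y" using F x1 y0 by (intro gh) auto
        then have "\<kappa> * t \<ge> 2" using x1 by (simp add: algebra_simps)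
        then have t2: "2 / \<kappa> \<le> t" using \<kappa> by (simp add: field_simps)
        have "A - ln ?x \<ge> A / 2"
        proof -
          have "ln ?x \<le> ?x - 1" using x1 by (intro ln_le_minus_one) auto
          then show ?thesis using A True by simp
        qed
        then have "(A - ln ?x) powr (- \<nu>) \<le> (A / 2) powr (- \<nu>)"
          using A \<nu>0 by (intro powr_mono2') auto
        moreover have "?x powr (2 * q) \<le> 4"
        proof -
          have "?x powr (2 * q) \<le> 2 powr (2 * q)" using True x1 q by (intro powr_mono2) auto
          also have "\<dots> \<le> 2 powr 2" using q1 by (intro powr_mono) auto
          finally show ?thesis by (simp add: powr_numeral)
        qed
        ultimately have "\<mu> * (A - ln ?x) powr (- \<nu>) * ?x powr (2 * q) \<le> \<mu> * (A / 2) powr (- \<nu>) * 4"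
          using \<mu> by (intro mult_mono mult_left_mono) auto
        then have nx: "n ?x \<le> 4 * \<mu> * (A / 2) powr (- \<nu>)" by (simp add: n_def log_profile_def)
        have i1: "n ?x / ?x * (\<nu> / (A - ln ?x) + 2 * q) \<le> n ?x * 4"
        proof -
          have "n ?x / ?x * (\<nu> / (A - ln ?x) + 2 * q) \<le> n ?x / 1 * (2 * q + 2 * q)"
            using x1 L[OF _ xE] n_nonneg \<nu>0 q
            by (intro mult_mono divide_left_mono add_mono) auto
          also have "\<dots> = n ?x * (4 * q)" by simp
          also have "\<dots> \<le> n ?x * 4" using q1 n_nonneg by (intro mult_left_mono) auto
          finally show ?thesis .
        qed
        have i2: "0 \<le> n ?x / ?x * (\<nu> / (A - ln ?x) + 2 * q)"
        proof (rule mult_nonneg_nonneg)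
          have x0: "0 < ?x" using x1 by linarith
          show "0 \<le> n ?x / ?x" by (rule divide_nonneg_pos[OF n_nonneg x0])
          have "0 \<le> \<nu> / (A - ln ?x)" using L(1)[OF x0 xE] \<nu>0 by (intro divide_nonneg_pos) auto
          then show "0 \<le> \<nu> / (A - ln ?x) + 2 * q" using q by linarith
        qed
        \<comment> \<open>The constant 52 is 4 (9 + 4): n is at most 4 \<mu> (A/2)^(-\<nu>) because
          X^(2q) \<le> 4 and A - ln X \<ge> A/2, the cutoff has slope at most 9, and the derivative
          of n is at most 4 q n \<le> 4 n.\<close>
        have "deriv B ?x \<le> 9 * n ?x + 1 * (n ?x * 4)"
          unfolding n_deriv[OF x1 xE]
          by (rule add_mono[OF mult_right_mono[OF deriv_smooth_step_le_9 n_nonneg]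
                mult_mono[OF smooth_step_le_1 i1 _ i2]]) simp
        then have Bd: "deriv B ?x \<le> 52 * \<mu> * (A / 2) powr (- \<nu>)" using nx by simp
        have "F \<le> 1" using Fle gle[of ?x] x1 by (simp add: g_def clamp_id_ge_1)
        then have F2: "F\<^sup>2 \<le> 1" using F by (intro power_le_one) auto
        have "B ?x * (6 * F) * deriv g ?x \<le> 0"
          unfolding g1[OF x1] using Bx F q x1
          by (intro mult_nonneg_nonpos mult_nonneg_nonneg) (auto simp: divide_nonpos_pos)
        moreover have "deriv B ?x * (3 * F\<^sup>2) \<le> (52 * \<mu> * (A / 2) powr (- \<nu>)) * (3 * 1)"
          using Bd F2 \<mu> by (intro mult_mono) auto
        ultimately have "deriv B ?x * (3 * F\<^sup>2) + B ?x * (6 * F) * deriv g ?x \<le> 3 * (52 * \<mu> * (A / 2) powr (- \<nu>))"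
          by linarith
        then have "M \<le> 4 * \<kappa>\<^sup>2 * q * (3 * (52 * \<mu> * (A / 2) powr (- \<nu>)))"
          unfolding M_def using q by (intro mult_left_mono) auto
        also have "\<dots> \<le> \<kappa> powr (1 + q) * \<delta> powr p" using small by (simp add: mult_ac)
        finally have "?r powr (- m) * (?y powr (- q - 1) * M) \<le> (?r powr (- m) * \<delta>) powr p"
          using r t \<delta> by (intro key) auto
        also have "\<dots> = l y t powr p" using t2 x1 True by (simp add: l_def mult.commute)
        also have "\<dots> \<le> max (?r powr (- m) * V ?r t) (l y t) powr p"
          using p \<delta> by (intro powr_mono2) (auto simp: l_def)
        finally show ?thesis unfolding M .
      next
        case x2: False
        have st: "smooth_step (?x - 1) = 1" "deriv smooth_step (?x - 1) = 0"
          using x2 by (auto intro!: smooth_step_1 deriv_smooth_step_1)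
        have BN: "B ?x = n ?x" using st x1 by (simp add: B_def clamp_id_ge_1)
        have "4 * \<kappa>\<^sup>2 * q * (n ?x / ?x * (\<nu> / (A - ln ?x) + 2 * q) * (3 * F\<^sup>2) +
            n ?x * (6 * F) * (- q * (8 * ?x) powr (- q) / ?x)) \<le> \<kappa> powr (1 + q) * (n ?x * F ^ 3) powr p"
          unfolding n_def log_profile_def
          using x1 L[OF _ xE] F Fle
          by (intro growth_inequality[OF p pq \<nu> _ \<mu> \<kappa> _ _ _ _ large]) auto
        then have "M \<le> \<kappa> powr (1 + q) * (n ?x * F ^ 3) powr p"
          unfolding M_def n_deriv[OF x1 xE] g1[OF x1] BN st by simp
        moreover have "V ?r t = n ?x * F ^ 3" using F BN by (simp add: V_def pos3_simps)
        ultimately have "M \<le> \<kappa> powr (1 + q) * V ?r t powr p" by (simp only:)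
        then have "?r powr (- m) * (?y powr (- q - 1) * M) \<le> (?r powr (- m) * V ?r t) powr p"
          using t by (intro key r Vnn) auto
        also have "\<dots> \<le> max (?r powr (- m) * V ?r t) (l y t) powr p"
          using p Vnn by (intro powr_mono2) auto
        finally show ?thesis unfolding M .
      qed
    qed
    finally show "vtt y t - (\<Sum>b\<in>Basis. vbb b y t) \<le> max (?r powr (- m) * V ?r t) (l y t) powr p" .
  qed
  moreover have "V (norm (x - c)) \<tau> = log_profile q \<nu> A \<mu> (?X (norm (x - c)) \<tau>) *
      ((8 * ?X (norm (x - c)) \<tau>) powr (- q) - ?Y (norm (x - c)) \<tau> powr (- q)) ^ 3"
    using X f by (simp add: V_def B_def n_def g_def h_def clamp_id_ge_1 smooth_step_1 pos3_simps)
  ultimately show ?thesis by simp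
qed

end

section \<open>Blow-up\<close>

context semilinear_wave
begin

text \<open>The exponent k = 2/(p - 1) satisfies k + 2 = k p, the balance of a power blow-up of
  \<theta>'' = \<theta>^p. The cubic \<open>Q\<close> starts at t1 with vanishing value and first
  two derivatives, so \<theta> is C^2 and zero up to t1. The numbers 9 and 6 in \<open>cond\<close>
  bound \<open>(Q1 t)\<^sup>2\<close> and \<open>Q2 t\<close> in units of 1/R^2.\<close>

lemma blowup:
  fixes x0 :: 'a
  assumes t: "0 < t1" "t1 < t0" "t0 < T" and L: "L > 0"
    and big: "\<And>x t. t1 \<le> t \<Longrightarrow> t \<le> t0 \<Longrightarrow> norm (x - x0) \<le> t0 - t \<Longrightarrow> L \<le> u x t"
    and k: "k = 2 / (p - 1)"
    and cond: "(9 * k * (k + 1) + 6 * k) * L / (t0 - t1)\<^sup>2 \<le> (L / 2) powr p"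
  shows False
proof -
  define R where "R = t0 - t1"
  have R: "R > 0" using t by (simp add: R_def)
  have k0: "k > 0" and kp: "k + 2 = k * p" using p by (auto simp: k field_simps)
  define y where "y t = (t - t1) / R" for t
  define Q where "Q t = pos3 (y t)" for t
  define Q1 where "Q1 t = 3 * max 0 (y t) ^ 2 / R" for t
  define Q2 where "Q2 t = 6 * max 0 (y t) / R\<^sup>2" for t
  define \<theta> where "\<theta> t = L * ((1 - Q t) powr (- k) - 1)" for t
  define \<theta>1 where "\<theta>1 t = L * (k * (1 - Q t) powr (- k - 1) * Q1 t)" for t
  define \<theta>2 where "\<theta>2 t = L * (k * (k + 1) * (1 - Q t) powr (- k - 1 - 1) * (Q1 t)\<^sup>2 + k * (1 - Q t) powr (- k - 1) * Q2 t)" for t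
  have yd: "(y has_real_derivative 1 / R) (at t within A)" for t A
    unfolding y_def[abs_def] using R by (auto intro!: derivative_eq_intros)
  have P01: "(pos3 has_real_derivative 3 * max 0 x ^ 2) (at x)" for x
    using C2_funD(1)[OF C2_fun_pos3] deriv_pos3 by simp
  have Qd: "(Q has_real_derivative Q1 t) (at t within A)" for t A
    unfolding Q_def[abs_def] Q1_def by (rule DERIV_cong[OF DERIV_chain2[OF P01 yd]]) simp
  have Q1d: "(Q1 has_real_derivative Q2 t) (at t within A)" for t A
    unfolding Q1_def[abs_def] Q2_def
    by (rule DERIV_cong[OF DERIV_cdivide[OF DERIV_cmult[OF DERIV_chain2[OF DERIV_pos_part(1) yd]]]])
       (simp add: power2_eq_square)
  have y1: "y t < 1" if "t < t0" for t using that R by (simp add: y_def R_def field_simps)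
  have Qlt: "0 \<le> Q t \<and> Q t < 1" if "t < t0" for t
  proof -
    have "max 0 (y t) ^ 3 < 1 ^ 3" using y1[OF that] by (intro power_strict_mono) auto
    then show ?thesis by (simp add: Q_def pos3_def)
  qed
  have pw: "((\<lambda>t. (1 - Q t) powr a) has_real_derivative a * (1 - Q t) powr (a - 1) * (- Q1 t)) (at t within A)"
    if "t < t0" for t A a
    using Qlt[OF that] by (auto intro!: derivative_eq_intros Qd)
  have theta: "(\<theta> has_real_derivative \<theta>1 t) (at t within A)" "(\<theta>1 has_real_derivative \<theta>2 t) (at t within A)"
    if "t < t0" for t A
  proof -
    show "(\<theta> has_real_derivative \<theta>1 t) (at t within A)"
      unfolding \<theta>_def[abs_def] \<theta>1_def
      by (rule derivative_eq_intros pw[OF that] refl | simp)+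
    show "(\<theta>1 has_real_derivative \<theta>2 t) (at t within A)"
      unfolding \<theta>1_def[abs_def] \<theta>2_def
      by (rule DERIV_cong[OF DERIV_cmult[OF DERIV_mult[OF DERIV_cmult[OF pw[OF that]] Q1d]]])
         (simp add: algebra_simps power2_eq_square)
  qed
  have upper: "\<theta> \<tau> \<le> u x0 \<tau>" if \<tau>: "t1 < \<tau>" "\<tau> < t0" for \<tau>
  proof -
    have \<tau>0: "0 < \<tau>" "\<tau> < T" using \<tau> t by auto
    have "continuous_on {0..\<tau>} y" by (rule DERIV_continuous_on[OF yd])
    moreover have "continuous_on {0..\<tau>} Q" by (rule DERIV_continuous_on[OF Qd])
    ultimately have "continuous_on {0..\<tau>} \<theta>2"
      unfolding \<theta>2_def Q1_def Q2_def using R \<tau> Qlt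
      by (intro continuous_intros) (auto, (metis le_less_trans less_irrefl)+)
    then have v: "C2_slab \<tau> (\<lambda>x. \<theta>) (\<lambda>x. \<theta>1) (\<lambda>x. \<theta>2) (\<lambda>b x t. 0) (\<lambda>(b::'a) (x::'a) t. 0)"
      using \<tau> by (intro C2_slab_time theta) auto
    have C2u: "C2_slab \<tau> u ut utt ub ubb" using slab \<tau>0 by simp
    have early: "Q s = 0 \<and> Q1 s = 0 \<and> Q2 s = 0" if "s \<le> t1" for s
    proof -
      have "y s \<le> 0" using that R by (simp add: y_def divide_nonpos_pos)
      then show ?thesis by (simp add: Q_def Q1_def Q2_def pos3_simps max_absorb1)
    qed
    show ?thesis
    proof (rule semilinear_comparison[OF dim(1) p \<tau>0(1) C2u v, where l = "\<lambda>x s. if t1 \<le> s then L else 0"])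
      show "u x 0 = 0" for x by (rule init)
      show "\<theta> 0 = 0" using early[of 0] t by (simp add: \<theta>_def)
      show "\<theta>1 0 \<le> ut x 0" for x using early[of 0] t init(2) by (simp add: \<theta>1_def)
      fix x s assume s: "0 < s" "s < \<tau>" and x: "norm (x - x0) \<le> \<tau> - s"
      show "utt x s - (\<Sum>b\<in>Basis. ubb b x s) = \<bar>u x s\<bar> powr p" using eq s \<tau>0 by simp
      show "0 \<le> (if t1 \<le> s then L else 0) \<and> (if t1 \<le> s then L else 0) \<le> u x s"
        using big[of s x] nonneg[of s x] s x \<tau> \<tau>0 L by auto
      show "\<theta>2 s - (\<Sum>b\<in>(Basis::'a set). 0) \<le> max (\<theta> s) (if t1 \<le> s then L else 0) powr p"
      proof (cases "t1 \<le> s")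
        case False
        then show ?thesis using early[of s] by (simp add: \<theta>2_def)
      next
        case True
        have st: "s < t0" using s \<tau> by simp
        define z where "z = 1 - Q s"
        have z: "0 < z" "z \<le> 1" using Qlt[OF st] by (auto simp: z_def)
        have y01: "0 \<le> y s" "y s \<le> 1" using True R y1[OF st] by (auto simp: y_def)
        have y2: "(y s)\<^sup>2 \<le> 1" using y01 by (intro power_le_one) auto
        have "Q1 s \<le> 3 / R" unfolding Q1_def using y2 y01 R by (intro divide_right_mono) auto
        moreover have "0 \<le> Q1 s" unfolding Q1_def using R by simp
        ultimately have Q1s: "(Q1 s)\<^sup>2 \<le> 9 / R\<^sup>2"
          using power_mono[of "Q1 s" "3 / R" 2] by (simp add: power_divide)
        have Q2s: "Q2 s \<le> 6 / R\<^sup>2" "0 \<le> Q2 s" unfolding Q2_def using y01 R by (auto intro!: divide_right_mono)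
        have e: "- k - 1 - 1 = - (k * p)" using kp by simp
        have zp: "z powr (- k - 1) \<le> z powr (- k - 1 - 1)"
          using z by (intro powr_mono') auto
        have "k * (k + 1) * z powr (- k - 1 - 1) * (Q1 s)\<^sup>2 + k * z powr (- k - 1) * Q2 s
          \<le> k * (k + 1) * z powr (- k - 1 - 1) * (9 / R\<^sup>2) + k * z powr (- k - 1 - 1) * (6 / R\<^sup>2)"
          using k0 Q1s Q2s zp by (intro add_mono mult_mono mult_left_mono) auto
        also have "\<dots> = (9 * k * (k + 1) + 6 * k) / R\<^sup>2 * z powr (- k - 1 - 1)"
          by (simp add: algebra_simps add_divide_distrib)
        finally have "\<theta>2 s \<le> L * ((9 * k * (k + 1) + 6 * k) / R\<^sup>2 * z powr (- k - 1 - 1))"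
          unfolding \<theta>2_def z_def[symmetric] using L by (intro mult_left_mono) auto
        also have "\<dots> = (9 * k * (k + 1) + 6 * k) * L / R\<^sup>2 * z powr (- (k * p))"
          unfolding e by simp
        also have "\<dots> \<le> (L / 2) powr p * z powr (- (k * p))"
          using cond unfolding R_def by (intro mult_right_mono) auto
        also have "\<dots> = (L / 2 * z powr (- k)) powr p"
          using L z by (subst powr_mult) (simp_all add: powr_powr)
        \<comment> \<open>\<theta> + L equals L z^(-k), so the larger of \<theta> and the known
          bound L is at least half of it; hence the L/2 in \<open>cond\<close>.\<close>
        also have "\<dots> \<le> max (\<theta> s) L powr p"
        proof (rule powr_mono2)
          have "\<theta> s + L = L * z powr (- k)" by (simp add: \<theta>_def z_def algebra_simps)
          then show "L / 2 * z powr (- k) \<le> max (\<theta> s) L" by (simp add: max_def)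
        qed (use p L in auto)
        finally show ?thesis using True by simp
      qed
    qed
  qed
  have "continuous_on {0..t0} (u x0)"
    using C2_slabD(1)[OF slab[OF t(3)]] by (rule DERIV_continuous_on)
  then have "bounded (u x0 ` {0..t0})" by (intro compact_imp_bounded compact_continuous_image) auto
  then obtain M where M: "M > 0" "\<And>s. s \<in> {0..t0} \<Longrightarrow> \<bar>u x0 s\<bar> \<le> M"
    unfolding bounded_pos by auto
  \<comment> \<open>Chosen so that L (z^(-k) - 1) = M + L, above the bound M of u at x0; the time s
    below solves 1 - Q s = z.\<close>
  define z where "z = (M / L + 2) powr (- 1 / k)"
  have quot: "M / L > 0" using M L by simp
  have z: "0 < z" "z < 1"
  proof -
    show "0 < z" using quot by (simp add: z_def)
    have "z < (M / L + 2) powr 0" unfolding z_def using quot k0 by (intro powr_less_mono) (auto simp: divide_neg_pos)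
    then show "z < 1" using quot by simp
  qed
  define s where "s = t1 + R * (1 - z) powr (1 / 3)"
  have w: "0 < (1 - z) powr (1 / 3)" "(1 - z) powr (1 / 3) < 1"
  proof -
    show "0 < (1 - z) powr (1 / 3)" using z by simp
    have "(1 - z) powr (1 / 3) < 1 powr (1 / 3)" using z by (intro powr_less_mono2) auto
    then show "(1 - z) powr (1 / 3) < 1" by simp
  qed
  have "R * (1 - z) powr (1 / 3) < R * 1" using R w by (intro mult_strict_left_mono) auto
  moreover have "0 < R * (1 - z) powr (1 / 3)" using R w(1) by (rule mult_pos_pos)
  moreover have "t0 = t1 + R" by (simp add: R_def)
  ultimately have s: "t1 < s" "s < t0" unfolding s_def by linarith+
  have "y s = (1 - z) powr (1 / 3)" using R by (simp add: y_def s_def)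
  then have "Q s = ((1 - z) powr (1 / 3)) ^ 3" using w by (simp add: Q_def pos3_simps)
  also have "\<dots> = ((1 - z) powr (1 / 3)) powr 3" using w by (simp add: powr_numeral)
  also have "\<dots> = 1 - z" using z by (simp add: powr_powr)
  finally have "\<theta> s = L * (z powr (- k) - 1)" by (simp add: \<theta>_def)
  also have "z powr (- k) = M / L + 2" using k0 quot by (simp add: z_def powr_powr)
  also have "L * (M / L + 2 - 1) = M + L" using L by (simp add: field_simps)
  finally have "\<theta> s = M + L" .
  then show False using upper[OF s] M(2)[of s] s t L by auto
qed


section \<open>Combination of the three subsolutions\<close>

text \<open>\<open>growth\<close> is evaluated on a cone where X is comparable with E = exp (A -
  \<nu>/(2q)). There A - ln X \<le> s1 bounds N below independently of A, and Y \<ge> M X keeps the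
  cubed factor away from 0. In \<open>large'\<close> the quantity E has cancelled.\<close>

lemma no_long_solution:
  fixes c :: 'a
  assumes \<kappa>: "\<kappa> > 0" and \<gamma>: "\<gamma> > 0" and \<mu>: "\<mu> > 0" and A: "A \<ge> 2"
    and pq: "p * q = 1" and mq: "m * (p - 1) = 1 + q" and \<nu>: "\<nu> = 1 / (p - 1)" and k: "k = 2 / (p - 1)"
    and vel: "\<And>x. norm (x - c) \<le> 4 / \<kappa> \<Longrightarrow> \<gamma> \<le> ut x 0"
    and T: "exp A \<le> \<kappa> * T"
    and small: "12 * \<kappa>\<^sup>2 * q * (52 * \<mu> * (A / 2) powr (- \<nu>)) \<le> \<kappa> powr (1 + q) * (\<gamma> * (2 / \<kappa>) powr m / (18 * \<kappa>)) powr p"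
    and large: "12 * \<kappa>\<^sup>2 * q * \<nu> \<le> \<kappa> powr (1 + q) * \<mu> powr (p - 1) * 8 powr (- (3 - 2 * q)) * 2 powr (- (3 * p - 2))"
    and M: "M = 8 * 2 powr p" and \<omega>: "\<omega> = 1 / (2 * M)" and s1: "s1 = \<nu> / (2 * q) + ln (4 / \<omega>)"
    and E: "16 * M \<le> exp (A - \<nu> / (2 * q))"
    and large': "(9 * k * (k + 1) + 6 * k) * 2 powr p \<le>
      \<mu> powr (p - 1) * (\<kappa> powr m * s1 powr (- \<nu>) * 8 powr (- 3 * q - 1)) powr (p - 1) * (\<omega>\<^sup>2 / (64 * \<kappa>\<^sup>2))"
  shows False
proof -
  have q: "q > 0" using p pq by (smt (verit) zero_less_mult_iff)
  have \<nu>0: "\<nu> > 0" using p by (simp add: \<nu>)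
  define E where "E = exp (A - \<nu> / (2 * q))"
  have E0: "E > 0" "16 * M \<le> E" using E by (simp_all add: E_def)
  have M8: "M \<ge> 8"
  proof -
    have "2 powr 0 \<le> 2 powr p" using p by (intro powr_mono) auto
    then show ?thesis by (simp add: M)
  qed
  have w: "0 < \<omega>" "\<omega> \<le> 1 / 16" "\<omega> * M = 1 / 2" using M8 by (auto simp: \<omega> field_simps)
  \<comment> \<open>The latest time that \<open>growth\<close> admits.\<close>
  define tf where "tf = (E - 4) / \<kappa>"
  have ktf: "\<kappa> * tf = E - 4" using \<kappa> by (simp add: tf_def)
  have ktf': "\<kappa> * tf \<ge> 12 * M" "\<kappa> * tf \<ge> E / 2" using E0 M8 by (auto simp: ktf)
  have "0 < \<kappa> * tf" using ktf' M8 by linarith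
  then have tf: "tf > 0" using \<kappa> by (simp add: zero_less_mult_iff)
  have tfT: "tf < T"
  proof -
    have "E \<le> exp A" using \<nu>0 q by (simp add: E_def)
    then have "\<kappa> * tf < \<kappa> * T" using T ktf by linarith
    then show ?thesis using \<kappa> by simp
  qed
  define \<delta> where "\<delta> = \<gamma> * (2 / \<kappa>) powr m / (18 * \<kappa>)"
  have \<delta>: "\<delta> > 0" using \<gamma> \<kappa> by (simp add: \<delta>_def)
  have strip: "\<delta> * norm (x - c) powr (- m) \<le> u x t"
    if "2 / \<kappa> \<le> t" "t < T" "1 \<le> \<kappa> * (t - norm (x - c)) + 4" "\<kappa> * (t - norm (x - c)) + 4 \<le> 2" for x t
    unfolding \<delta>_def using strip_lower_bound[OF \<kappa> \<gamma> vel that] by simp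
  obtain b :: 'a where b: "b \<in> Basis" using nonempty_Basis by blast
  \<comment> \<open>The cone over this point sits just inside the light cone from c: with height
    \<omega> tf / 4 it keeps t - r between \<omega> tf / 2 and 5/4 \<omega> tf.\<close>
  define xb where "xb = c + ((1 - \<omega>) * tf) *\<^sub>R b"
  define t1 where "t1 = (1 - \<omega> / 4) * tf"
  have wtf: "\<omega> * tf > 0" using w tf by simp
  have wtf_le: "\<omega> * tf \<le> tf / 16" using w tf by (simp add: mult_right_mono)
  have t1: "0 < t1" "t1 < tf" "tf - t1 = \<omega> * tf / 4"
    using wtf wtf_le tf by (auto simp: t1_def algebra_simps)
  have nb: "norm (xb - c) = tf - \<omega> * tf"
  proof -
    have "xb - c = ((1 - \<omega>) * tf) *\<^sub>R b" by (simp add: xb_def)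
    then have "norm (xb - c) = \<bar>(1 - \<omega>) * tf\<bar>" using b by (simp only: norm_scaleR norm_Basis mult_1_right)
    then show ?thesis using wtf_le tf by (simp add: left_diff_distrib)
  qed
  have s1pos: "s1 > 0"
  proof -
    have "ln (4 / \<omega>) > 0" using w by (intro ln_gt_zero) (auto simp: field_simps)
    then show ?thesis using \<nu>0 q by (simp add: s1 add_pos_pos)
  qed
  define c5 where "c5 = \<kappa> powr m * s1 powr (- \<nu>) * 8 powr (- 3 * q - 1)"
  have c5: "c5 > 0" using \<kappa> s1pos by (simp add: c5_def)
  define L where "L = E powr (- m - q) * (\<mu> * c5)"
  have L: "L > 0" using E0 \<mu> c5 by (simp add: L_def)
  \<comment> \<open>At half of the maximum (8 X)^(-q) the cube reduces X^(2q) to X^(-q). The power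
    8^(-3q) comes from cubing, the further 1/8 from the halving.\<close>
  have pow_eq: "8 powr (- 3 * q - 1) * y powr (- q) = y powr (2 * q) * ((8 * y) powr (- q) / 2) ^ 3"
    if "y > 0" for y :: real
  proof -
    have "((8 * y) powr (- q) / 2) ^ 3 = ((8 * y) powr (- q)) powr 3 / 8"
      using that by (simp add: powr_numeral power_divide)
    also have "((8 * y) powr (- q)) powr 3 = 8 powr (- 3 * q) * y powr (- 3 * q)"
      using that by (simp add: powr_powr powr_mult mult.commute)
    finally have "y powr (2 * q) * ((8 * y) powr (- q) / 2) ^ 3 =
        8 powr (- 3 * q) / 8 * (y powr (2 * q) * y powr (- 3 * q))" by simp
    also have "y powr (2 * q) * y powr (- 3 * q) = y powr (- q)"
      unfolding powr_add[symmetric] by simp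
    also have "8 powr (- 3 * q) / 8 = 8 powr (- 3 * q - 1)" by (simp add: powr_diff)
    finally show ?thesis by simp
  qed
  have big: "L \<le> u x t" if t: "t1 \<le> t" "t \<le> tf" and x: "norm (x - xb) \<le> tf - t" for x t
  proof -
    let ?r = "norm (x - c)"
    let ?X = "\<kappa> * (t - ?r) + 4" and ?Y = "\<kappa> * (t + ?r)"
    have xr: "norm (x - xb) \<le> \<omega> * tf / 4" using x t t1 by simp
    have r1: "?r \<le> tf - \<omega> * tf + \<omega> * tf / 4"
      using norm_triangle_ineq[of "x - xb" "xb - c"] xr nb by simp
    have r2: "?r \<ge> tf - \<omega> * tf - \<omega> * tf / 4"
      using norm_triangle_ineq[of "xb - x" "x - c"] xr nb by (simp add: norm_minus_commute)
    have t0: "t > 0" "t < T" using t t1 tfT by auto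
    have r0: "?r > 0" using r2 wtf_le tf by linarith
    have tr: "t - ?r \<ge> \<omega> * tf / 2" "t - ?r \<le> 5 / 4 * (\<omega> * tf)" using r1 r2 t t1 by linarith+
    have kw: "\<kappa> * (\<omega> * tf) = \<omega> * (\<kappa> * tf)" by simp
    have Xlow: "?X \<ge> \<omega> * (\<kappa> * tf) / 2 + 4"
      using mult_left_mono[OF tr(1), of \<kappa>] \<kappa> kw by simp
    have Xup: "?X \<le> 5 / 4 * (\<omega> * (\<kappa> * tf)) + 4"
      using mult_left_mono[OF tr(2), of \<kappa>] \<kappa> kw by simp
    have wk: "\<omega> * (\<kappa> * tf) > 0" using w \<open>0 < \<kappa> * tf\<close> by simp
    have X2: "?X \<ge> 2" using Xlow wk by linarith
    have XE: "?X \<le> E"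
    proof -
      have "\<kappa> * (t - ?r) \<le> \<kappa> * tf" using t r0 \<kappa> by (intro mult_left_mono) linarith+
      then show ?thesis using ktf by simp
    qed
    \<comment> \<open>By \<omega> M = 1/2 the left side is at most 5/8 \<kappa> tf + 4 M; assumption
      \<open>E\<close> yields \<kappa> tf \<ge> 12 M, enough to absorb 4 M.\<close>
    have MX: "M * ?X \<le> ?Y"
    proof -
      have "M * ?X \<le> M * (5 / 4 * (\<omega> * (\<kappa> * tf)) + 4)" using Xup M8 by (intro mult_left_mono) auto
      also have "\<dots> = 5 / 4 * ((\<omega> * M) * (\<kappa> * tf)) + 4 * M" by (simp add: algebra_simps)
      also have "\<dots> = 5 / 8 * (\<kappa> * tf) + 4 * M" unfolding w(3) by simp
      also have "\<dots> \<le> \<kappa> * tf" using ktf' M8 by linarith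
      also have "\<dots> \<le> ?Y" using r2 t t1 wtf_le tf \<kappa> by (intro mult_left_mono) linarith+
      finally show ?thesis .
    qed
    \<comment> \<open>The factor 2^p in M is there because (2^p)^(-q) = 1/2.\<close>
    have half: "?Y powr (- q) \<le> (8 * ?X) powr (- q) / 2"
    proof -
      have "?Y powr (- q) \<le> (M * ?X) powr (- q)"
        using MX M8 X2 q by (intro powr_mono2') auto
      also have "\<dots> = (8 * ?X * 2 powr p) powr (- q)" unfolding M by (simp only: mult_ac)
      also have "\<dots> = (8 * ?X) powr (- q) * (2 powr p) powr (- q)" by (rule powr_mult)
      also have "(2 powr p) powr (- q) = 1 / 2" using pq by (simp add: powr_powr powr_minus_divide)
      finally show ?thesis by simp
    qed
    define f where "f = (8 * ?X) powr (- q) - ?Y powr (- q)"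
    have f: "f \<ge> (8 * ?X) powr (- q) / 2" using half by (simp add: f_def)
    have lnX: "A - ln ?X \<le> s1" "A - ln ?X > 0"
    proof -
      have "\<omega> * E / 4 \<le> ?X"
      proof -
        have "\<omega> * (E / 2) \<le> \<omega> * (\<kappa> * tf)" using ktf'(2) w by (intro mult_left_mono) auto
        then show ?thesis using Xlow by simp
      qed
      then have "ln (\<omega> * E / 4) \<le> ln ?X" using w E0 by (intro ln_mono) auto
      moreover have "ln (\<omega> * E / 4) = ln E - ln (4 / \<omega>)"
        using w E0 by (simp add: ln_div ln_mult)
      moreover have "ln E = A - \<nu> / (2 * q)" by (simp add: E_def)
      ultimately show "A - ln ?X \<le> s1" by (simp add: s1)
      have "ln ?X \<le> ln E" using XE X2 by (intro ln_mono) auto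
      moreover have "\<nu> / (2 * q) > 0" using \<nu>0 q by simp
      ultimately show "A - ln ?X > 0" using \<open>ln E = A - \<nu> / (2 * q)\<close> by linarith
    qed
    have rE: "?r \<le> E / \<kappa>"
    proof -
      have "?r \<le> tf" using r1 wtf by linarith
      also have "\<dots> \<le> E / \<kappa>" using \<kappa> by (simp add: tf_def divide_right_mono)
      finally show ?thesis .
    qed
    have "L = E powr (- m) * \<kappa> powr m * (\<mu> * s1 powr (- \<nu>) * (8 powr (- 3 * q - 1) * E powr (- q)))"
      by (simp add: L_def c5_def powr_diff powr_minus field_simps)
    also have "E powr (- m) * \<kappa> powr m = (E / \<kappa>) powr (- m)"
      using E0 \<kappa> by (simp add: powr_divide powr_minus field_simps)
    also have "(E / \<kappa>) powr (- m) * (\<mu> * s1 powr (- \<nu>) * (8 powr (- 3 * q - 1) * E powr (- q)))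
      \<le> ?r powr (- m) * (\<mu> * (A - ln ?X) powr (- \<nu>) * (8 powr (- 3 * q - 1) * ?X powr (- q)))"
      using rE r0 m \<mu> lnX \<nu>0 q XE X2
      by (intro mult_mono mult_left_mono powr_mono2' mult_nonneg_nonneg) auto
    also have "8 powr (- 3 * q - 1) * ?X powr (- q) = ?X powr (2 * q) * ((8 * ?X) powr (- q) / 2) ^ 3"
      using X2 by (intro pow_eq) linarith
    also have "\<mu> * (A - ln ?X) powr (- \<nu>) * (?X powr (2 * q) * ((8 * ?X) powr (- q) / 2) ^ 3)
      = log_profile q \<nu> A \<mu> ?X * ((8 * ?X) powr (- q) / 2) ^ 3"
      by (simp only: log_profile_def mult.assoc)
    also have "?r powr (- m) * (log_profile q \<nu> A \<mu> ?X * ((8 * ?X) powr (- q) / 2) ^ 3)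
      \<le> ?r powr (- m) * (log_profile q \<nu> A \<mu> ?X * f ^ 3)"
      using f \<mu> by (intro mult_left_mono power_mono) (auto simp: log_profile_def)
    also have "\<dots> \<le> u x t"
      unfolding f_def
    proof (rule growth[OF \<kappa> \<delta> \<mu> A pq mq \<nu> strip _ large t0 _ X2])
      show "12 * \<kappa>\<^sup>2 * q * (52 * \<mu> * (A / 2) powr (- \<nu>)) \<le> \<kappa> powr (1 + q) * \<delta> powr p"
        using small by (simp add: \<delta>_def)
      have "\<kappa> * t \<le> \<kappa> * tf" using t \<kappa> by (intro mult_left_mono) auto
      then show "\<kappa> * t + 4 \<le> exp (A - \<nu> / (2 * q))" using ktf by (simp add: E_def)
      show "?Y powr (- q) \<le> (8 * ?X) powr (- q)" using half powr_ge_zero[of "8 * ?X" "- q"] by linarith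
    qed
    finally show ?thesis .
  qed
  show False
  proof (rule blowup[OF t1(1,2) tfT L big k])
    \<comment> \<open>Scale invariance: L^(p-1) is proportional to E^(-2), while the squared height
      of the cone is at least a constant times E^2.\<close>
    have mq2: "(- m - q) * (p - 1) = - 2" using mq pq by (simp add: algebra_simps)
    have Lp: "L powr (p - 1) = E powr (- 2) * (\<mu> powr (p - 1) * c5 powr (p - 1))"
      using E0 \<mu> c5 unfolding L_def by (simp add: powr_mult powr_powr mq2)
    have "\<omega> * E / (8 * \<kappa>) \<le> \<omega> * tf / 4"
    proof -
      have "E / (2 * \<kappa>) \<le> tf" using ktf'(2) \<kappa> by (simp add: field_simps)
      then have "\<omega> * (E / (2 * \<kappa>)) \<le> \<omega> * tf" using w by (intro mult_left_mono) auto
      then have "\<omega> * (E / (2 * \<kappa>)) / 4 \<le> \<omega> * tf / 4" by (rule divide_right_mono) simp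
      moreover have "\<omega> * E / (8 * \<kappa>) = \<omega> * (E / (2 * \<kappa>)) / 4" by simp
      ultimately show ?thesis by (simp only:)
    qed
    then have R: "(\<omega> * E / (8 * \<kappa>))\<^sup>2 \<le> (tf - t1)\<^sup>2"
      unfolding t1(3) using w E0 \<kappa> by (intro power_mono) auto
    have "(9 * k * (k + 1) + 6 * k) * 2 powr p \<le> \<mu> powr (p - 1) * c5 powr (p - 1) * (\<omega>\<^sup>2 / (64 * \<kappa>\<^sup>2))"
      using large' by (simp only: c5_def)
    also have "\<dots> = L powr (p - 1) * (\<omega> * E / (8 * \<kappa>))\<^sup>2"
      unfolding Lp using E0 by (simp add: powr_minus_divide powr_numeral power_divide power_mult_distrib)
    also have "\<dots> \<le> L powr (p - 1) * (tf - t1)\<^sup>2" by (intro mult_left_mono R) auto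
    finally have main: "(9 * k * (k + 1) + 6 * k) * 2 powr p \<le> L powr (p - 1) * (tf - t1)\<^sup>2" .
    have "(L / 2) powr p = L * L powr (p - 1) / 2 powr p"
      using L by (simp add: powr_divide powr_mult_base)
    moreover have "(9 * k * (k + 1) + 6 * k) * L / (tf - t1)\<^sup>2 \<le> L * L powr (p - 1) / 2 powr p"
    proof -
      have D: "(tf - t1)\<^sup>2 > 0" using t1 by simp
      have "9 * k * (k + 1) + 6 * k \<le> L powr (p - 1) * (tf - t1)\<^sup>2 / 2 powr p"
        using main by (simp only: pos_le_divide_eq powr_gt_zero)
      then have "(9 * k * (k + 1) + 6 * k) * L / (tf - t1)\<^sup>2 \<le>
          (L powr (p - 1) * (tf - t1)\<^sup>2 / 2 powr p) * L / (tf - t1)\<^sup>2"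
        using L D by (intro divide_right_mono mult_right_mono) auto
      also have "\<dots> = L * L powr (p - 1) / 2 powr p" using D by simp
      finally show ?thesis .
    qed
    ultimately show "(9 * k * (k + 1) + 6 * k) * L / (tf - t1)\<^sup>2 \<le> (L / 2) powr p" by (simp only:)
  qed
qed

end

section \<open>The critical exponent and the choice of constants\<close>

text \<open>Division of \<open>strauss_gamma n p = 0\<close> by p. It shows that q = m p - m - 1
  equals 1/p at the critical exponent, which supplies both \<open>pq\<close> and \<open>mq\<close>
  of the growth estimate.\<close>

lemma strauss_exponent_identities:
  fixes n :: nat and m p :: real
  assumes n: "n \<in> {2, 3}" and p: "p = strauss_exponent n" and m: "m = (real n - 1) / 2"
  shows "p > 1" and "m * (p - 1) = 1 + 1 / p"
proof -
  have n2: "n \<ge> 2" using n by auto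
  have "p > 0"
    unfolding p strauss_exponent_def using n
    by (intro divide_pos_pos add_pos_nonneg real_sqrt_ge_zero) auto
  then have "strauss_gamma n p = 0" using strauss_gamma_eq_0_iff[OF n2] p by blast
  then have "1 + (m + 1) * p - m * p\<^sup>2 = 0"
    unfolding strauss_gamma_def m by (simp add: field_simps)
  then show mp: "m * (p - 1) = 1 + 1 / p"
    using \<open>p > 0\<close> by (simp add: field_simps power2_eq_square)
  have "0 < m" "m \<le> 1" using n by (auto simp: m)
  show "p > 1"
  proof (rule ccontr)
    assume "\<not> p > 1"
    then have "m * (p - 1) \<le> 0" using \<open>0 < m\<close> by (intro mult_nonneg_nonpos) auto
    moreover have "1 / p > 0" using \<open>p > 0\<close> by simp
    ultimately show False using mp by linarith
  qed
qed

theorem theorem2p1: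
  fixes n :: nat and p :: real and f g :: "real ^ 'n \<Rightarrow> real"
  assumes "n \<in> {2, 3}" and "CARD('n) = n"
    and "p = strauss_exponent n"
    and "smooth f" and "smooth g"
    and "\<forall>x. f x = 0"
    and "\<forall>x. g x \<ge> 0" and "\<exists>x. g x \<noteq> 0"
  shows "\<exists>\<epsilon>0 > 0. \<exists>C > 0. \<forall>\<epsilon> T. 0 < \<epsilon> \<and> \<epsilon> \<le> \<epsilon>0 \<and> T > exp (C * \<epsilon> powr (- p * (p - 1))) \<longrightarrow>
    \<not> (\<exists>u. classical_solution p T (\<lambda>x. \<epsilon> * f x) (\<lambda>x. \<epsilon> * g x) u)"
proof -
  define m where "m = (real n - 1) / 2"
  define q where "q = 1 / p"
  define \<nu> where "\<nu> = 1 / (p - 1)"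
  define k where "k = 2 / (p - 1)"
  have p: "p > 1" and mq: "m * (p - 1) = 1 + q"
    using strauss_exponent_identities[OF assms(1,3) m_def] by (auto simp: q_def)
  have pq: "p * q = 1" and q: "q > 0" and \<nu>0: "\<nu> > 0" and k0: "k > 0"
    using p by (auto simp: q_def \<nu>_def k_def)
  have dim: "DIM(real ^ 'n) \<in> {2, 3}" "DIM(real ^ 'n) = 2 * m + 1"
    using assms(1,2) by (auto simp: m_def)

  obtain c where c: "g c > 0" using assms(7,8) by (metis order_le_less)
  have "Ck_on 0 g UNIV" using assms(5) unfolding smooth_def by blast
  then have "continuous_on UNIV g" by simp
  then have "isCont g c" by (simp add: continuous_on_eq_continuous_at)
  then obtain d where d: "d > 0" "\<And>x. dist x c < d \<Longrightarrow> dist (g x) (g c) < g c / 2"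
    unfolding continuous_at_eps_delta using c half_gt_zero by metis
  \<comment> \<open>Then 4/\<kappa> = d/2, inside the ball where g exceeds half of its value at
    c.\<close>
  define \<kappa> where "\<kappa> = 8 / d"
  define g0 where "g0 = g c / 2"
  have \<kappa>: "\<kappa> > 0" and g0: "g0 > 0" using d c by (auto simp: \<kappa>_def g0_def)
  have g_low: "g0 \<le> g x" if "norm (x - c) \<le> 4 / \<kappa>" for x
  proof -
    have "dist x c < d" using that d(1) by (simp add: \<kappa>_def dist_norm)
    then have "dist (g x) (g c) < g c / 2" by (rule d(2))
    then show ?thesis unfolding g0_def dist_real_def by linarith
  qed

  define M where "M = 8 * 2 powr p"
  define \<omega> where "\<omega> = 1 / (2 * M)"
  define s1 where "s1 = \<nu> / (2 * q) + ln (4 / \<omega>)"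
  define c5 where "c5 = (\<kappa> powr m * s1 powr (- \<nu>) * 8 powr (- 3 * q - 1)) powr (p - 1) * (\<omega>\<^sup>2 / (64 * \<kappa>\<^sup>2))"
  have M: "M \<ge> 8"
  proof -
    have "2 powr 0 \<le> 2 powr p" using p by (intro powr_mono) auto
    then show ?thesis by (simp add: M_def)
  qed
  have \<omega>: "\<omega> > 0" "\<omega> \<le> 1" using M by (auto simp: \<omega>_def field_simps)
  have s1: "s1 > 0"
  proof -
    have "ln (4 / \<omega>) > 0" using \<omega> by (intro ln_gt_zero) (auto simp: field_simps)
    then show ?thesis using \<nu>0 q by (simp add: s1_def add_pos_pos)
  qed
  have c5: "c5 > 0" using \<kappa> s1 \<omega> by (simp add: c5_def)
  define c3 where "c3 = \<kappa> powr (1 + q) * (8 powr (- (3 - 2 * q)) * 2 powr (- (3 * p - 2)))"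
  have c3: "c3 > 0" using \<kappa> by (simp add: c3_def)
  \<comment> \<open>This will be \<mu>^(p-1). The two quotients are the lower bounds demanded by
    \<open>large\<close> and \<open>large'\<close>; neither involves \<epsilon>.\<close>
  define a where "a = max 1 (max (12 * \<kappa>\<^sup>2 * q * \<nu> / c3) ((9 * k * (k + 1) + 6 * k) * 2 powr p / c5))"
  define \<mu> where "\<mu> = a powr (1 / (p - 1))"
  have a: "a > 0" by (simp add: a_def)
  have \<mu>: "\<mu> > 0" using a by (simp add: \<mu>_def)
  have \<mu>a: "\<mu> powr (p - 1) = a" using p a by (simp add: \<mu>_def powr_powr)
  have "12 * \<kappa>\<^sup>2 * q * \<nu> / c3 \<le> a" by (simp add: a_def)
  then have "12 * \<kappa>\<^sup>2 * q * \<nu> \<le> a * c3" using c3 by (simp only: pos_divide_le_eq)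
  then have large: "12 * \<kappa>\<^sup>2 * q * \<nu> \<le> \<kappa> powr (1 + q) * \<mu> powr (p - 1) * 8 powr (- (3 - 2 * q)) * 2 powr (- (3 * p - 2))"
    unfolding \<mu>a c3_def by (simp only: mult_ac)
  have "(9 * k * (k + 1) + 6 * k) * 2 powr p / c5 \<le> a" by (simp add: a_def)
  then have "(9 * k * (k + 1) + 6 * k) * 2 powr p \<le> a * c5" using c5 by (simp only: pos_divide_le_eq)
  then have large': "(9 * k * (k + 1) + 6 * k) * 2 powr p \<le>
      \<mu> powr (p - 1) * (\<kappa> powr m * s1 powr (- \<nu>) * 8 powr (- 3 * q - 1)) powr (p - 1) * (\<omega>\<^sup>2 / (64 * \<kappa>\<^sup>2))"
    unfolding \<mu>a c5_def by (simp only: mult.assoc)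

  define c6 where "c6 = g0 * (2 / \<kappa>) powr m / (18 * \<kappa>)"
  have c6: "c6 > 0" using g0 \<kappa> by (simp add: c6_def)
  \<comment> \<open>Here 624 is the product of 12 and 52. Condition \<open>small\<close> says that
    (A/2)^\<nu> is at least D \<epsilon>^(-p); taking A/2 = (D \<epsilon>^(-p))^(p-1) makes it an
    equality and produces the exponent -p (p - 1) of the lifespan.\<close>
  define D where "D = 624 * \<kappa>\<^sup>2 * q * \<mu> / (\<kappa> powr (1 + q) * c6 powr p)"
  have D: "D > 0" using \<kappa> q \<mu> c6 by (simp add: D_def)
  define CA where "CA = 2 * D powr (p - 1)"
  have CA: "CA > 0" using D by (simp add: CA_def)
  \<comment> \<open>The entry 2 is the hypothesis on A, the other one is the logarithm of assumption
    \<open>E\<close>.\<close>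
  define Amin where "Amin = max 2 (\<nu> / (2 * q) + ln (16 * M))"
  define e where "e = p * (p - 1)"
  have e: "e > 0" using p by (simp add: e_def)
  \<comment> \<open>The second entry guarantees CA \<epsilon>^(-e) \<ge> Amin; the entry 1 gives
    \<epsilon>^(-e) \<ge> 1.\<close>
  define \<epsilon>0 where "\<epsilon>0 = min 1 ((Amin / CA) powr (- 1 / e))"
  \<comment> \<open>The requirement is exp A \<le> \<kappa> T rather than exp A \<le> T; the added
    modulus of ln \<kappa> pays for the factor \<kappa>, since \<epsilon>^(-e) \<ge> 1.\<close>
  define C where "C = CA + \<bar>ln \<kappa>\<bar>"
  have Amin: "Amin / CA > 0" using CA by (simp add: Amin_def)
  have \<epsilon>0: "\<epsilon>0 > 0" using Amin CA by (simp add: \<epsilon>0_def Amin_def)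
  have C: "C > 0" using CA by (simp add: C_def)
  have "\<not> classical_solution p T (\<lambda>x. \<epsilon> * f x) (\<lambda>x. \<epsilon> * g x) u"
    if \<epsilon>: "0 < \<epsilon>" "\<epsilon> \<le> \<epsilon>0" and T: "T > exp (C * \<epsilon> powr (- p * (p - 1)))" for \<epsilon> T u
  proof
    assume sol: "classical_solution p T (\<lambda>x. \<epsilon> * f x) (\<lambda>x. \<epsilon> * g x) u"
    define A where "A = CA * \<epsilon> powr (- e)"
    have ee: "- p * (p - 1) = - e" by (simp add: e_def)
    have "1 powr (- e) \<le> \<epsilon> powr (- e)" using \<epsilon> e by (intro powr_mono2') (auto simp: \<epsilon>0_def)
    then have eps1: "1 \<le> \<epsilon> powr (- e)" by simp
    have "- 1 / e * - e = 1" using e by simp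
    then have "Amin / CA = ((Amin / CA) powr (- 1 / e)) powr (- e)"
      by (simp only: powr_powr powr_one[OF less_imp_le[OF Amin]])
    also have "\<dots> \<le> \<epsilon> powr (- e)" using \<epsilon> e Amin by (intro powr_mono2') (auto simp: \<epsilon>0_def)
    finally have "Amin \<le> A" using CA by (simp add: A_def pos_divide_le_eq mult.commute)
    then have A: "A \<ge> 2" "\<nu> / (2 * q) + ln (16 * M) \<le> A" by (auto simp: Amin_def)
    have E: "16 * M \<le> exp (A - \<nu> / (2 * q))"
    proof -
      have "exp (ln (16 * M)) \<le> exp (A - \<nu> / (2 * q))" using A(2) by simp
      then show ?thesis using M by simp
    qed
    have "\<bar>ln \<kappa>\<bar> * 1 \<le> \<bar>ln \<kappa>\<bar> * \<epsilon> powr (- e)" using eps1 by (intro mult_left_mono) auto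
    then have "A \<le> ln \<kappa> + C * \<epsilon> powr (- e)" by (simp add: A_def C_def algebra_simps)
    then have "exp A \<le> exp (ln \<kappa> + C * \<epsilon> powr (- e))" by (simp only: exp_le_cancel_iff)
    also have "\<dots> = \<kappa> * exp (C * \<epsilon> powr (- e))" using \<kappa> by (simp add: exp_add)
    also have "\<dots> \<le> \<kappa> * T" using T \<kappa> unfolding ee by (intro mult_left_mono) auto
    finally have expA: "exp A \<le> \<kappa> * T" .
    have T0: "T > 0" using T exp_gt_zero order_less_trans by blast
    obtain ut utt ub ubb where
      slab: "\<forall>\<tau><T. C2_slab \<tau> (\<lambda>x t. u (x, t)) ut utt ub ubb"
      and eq: "\<forall>x. \<forall>t\<in>{0<..<T}. utt x t - (\<Sum>b\<in>Basis. ubb b x t) = \<bar>u (x, t)\<bar> powr p"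
      and uinit: "\<forall>x. u (x, 0) = \<epsilon> * f x" "\<forall>x. ut x 0 = \<epsilon> * g x"
      by (rule classical_solution_C2_slab[OF sol T0])
    interpret semilinear_wave m p T "\<lambda>x t. u (x, t)" ut utt ub ubb
      by unfold_locales (use dim p slab eq uinit assms(6,7) \<epsilon> in auto)
    show False
    proof (rule no_long_solution[where c = c, OF \<kappa> _ \<mu> A(1) pq mq \<nu>_def k_def _ expA _ large M_def \<omega>_def s1_def E large'])
      show "0 < \<epsilon> * g0" using \<epsilon> g0 by simp
      show "\<epsilon> * g0 \<le> ut x 0" if "norm (x - c) \<le> 4 / \<kappa>" for x
        using g_low[OF that] uinit(2) \<epsilon> by simp
      define \<delta> where "\<delta> = \<epsilon> * c6"
      have \<delta>: "\<delta> > 0" using \<epsilon> c6 by (simp add: \<delta>_def)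
      have Dd: "D * \<epsilon> powr (- p) = 624 * \<kappa>\<^sup>2 * q * \<mu> / (\<kappa> powr (1 + q) * \<delta> powr p)"
        by (simp add: D_def \<delta>_def powr_mult powr_minus_divide mult_ac)
      have "A / 2 = (D * \<epsilon> powr (- p)) powr (p - 1)"
        using \<epsilon> D by (simp add: A_def CA_def powr_mult powr_powr e_def)
      moreover have "(p - 1) * (- \<nu>) = - 1" using p by (simp add: \<nu>_def)
      ultimately have "(A / 2) powr (- \<nu>) = 1 / (D * \<epsilon> powr (- p))"
        using \<epsilon> D by (simp only: powr_powr) (simp add: powr_minus_divide)
      then have "12 * \<kappa>\<^sup>2 * q * (52 * \<mu> * (A / 2) powr (- \<nu>)) = \<kappa> powr (1 + q) * \<delta> powr p"
        unfolding Dd using \<kappa> q \<mu> \<delta> by simp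
      then show "12 * \<kappa>\<^sup>2 * q * (52 * \<mu> * (A / 2) powr (- \<nu>)) \<le>
          \<kappa> powr (1 + q) * (\<epsilon> * g0 * (2 / \<kappa>) powr m / (18 * \<kappa>)) powr p"
        by (simp add: \<delta>_def c6_def mult_ac)
    qed
  qed
  then show ?thesis using \<epsilon>0 C by blast
qed

end
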